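(* There are at least $36$ pairwise non-isomorphic minor minimal not apex (MMNA) graphs.
   Context: Graphs are finite, simple, undirected and have at least one vertex. A graph $H$ is a minor of $G$ if $H$ can be obtained by contracting edges in a subgraph of $G$ (after a contraction, doubled edges are replaced by a single edge so that the graph stays simple); a minor of $G$ is proper if it is not $G$ itself. $G-v$ is the graph obtained by deleting the vertex $v$ and its incident edges. A graph $G$ is not apex (NA) if $G-v$ is nonplanar for every vertex $v$. A graph is MMNA (minor minimal NA) if it is NA and no proper minor of it is NA. *)

theory Defs
  imports "HOL-Analysis.Analysis"
begin

datatype 'a graph = Graph (verts: "'a set") (edges: "'a set set")

definition simple_graph :: "'a graph \<Rightarrow> bool" where
  "simple_graph G \<longleftrightarrow> finite (verts G) \<and> verts G \<noteq> {} \<and>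
     (\<forall>e\<in>edges G. e \<subseteq> verts G \<and> card e = 2)"

definition graph_iso :: "'a graph \<Rightarrow> 'b graph \<Rightarrow> bool" where
  "graph_iso G H \<longleftrightarrow> (\<exists>f. bij_betw f (verts G) (verts H) \<and> edges H = (`) f ` edges G)"

definition delete_vertex :: "'a graph \<Rightarrow> 'a \<Rightarrow> 'a graph" where
  "delete_vertex G v = Graph (verts G - {v}) {e \<in> edges G. v \<notin> e}"

definition subgraph :: "'a graph \<Rightarrow> 'a graph \<Rightarrow> bool" where
  "subgraph H G \<longleftrightarrow> simple_graph H \<and> verts H \<subseteq> verts G \<and> edges H \<subseteq> edges G"

text \<open>Contraction of the edge \<open>{u, v}\<close>; the new vertex is named \<open>u\<close>.
  Edges that become parallel are identified because edges form a set of vertex pairs.\<close>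

definition contract_edge :: "'a \<Rightarrow> 'a \<Rightarrow> 'a graph \<Rightarrow> 'a graph" where
  "contract_edge u v G =
     Graph (verts G - {v})
           ((`) (\<lambda>x. if x = v then u else x) ` (edges G - {{u, v}}))"

definition contracts :: "'a graph \<Rightarrow> 'a graph \<Rightarrow> bool" where
  "contracts G H \<longleftrightarrow> (\<exists>u v. u \<noteq> v \<and> {u, v} \<in> edges G \<and> H = contract_edge u v G)"

text \<open>Minors are taken up to isomorphism, so ``not \<open>G\<close> itself'' means not isomorphic to \<open>G\<close>.\<close>

definition minor :: "'a graph \<Rightarrow> 'a graph \<Rightarrow> bool" where
  "minor H G \<longleftrightarrow> (\<exists>S K. subgraph S G \<and> contracts\<^sup>*\<^sup>* S K \<and> graph_iso K H)"

definition proper_minor :: "'a graph \<Rightarrow> 'a graph \<Rightarrow> bool" where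
  "proper_minor H G \<longleftrightarrow> minor H G \<and> \<not> graph_iso H G"

text \<open>Planarity: a crossing-free drawing in the plane (here the type of complex numbers), with
  vertices drawn as distinct points and each edge as an arc joining its two ends.
  Nonemptiness is not required, so deleting the vertex of a one-vertex graph leaves a planar graph.\<close>

definition plane_drawing :: "'a graph \<Rightarrow> ('a \<Rightarrow> complex) \<Rightarrow> ('a set \<Rightarrow> real \<Rightarrow> complex) \<Rightarrow> bool" where
  "plane_drawing G p \<gamma> \<longleftrightarrow>
     inj_on p (verts G) \<and>
     (\<forall>e\<in>edges G. arc (\<gamma> e) \<and> {pathstart (\<gamma> e), pathfinish (\<gamma> e)} = p ` e) \<and>
     (\<forall>e\<in>edges G. \<forall>v\<in>verts G. p v \<in> path_image (\<gamma> e) \<longrightarrow> v \<in> e) \<and>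
     (\<forall>e\<in>edges G. \<forall>e'\<in>edges G. e \<noteq> e' \<longrightarrow>
        path_image (\<gamma> e) \<inter> path_image (\<gamma> e') \<subseteq> p ` (e \<inter> e'))"

definition planar :: "'a graph \<Rightarrow> bool" where
  "planar G \<longleftrightarrow> (\<exists>p \<gamma>. plane_drawing G p \<gamma>)"

definition NA :: "'a graph \<Rightarrow> bool" where
  "NA G \<longleftrightarrow> simple_graph G \<and> (\<forall>v\<in>verts G. \<not> planar (delete_vertex G v))"

definition MMNA :: "'a graph \<Rightarrow> bool" where
  "MMNA G \<longleftrightarrow> NA G \<and> (\<forall>H. proper_minor H G \<longrightarrow> \<not> NA H)"

end

(* Contracting an edge of a plane drawing again gives a plane drawing, because the complement of an
   arc in the plane is homeomorphic to a punctured plane. Hence apex graphs are closed under minors,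
   and an NA graph without isolated vertices is MMNA as soon as each single edge deletion and each
   single edge contraction makes it apex. These finitely many conditions are certified for explicit
   graphs: nonplanarity by a K5 or K33 minor, planarity by a two-page book embedding. K5 and K33 are
   nonplanar since crossing chords of a cycle lie on different sides of it, by the Jordan curve
   theorem. Degree sequences show that the graphs are pairwise non-isomorphic. *)
theory Submission
  imports Defs "HOL-Complex_Analysis.Riemann_Mapping"
begin

subsection \<open>Contraction preserves planarity\<close>

text \<open>Drawings consist of arbitrary continuous arcs, so a contracted edge cannot be shrunk by
  a local redrawing; the whole complement of its arc is reparametrised at once, which is what the
  Riemann mapping theorem is for. The result serves in two directions: forwards it carries planarity
  of \<open>G - w\<close> to contractions, backwards it lets a few contractions certify
  nonplanarity, so that only two graphs need a direct topological argument. Planarity must be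
  witnessed by an actual drawing. In a two-page book the vertices lie on a line, and with parabolas
  as arcs the absence of crossings becomes a comparison of integer intervals. Only subgraphs of
  Hamiltonian planar graphs have such drawings, but the free choice of the apex leaves enough room
  for the graphs below. Isolated vertices are excluded because dropping one is a proper minor that
  involves no edge. Different degree sequences replace isomorphism tests for 630 pairs of
  graphs.\<close>

text \<open>After an inversion at its starting point the complement of an arc, together with infinity,
  becomes a simply connected open set, hence homeomorphic to the plane. Inverting back, the
  complement of the arc is a punctured plane, and the puncture stands for the collapsed arc.\<close>

lemma arc_collapse:
  fixes g :: "real \<Rightarrow> complex"
  assumes "arc g"
  obtains h where "continuous_on (- path_image g) h" "inj_on h (- path_image g)"
    "\<And>z. z \<notin> path_image g \<Longrightarrow> h z \<noteq> (0::complex)"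
    "\<And>z. z \<in> path_image g \<Longrightarrow> (h \<longlongrightarrow> 0) (at z within - path_image g)"
proof -
  define A where "A = path_image g"
  define a where "a = pathstart g"
  define f where "f = (\<lambda>z. inverse (z - a))"
  \<comment> \<open>Since \<open>inverse 0 = 0\<close>, \<open>f\<close> is a bijection of the plane
    with \<open>f a = 0\<close>. The point 0 of \<open>S\<close> thus stands for infinity, while the
    start \<open>a\<close> of the arc has been sent to infinity.\<close>
  define S where "S = f ` (insert a (- A))"
  have aA: "a \<in> A" unfolding A_def a_def by (rule pathstart_in_path_image)
  have cA: "compact A" and conA: "connected A"
    using assms by (simp_all add: A_def compact_arc_image connected_arc_image)
  have fa: "f a = 0" by (simp add: f_def)
  have finj: "f x = f y \<longleftrightarrow> x = y" for x y by (simp add: f_def)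
  have contf: "continuous_on T f" if "a \<notin> T" for T
    unfolding f_def using that by (auto intro!: continuous_intros)
  have S_mem: "f z \<in> S \<longleftrightarrow> z = a \<or> z \<notin> A" for z
    by (auto simp: S_def finj)
  have fsurj: "\<exists>z. w = f z" for w
    by (rule exI[of _ "a + inverse w"]) (simp add: f_def)
  have compS: "- S = f ` (A - {a})"
  proof -
    have "w \<in> - S \<longleftrightarrow> w \<in> f ` (A - {a})" for w
      using fsurj[of w] aA by (auto simp: S_mem finj)
    then show ?thesis by blast
  qed
  obtain B where B: "B > 0" "\<And>z. z \<in> A \<Longrightarrow> norm (z - a) \<le> B"
  proof -
    have "bounded ((\<lambda>z. z - a) ` A)"
      using compact_imp_bounded[OF cA] bounded_translation_minus by blast
    then show ?thesis using that unfolding bounded_pos by auto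
  qed
  have "closed (- S)"
  proof -
    \<comment> \<open>\<open>B\<close> bounds the distance of points of \<open>A\<close> from
      \<open>a\<close>, so their images other than 0 have norm at least \<open>1 / B\<close>. This
      bound keeps out \<open>w = 0\<close>, where \<open>a + inverse w = a\<close> would lie in
      \<open>A\<close> and continuity would fail.\<close>
    have eq: "- S = {w \<in> {w. norm w \<ge> 1 / B}. a + inverse w \<in> A}"
    proof -
      have "f z \<in> - S \<longleftrightarrow> f z \<in> {w \<in> {w. norm w \<ge> 1 / B}. a + inverse w \<in> A}" for z
      proof (cases "z = a")
        case True
        then show ?thesis using B S_mem[of a] by (simp add: fa)
      next
        case False
        have "a + inverse (f z) = z" by (simp add: f_def)
        moreover have "norm (f z) \<ge> 1 / B" if "z \<in> A"
        proof -
          have "norm (z - a) > 0" using False by simp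
          then show ?thesis using B(1) B(2)[OF that] by (simp add: f_def norm_inverse norm_divide field_simps)
        qed
        ultimately show ?thesis using False by (auto simp: S_mem)
      qed
      then show ?thesis using fsurj by (metis (no_types, lifting) set_eqI)
    qed
    have cl: "closed {w::complex. norm w \<ge> 1 / B}"
      by (intro closed_Collect_le continuous_intros)
    have "continuous_on {w::complex. norm w \<ge> 1 / B} (\<lambda>w. a + inverse w)"
      using B(1) by (intro continuous_intros) (auto simp: norm_le_zero_iff[symmetric] simp del: norm_le_zero_iff dest: order.trans)
    from continuous_closed_preimage[OF this cl compact_imp_closed[OF cA]]
    show ?thesis unfolding eq by (simp add: vimage_def Int_def)
  qed
  then have openS: "open S" by (simp add: open_closed)
  have S0: "0 \<in> S" using fa by (auto simp: S_def)
  have S0': "S - {0} = f ` (- A)" using fa aA by (auto simp: S_def f_def)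
  \<comment> \<open>\<open>S - {0}\<close> is the image of the complement of the arc, which is
    connected because an arc does not separate the plane; 0 is a limit point of it.\<close>
  have conS: "connected S"
  proof -
    have "connected (S - {0})"
      unfolding S0' using aA assms
      by (intro connected_continuous_image contf) (auto simp: A_def intro: connected_arc_complement)
    moreover have "S \<subseteq> closure (S - {0})"
    proof -
      have "0 islimpt S" using openS S0 by (intro interior_limit_point) (simp add: interior_open)
      then have "0 islimpt (S - {0})" unfolding islimpt_def by blast
      then show ?thesis by (auto simp: closure_def)
    qed
    ultimately show ?thesis using connected_intermediate_closure Diff_subset by metis
  qed
  have conA': "connected (A - {a})"
  proof -
    have g01: "continuous_on {0<..1} g" "inj_on g {0..1}"
      using assms by (auto simp: arc_def path_def intro: continuous_on_subset)
    have "A - {a} = g ` {0<..1}"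
    proof -
      have "x \<in> g ` {0<..1} \<longleftrightarrow> x \<in> A - {a}" for x
      proof
        assume "x \<in> g ` {0<..1}"
        then obtain t where t: "0 < t" "t \<le> 1" "x = g t" by auto
        have "g t \<noteq> g 0" using inj_onD[OF g01(2), of t 0] t by auto
        then show "x \<in> A - {a}" using t by (auto simp: A_def a_def path_image_def pathstart_def)
      next
        assume "x \<in> A - {a}"
        then obtain t where "0 \<le> t" "t \<le> 1" "x = g t"
          by (auto simp: A_def path_image_def)
        moreover have "t \<noteq> 0" using \<open>x \<in> A - {a}\<close> \<open>x = g t\<close> by (auto simp: a_def pathstart_def)
        ultimately show "x \<in> g ` {0<..1}" by auto
      qed
      then show ?thesis by blast
    qed
    then show ?thesis using g01 by (simp add: connected_continuous_image)
  qed
  \<comment> \<open>Points of the arc close to \<open>a\<close> have images of large norm; this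
    makes the complement of \<open>S\<close> unbounded.\<close>
  have "a islimpt A"
  proof (rule connected_imp_perfect[OF conA aA])
    show "A \<noteq> {x}" for x using arc_distinct_ends[OF assms]
      by (metis A_def pathfinish_in_path_image pathstart_in_path_image singletonD)
  qed
  have unb: "\<not> bounded (- S)"
  proof
    assume "bounded (- S)"
    then obtain M where M: "M > 0" "\<And>w. w \<in> - S \<Longrightarrow> norm w \<le> M"
      unfolding bounded_pos by auto
    from \<open>a islimpt A\<close> obtain z where z: "z \<in> A" "z \<noteq> a" "dist z a < 1 / M"
      unfolding islimpt_approachable using M(1) by (metis zero_less_divide_1_iff)
    then have "norm (f z) \<le> M" by (intro M(2)) (simp add: S_mem)
    moreover have "norm (z - a) > 0" using z by simp
    ultimately show False using z(3) M(1) by (simp add: f_def norm_inverse norm_divide dist_norm field_simps)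
  qed
  \<comment> \<open>The complement of \<open>S\<close> is connected and unbounded, so it is its own
    only component, and the criterion by unbounded complement components applies.\<close>
  have "simply_connected S"
  proof -
    have "connected (- S)" unfolding compS
      by (intro connected_continuous_image contf conA') auto
    then have "C = - S" if "C \<in> components (- S)" for C
      using that by (metis components_empty connected_eq_connected_components_eq empty_iff in_components_self singletonD components_eq_sing_iff)
    then show ?thesis
      using unb conS simply_connected_eq_unbounded_complement_components[OF openS] by blast
  qed
  then have "S homeomorphic (ball 0 1 :: complex set)"
    using simply_connected_eq_homeomorphic_to_disc[OF openS] S0 by blast
  then have "S homeomorphic (UNIV :: complex set)"
    using homeomorphic_ball01_UNIV homeomorphic_trans by blast
  then obtain \<phi> \<psi> where hom: "homeomorphism S (UNIV::complex set) \<phi> \<psi>"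
    by (auto simp: homeomorphic_def)
  have \<phi>inj: "\<phi> x = \<phi> y \<longleftrightarrow> x = y" if "x \<in> S" "y \<in> S" for x y
    using hom that by (metis homeomorphism_apply1)
  \<comment> \<open>The shift moves the image of the point for infinity to 0 and the second
    inversion sends it back to infinity; the end of the plane that corresponds to the arc is sent to
    0.\<close>
  define h where "h = (\<lambda>z. inverse (\<phi> (f z) - \<phi> 0))"
  have fS: "f z \<in> S" "f z \<noteq> 0" if "z \<notin> A" for z
    using that aA S_mem[of z] by (auto simp: f_def)
  show ?thesis
  proof
    show "continuous_on (- path_image g) h"
      unfolding h_def A_def[symmetric]
    proof (intro continuous_intros)
      show "continuous_on (- A) (\<lambda>x. \<phi> (f x))"
      proof (rule continuous_on_compose2[of S \<phi> "- A" f])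
        show "continuous_on S \<phi>" using hom by (simp add: homeomorphism_def)
      qed (use aA fS contf in auto)
      show "\<forall>x\<in>- A. \<phi> (f x) - \<phi> 0 \<noteq> 0" using fS \<phi>inj S0 by auto
    qed
    show "inj_on h (- path_image g)"
      unfolding A_def[symmetric] by (rule inj_onI) (use fS \<phi>inj S0 finj in \<open>auto simp: h_def\<close>)
    show "h z \<noteq> 0" if "z \<notin> path_image g" for z
      using that fS[of z] \<phi>inj S0 by (auto simp: h_def A_def)
    show "(h \<longlongrightarrow> 0) (at z within - path_image g)" if "z \<in> path_image g" for z
    proof -
      have zA: "z \<in> A" using that by (simp add: A_def)
      have "filterlim (\<lambda>x. \<phi> (f x)) at_infinity (at z within - A)"
        unfolding filterlim_at_infinity[OF order_refl]
      proof (intro allI impI)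
        fix R :: real assume "R > 0"
        \<comment> \<open>Properness of the homeomorphism: near the arc, \<open>f x\<close> leaves
          every compact subset of \<open>S\<close>, in particular the preimage \<open>K\<close> of
          the disc of radius \<open>R\<close>.\<close>
        define K where "K = \<psi> ` cball 0 R"
        have cK: "compact K"
          unfolding K_def using hom
          by (intro compact_continuous_image) (auto simp: homeomorphism_def intro: continuous_on_subset)
        have KS: "K \<subseteq> S" using hom by (auto simp: K_def homeomorphism_def)
        have "\<forall>\<^sub>F x in at z within - A. f x \<notin> K"
        \<comment> \<open>Away from \<open>a\<close> the map \<open>f\<close> is continuous and
          closedness of \<open>K\<close> suffices; at \<open>a\<close> it blows up and boundedness
          of \<open>K\<close> is used instead.\<close>
        proof (cases "z = a")
          case False
          have "f z \<notin> K" using False zA KS S_mem by blast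
          moreover have "(f \<longlongrightarrow> f z) (at z within - A)"
            unfolding f_def using False by (auto intro!: tendsto_eq_intros)
          ultimately show ?thesis
            using topological_tendstoD[of f "f z" _ "- K"] compact_imp_closed[OF cK] by auto
        next
          case True
          obtain M where M: "M > 0" "\<And>w. w \<in> K \<Longrightarrow> norm w \<le> M"
            using compact_imp_bounded[OF cK] unfolding bounded_pos by auto
          have "\<forall>\<^sub>F x in at z within - A. dist x z < 1 / M"
            using M(1) by (auto simp: eventually_at intro!: exI[of _ "1/M"])
          moreover have "\<forall>\<^sub>F x in at z within - A. x \<noteq> z"
            by (auto simp: eventually_at_filter)
          ultimately show ?thesis
          proof eventually_elim
            case (elim x)
            then have "norm (x - a) > 0" using True by simp
            then have "norm (f x) > M"
              using elim M(1) True by (simp add: norm_divide f_def norm_inverse dist_norm field_simps)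
            then show ?case using M(2) by force
          qed
        qed
        moreover have "\<forall>\<^sub>F x in at z within - A. x \<notin> A"
          by (auto simp: eventually_at_filter)
        ultimately show "\<forall>\<^sub>F x in at z within - A. R \<le> norm (\<phi> (f x))"
        proof eventually_elim
          case (elim x)
          show ?case
          proof (rule ccontr)
            assume "\<not> ?case"
            then have "\<psi> (\<phi> (f x)) \<in> K" by (auto simp: K_def)
            then show False using elim hom fS by (metis homeomorphism_apply1)
          qed
        qed
      qed
      then have "filterlim (\<lambda>x. - \<phi> 0 + \<phi> (f x)) at_infinity (at z within - A)"
        by (intro tendsto_add_filterlim_at_infinity[OF tendsto_const])
      then have "filterlim (\<lambda>x. inverse (- \<phi> 0 + \<phi> (f x))) (nhds 0) (at z within - A)"
        by (rule filterlim_compose[OF tendsto_inverse_0])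
      then show ?thesis by (simp add: h_def A_def)
    qed
  qed
qed

section \<open>Restricting, renaming and contracting plane drawings\<close>

text \<open>The edge condition of \<open>simple_graph\<close> on its own; it survives the deletion
  of the last vertex.\<close>

definition wf_graph :: "'a graph \<Rightarrow> bool" where
  "wf_graph G \<longleftrightarrow> (\<forall>e\<in>edges G. e \<subseteq> verts G \<and> card e = 2)"

lemma plane_drawingD:
  assumes "plane_drawing G p \<gamma>"
  shows "inj_on p (verts G)"
    and "e \<in> edges G \<Longrightarrow> arc (\<gamma> e)"
    and "e \<in> edges G \<Longrightarrow> {pathstart (\<gamma> e), pathfinish (\<gamma> e)} = p ` e"
    and "e \<in> edges G \<Longrightarrow> v \<in> verts G \<Longrightarrow> p v \<in> path_image (\<gamma> e) \<Longrightarrow> v \<in> e"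
    and "e \<in> edges G \<Longrightarrow> e' \<in> edges G \<Longrightarrow> e \<noteq> e' \<Longrightarrow>
      path_image (\<gamma> e) \<inter> path_image (\<gamma> e') \<subseteq> p ` (e \<inter> e')"
proof -
  note A = assms[unfolded plane_drawing_def]
  show "inj_on p (verts G)" using A by (rule conjunct1)
  note A1 = A[THEN conjunct2, THEN conjunct1] and A2 = A[THEN conjunct2, THEN conjunct2, THEN conjunct1]
    and A3 = A[THEN conjunct2, THEN conjunct2, THEN conjunct2]
  show "arc (\<gamma> e)" "{pathstart (\<gamma> e), pathfinish (\<gamma> e)} = p ` e" if "e \<in> edges G"
    using bspec[OF A1 that] by simp_all
  show "v \<in> e" if "e \<in> edges G" "v \<in> verts G" "p v \<in> path_image (\<gamma> e)"
    using A2 that by simp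
  show "path_image (\<gamma> e) \<inter> path_image (\<gamma> e') \<subseteq> p ` (e \<inter> e')"
    if "e \<in> edges G" "e' \<in> edges G" "e \<noteq> e'"
    using A3 that by simp
qed

lemma planar_mono:
  assumes "planar G" "verts H \<subseteq> verts G" "edges H \<subseteq> edges G"
  shows "planar H"
proof -
  obtain p \<gamma> where d: "plane_drawing G p \<gamma>" using assms(1) by (auto simp: planar_def)
  note D = plane_drawingD[OF d]
  have "plane_drawing H p \<gamma>"
    unfolding plane_drawing_def
  proof (intro conjI ballI impI)
    show "inj_on p (verts H)" using D(1) assms(2) by (rule inj_on_subset)
  next
    fix e assume "e \<in> edges H"
    then have e: "e \<in> edges G" using assms(3) by (rule rev_subsetD)
    show "arc (\<gamma> e)" "{pathstart (\<gamma> e), pathfinish (\<gamma> e)} = p ` e"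
      using D(2,3)[OF e] .
    fix v assume v: "v \<in> verts H" "p v \<in> path_image (\<gamma> e)"
    show "v \<in> e" using D(4)[OF e subsetD[OF assms(2) v(1)] v(2)] .
  next
    fix e e' assume "e \<in> edges H" "e' \<in> edges H" "e \<noteq> e'"
    then show "path_image (\<gamma> e) \<inter> path_image (\<gamma> e') \<subseteq> p ` (e \<inter> e')"
      using D(5) assms(3) by (meson subsetD)
  qed
  then show ?thesis by (auto simp: planar_def)
qed

lemma planar_iso:
  assumes "planar G" "wf_graph G" "graph_iso G H"
  shows "planar H"
proof -
  obtain p \<gamma> where d: "plane_drawing G p \<gamma>" using assms(1) by (auto simp: planar_def)
  obtain f where f: "bij_betw f (verts G) (verts H)" "edges H = (`) f ` edges G"
    using assms(3) by (auto simp: graph_iso_def)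
  define k where "k = inv_into (verts G) f"
  have kf: "k (f x) = x" if "x \<in> verts G" for x
    using f(1) that by (simp add: k_def bij_betw_inv_into_left)
  have kf_im: "k ` f ` e = e" if "e \<subseteq> verts G" for e
    using that kf by (force simp: image_iff)
  have eV: "e \<subseteq> verts G" if "e \<in> edges G" for e using that assms(2) by (auto simp: wf_graph_def)
  have "plane_drawing H (p \<circ> k) (\<lambda>e. \<gamma> (k ` e))"
    unfolding plane_drawing_def f(2) ball_simps
  proof (intro conjI ballI impI)
    have "inj_on k (verts H)" "k ` verts H = verts G"
      using bij_betw_inv_into[OF f(1)] by (auto simp: bij_betw_def k_def)
    then show "inj_on (p \<circ> k) (verts H)" using d by (auto simp: plane_drawing_def intro: comp_inj_on)
  next
    fix e assume e: "e \<in> edges G"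
    show "arc (\<gamma> (k ` f ` e))" using d e kf_im[OF eV[OF e]] by (simp add: plane_drawing_def)
    show "{pathstart (\<gamma> (k ` f ` e)), pathfinish (\<gamma> (k ` f ` e))} = (p \<circ> k) ` f ` e"
      using d e kf_im[OF eV[OF e]] unfolding plane_drawing_def by (metis image_comp)
  next
    fix e v assume e: "e \<in> edges G" and v: "v \<in> verts H" and *: "(p \<circ> k) v \<in> path_image (\<gamma> (k ` f ` e))"
    obtain w where w: "w \<in> verts G" "v = f w" using f(1) v by (auto simp: bij_betw_def)
    then have "p w \<in> path_image (\<gamma> e)" using * kf kf_im[OF eV[OF e]] by simp
    then have "w \<in> e" using d e w by (auto simp: plane_drawing_def)
    then show "v \<in> f ` e" using w by simp
  next
    fix e e' assume e: "e \<in> edges G" "e' \<in> edges G" and ne: "f ` e \<noteq> f ` e'"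
    have "path_image (\<gamma> e) \<inter> path_image (\<gamma> e') \<subseteq> p ` (e \<inter> e')"
    proof -
      have "e \<noteq> e'" using ne by auto
      then show ?thesis using d e unfolding plane_drawing_def by blast
    qed
    moreover have "p ` (e \<inter> e') \<subseteq> (p \<circ> k) ` (f ` e \<inter> f ` e')"
    proof
      fix z assume "z \<in> p ` (e \<inter> e')"
      then obtain x where x: "x \<in> e" "x \<in> e'" "z = p x" by auto
      then have "z = (p \<circ> k) (f x)" using kf eV[OF e(1)] by auto
      then show "z \<in> (p \<circ> k) ` (f ` e \<inter> f ` e')" using x by blast
    qed
    ultimately show "path_image (\<gamma> (k ` f ` e)) \<inter> path_image (\<gamma> (k ` f ` e')) \<subseteq> (p \<circ> k) ` (f ` e \<inter> f ` e')"
      using kf_im eV e by simp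
  qed
  then show ?thesis by (auto simp: planar_def)
qed

text \<open>The old drawing is pushed through the collapse map of the arc of \<open>{u, v}\<close>.
  Every other edge meets that arc in at most one point, so its image is again an arc, and 0 becomes
  the position of the merged vertex.\<close>

lemma planar_contract_edge:
  assumes "planar G" "wf_graph G" "{u, v} \<in> edges G" "u \<noteq> v"
  shows "planar (contract_edge u v G)"
proof -
  obtain p \<gamma> where d: "plane_drawing G p \<gamma>" using assms(1) by (auto simp: planar_def)
  define e0 where "e0 = {u, v}"
  define A where "A = path_image (\<gamma> e0)"
  have e0: "e0 \<in> edges G" using assms(3) by (simp add: e0_def)
  have uvV: "u \<in> verts G" "v \<in> verts G" using assms(2,3) by (auto simp: wf_graph_def)
  have inj: "inj_on p (verts G)" using d by (simp add: plane_drawing_def)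
  have arcs: "arc (\<gamma> e)" "{pathstart (\<gamma> e), pathfinish (\<gamma> e)} = p ` e" if "e \<in> edges G" for e
    using d that by (auto simp: plane_drawing_def)
  have ends: "p x \<in> path_image (\<gamma> e)" if "e \<in> edges G" "x \<in> e" for e x
    using arcs(2)[OF that(1)] that(2) by (metis image_eqI insertE pathfinish_in_path_image pathstart_in_path_image singletonD)
  have vert: "x \<in> e" if "e \<in> edges G" "x \<in> verts G" "p x \<in> path_image (\<gamma> e)" for e x
    using d that unfolding plane_drawing_def by blast
  have cross: "path_image (\<gamma> e) \<inter> path_image (\<gamma> e') \<subseteq> p ` (e \<inter> e')"
    if "e \<in> edges G" "e' \<in> edges G" "e \<noteq> e'" for e e'
    using d that unfolding plane_drawing_def by blast
  obtain h where h: "continuous_on (- A) h" "inj_on h (- A)"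
    "\<And>z. z \<notin> A \<Longrightarrow> h z \<noteq> (0::complex)" "\<And>z. z \<in> A \<Longrightarrow> (h \<longlongrightarrow> 0) (at z within - A)"
    using arc_collapse[OF arcs(1)[OF e0]] unfolding A_def by metis
  \<comment> \<open>Extending \<open>h\<close> by 0 is not continuous as a map on the whole plane in
    any sense needed here; only its restriction to each remaining edge curve is shown to be
    continuous.\<close>
  define H where "H = (\<lambda>z. if z \<in> A then 0 else h z)"
  have H0: "H z = 0 \<longleftrightarrow> z \<in> A" for z using h(3) by (auto simp: H_def)
  have Hinj: "z = z'" if "H z = H z'" "z \<notin> A" for z z'
  proof -
    have "z' \<notin> A" using that H0 by metis
    then show ?thesis using that h(2) by (auto simp: H_def inj_on_def)
  qed
  define \<phi> where "\<phi> = (\<lambda>x. if x = v then u else x)"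
  define E where "E = edges G - {e0}"
  \<comment> \<open>Two edges with a common third vertex become parallel; one representative is
    chosen to draw the resulting edge.\<close>
  define src where "src = (\<lambda>e'. SOME e. e \<in> E \<and> \<phi> ` e = e')"
  define \<gamma>' where "\<gamma>' = (\<lambda>e'. H \<circ> \<gamma> (src e'))"
  \<comment> \<open>In a simple graph an edge different from \<open>e0\<close> shares at most one
    end with it.\<close>
  have meet: "\<exists>z. path_image (\<gamma> e) \<inter> A \<subseteq> {z}" and meetV: "path_image (\<gamma> e) \<inter> A \<subseteq> p ` (e \<inter> e0)"
    if "e \<in> E" for e
  proof -
    show *: "path_image (\<gamma> e) \<inter> A \<subseteq> p ` (e \<inter> e0)"
      using cross[of e e0] that e0 by (auto simp: E_def A_def)
    have "card e = 2" "e \<noteq> e0" using that assms(2) by (auto simp: E_def wf_graph_def)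
    have "\<not> {u, v} \<subseteq> e"
    proof
      assume "{u, v} \<subseteq> e"
      moreover have "finite e" using \<open>card e = 2\<close> by (simp add: card_ge_0_finite)
      ultimately have "{u, v} = e" using \<open>card e = 2\<close> assms(4) by (intro card_subset_eq) auto
      then show False using \<open>e \<noteq> e0\<close> by (simp add: e0_def)
    qed
    then have "e \<inter> e0 \<subseteq> {u} \<or> e \<inter> e0 \<subseteq> {v}" by (auto simp: e0_def)
    then have "p ` (e \<inter> e0) \<subseteq> {p u} \<or> p ` (e \<inter> e0) \<subseteq> {p v}" by auto
    with * show "\<exists>z. path_image (\<gamma> e) \<inter> A \<subseteq> {z}" by (meson order_trans)
  qed
  have opA: "open (- A)" using arcs(1)[OF e0]
    by (simp add: A_def closed_arc_image open_Compl)
  have contH: "continuous_on (path_image (\<gamma> e)) H" if e: "e \<in> E" for e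
    unfolding continuous_on_def
  proof
    fix z assume z: "z \<in> path_image (\<gamma> e)"
    show "(H \<longlongrightarrow> H z) (at z within path_image (\<gamma> e))"
    proof (cases "z \<in> A")
      case False
      then have "(h \<longlongrightarrow> h z) (at z)"
        using h(1) opA by (simp add: continuous_on_eq_continuous_at isCont_def)
      moreover have "\<forall>\<^sub>F x in at z. h x = H x"
        using False opA by (intro eventually_at_topological[THEN iffD2]) (auto simp: H_def)
      ultimately have "(H \<longlongrightarrow> H z) (at z)"
        using False by (simp add: H_def tendsto_cong)
      then show ?thesis by (rule tendsto_within_subset) simp
    next
      case True
      obtain z1 where "path_image (\<gamma> e) \<inter> A \<subseteq> {z1}" using meet[OF e] by auto
      \<comment> \<open>Apart from its only meeting point with \<open>A\<close> the curve runs in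
        the complement, so the limit of \<open>h\<close> at \<open>z\<close> is also the limit of
        \<open>H\<close> along the curve.\<close>
      then have sub: "path_image (\<gamma> e) - {z} \<subseteq> - A" using True z by blast
      have "(h \<longlongrightarrow> 0) (at z within path_image (\<gamma> e) - {z})"
        using h(4)[OF True] sub by (rule tendsto_within_subset)
      moreover have "\<forall>\<^sub>F x in at z within path_image (\<gamma> e) - {z}. h x = H x"
        using sub by (intro eventually_at_topological[THEN iffD2] exI[of _ UNIV]) (auto simp: H_def)
      ultimately have "(H \<longlongrightarrow> 0) (at z within path_image (\<gamma> e) - {z})"
        using tendsto_cong by fastforce
      then show ?thesis using True by (simp add: H_def at_within_def Diff_idemp)
    qed
  qed
  have Hinj_on: "inj_on H (path_image (\<gamma> e))" if e: "e \<in> E" for e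
  proof (rule inj_onI)
    fix x y assume xy: "x \<in> path_image (\<gamma> e)" "y \<in> path_image (\<gamma> e)" "H x = H y"
    show "x = y"
    proof (cases "x \<in> A")
      case True
      then have "y \<in> A" using xy H0 by metis
      then show ?thesis using True xy meet[OF e] by auto
    next
      case False then show ?thesis using Hinj xy by blast
    qed
  qed
  have src: "src e' \<in> E \<and> e' = \<phi> ` src e'" if e': "e' \<in> (`) \<phi> ` E" for e'
  proof -
    have "\<exists>e. e \<in> E \<and> \<phi> ` e = e'" using e' by auto
    from someI_ex[OF this] show ?thesis by (auto simp: src_def)
  qed
  have pim: "path_image (\<gamma>' e') = H ` path_image (\<gamma> (src e'))" for e'
    by (simp add: \<gamma>'_def path_image_compose)
  \<comment> \<open>Both \<open>p u\<close> and \<open>p v\<close> lie on the collapsed arc, so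
    renaming \<open>v\<close> to \<open>u\<close> does not change positions after
    \<open>H\<close>.\<close>
  have Hp: "H (p (\<phi> x)) = H (p x)" for x
  proof -
    have "p u \<in> A" "p v \<in> A" using ends[OF e0] by (auto simp: A_def e0_def)
    then show ?thesis by (simp add: \<phi>_def H_def)
  qed
  have pA: "p x \<in> A \<longleftrightarrow> x = u \<or> x = v" if "x \<in> verts G" for x
    using ends[OF e0] vert[OF e0 that] by (auto simp: A_def e0_def)
  have C: "verts (contract_edge u v G) = verts G - {v}" "edges (contract_edge u v G) = (`) \<phi> ` E"
    by (simp_all only: contract_edge_def graph.sel \<phi>_def E_def e0_def)
  have "plane_drawing (contract_edge u v G) (H \<circ> p) \<gamma>'"
    unfolding plane_drawing_def C
  proof (intro conjI ballI impI)
    show "inj_on (H \<circ> p) (verts G - {v})"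
    proof (rule inj_onI)
      fix x y assume xy: "x \<in> verts G - {v}" "y \<in> verts G - {v}" "(H \<circ> p) x = (H \<circ> p) y"
      show "x = y"
      proof (cases "x = u")
        case True
        then have "H (p y) = 0" using xy H0[of "p x"] pA uvV by simp
        then have "p y \<in> A" using H0 by blast
        then show ?thesis using True xy pA by auto
      next
        case False
        then have "p x \<notin> A" using xy pA by auto
        then have "p x = p y" using xy Hinj by simp
        then show ?thesis using inj xy by (auto simp: inj_on_def)
      qed
    qed
  next
    fix e' assume "e' \<in> (`) \<phi> ` E"
    then obtain e where e: "e = src e'" "e \<in> E" "e' = \<phi> ` e" using src by metis
    then have eG: "e \<in> edges G" by (simp add: E_def)
    have "path (\<gamma> e)" "inj_on (\<gamma> e) {0..1}" using arcs(1)[OF eG] by (auto simp: arc_def)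
    then show "arc (\<gamma>' e')"
      using contH[OF e(2)] Hinj_on[OF e(2)] e(1)
      by (auto simp: arc_def \<gamma>'_def path_image_def intro: path_continuous_image[unfolded path_image_def] comp_inj_on)
    have "{pathstart (\<gamma>' e'), pathfinish (\<gamma>' e')} = H ` {pathstart (\<gamma> e), pathfinish (\<gamma> e)}"
      using e(1) by (simp add: \<gamma>'_def pathstart_def pathfinish_def)
    also have "\<dots> = H ` p ` e" using arcs(2)[OF eG] by simp
    also have "\<dots> = (H \<circ> p) ` e'" unfolding e(3) by (simp add: image_image Hp)
    finally show "{pathstart (\<gamma>' e'), pathfinish (\<gamma>' e')} = (H \<circ> p) ` e'" .
    fix w assume w: "w \<in> verts G - {v}" "(H \<circ> p) w \<in> path_image (\<gamma>' e')"
    then obtain z where z: "z \<in> path_image (\<gamma> e)" "H (p w) = H z" using e(1) by (auto simp: pim)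
    show "w \<in> e'"
    proof (cases "w = u")
      case True
      then have "z \<in> A" using z(2) H0 pA uvV by metis
      \<comment> \<open>A curve reaches the collapsed arc only at an end that belongs to
        \<open>e0\<close>, and \<open>\<phi>\<close> turns this end into \<open>u\<close>.\<close>
      then obtain x where "x \<in> e" "x \<in> e0" using z meetV[OF e(2)] by auto
      then have "\<phi> x = u" "x \<in> e" by (auto simp: \<phi>_def e0_def)
      then show ?thesis using True e(3) by blast
    next
      case False
      then have "p w \<notin> A" using w pA by auto
      then have "p w \<in> path_image (\<gamma> e)" using Hinj z by blast
      then have "w \<in> e" using vert[OF eG] w by auto
      moreover have "\<phi> w = w" using w by (simp add: \<phi>_def)
      ultimately show ?thesis using e(3) by (metis image_eqI)
    qed
  next
    fix e1' e2' assume E': "e1' \<in> (`) \<phi> ` E" "e2' \<in> (`) \<phi> ` E" and ne: "e1' \<noteq> e2'"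
    obtain e1 where e1: "e1 = src e1'" "e1 \<in> E" "e1' = \<phi> ` e1" using E' src by metis
    obtain e2 where e2: "e2 = src e2'" "e2 \<in> E" "e2' = \<phi> ` e2" using E' src by metis
    have ne12: "e1 \<noteq> e2" using ne e1(3) e2(3) by blast
    show "path_image (\<gamma>' e1') \<inter> path_image (\<gamma>' e2') \<subseteq> (H \<circ> p) ` (e1' \<inter> e2')"
    proof
      fix y assume "y \<in> path_image (\<gamma>' e1') \<inter> path_image (\<gamma>' e2')"
      then obtain z1 z2 where z: "z1 \<in> path_image (\<gamma> e1)" "z2 \<in> path_image (\<gamma> e2)" "y = H z1" "y = H z2"
        using e1(1) e2(1) by (auto simp: pim)
      show "y \<in> (H \<circ> p) ` (e1' \<inter> e2')"
      \<comment> \<open>Curves that touched the arc at different points now meet at 0. This is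
        allowed, because both contracted edges then contain \<open>u\<close>.\<close>
      proof (cases "z1 \<in> A")
        case True
        then have "z2 \<in> A" using z H0 by metis
        obtain x1 where "x1 \<in> e1" "x1 \<in> e0" using z True meetV[OF e1(2)] by auto
        then have "\<phi> x1 = u" "x1 \<in> e1" by (auto simp: \<phi>_def e0_def)
        then have 1: "u \<in> e1'" using e1(3) by blast
        obtain x2 where "x2 \<in> e2" "x2 \<in> e0" using z \<open>z2 \<in> A\<close> meetV[OF e2(2)] by auto
        then have "\<phi> x2 = u" "x2 \<in> e2" by (auto simp: \<phi>_def e0_def)
        then have 2: "u \<in> e2'" using e2(3) by blast
        have "y = (H \<circ> p) u" using True z(3) H0 pA uvV by (metis comp_apply)
        then show ?thesis using 1 2 by blast
      next
        case False
        then have "z1 = z2" using z Hinj by metis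
        then obtain x where x: "x \<in> e1" "x \<in> e2" "z1 = p x"
        proof -
          have "z1 \<in> p ` (e1 \<inter> e2)"
            using z(1,2) \<open>z1 = z2\<close> cross[OF _ _ ne12] e1(2) e2(2) unfolding E_def by blast
          then show ?thesis using that by blast
        qed
        have "\<phi> x = x" using False x ends[OF e0] by (auto simp: \<phi>_def A_def e0_def)
        then have "x \<in> e1' \<inter> e2'" using x e1 e2 by (metis IntI image_eqI)
        then show ?thesis using x z by auto
      qed
    qed
  qed
  then show ?thesis by (auto simp: planar_def)
qed

subsection \<open>Nonplanarity of the Kuratowski graphs\<close>

text \<open>The chord \<open>c\<close> cuts the inside of the cycle into two regions, bounded by
  \<open>c1\<close> with \<open>c\<close> and by \<open>c2\<close> with \<open>c\<close>. The
  interior of \<open>d\<close> is connected and avoids all three arcs, so it stays in one region,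
  whose boundary misses one of the ends of \<open>d\<close>.\<close>

lemma crossing_chords_inside:
  fixes c1 c2 c d :: "real \<Rightarrow> complex"
  assumes arcs: "arc c1" "arc c2" "arc c" "arc d"
    and ends: "pathstart c1 = a" "pathfinish c1 = b" "pathstart c2 = a" "pathfinish c2 = b"
      "pathstart c = a" "pathfinish c = b"
    and int: "path_image c1 \<inter> path_image c2 = {a, b}" "path_image c1 \<inter> path_image c = {a, b}"
      "path_image c2 \<inter> path_image c = {a, b}"
    and q: "pathstart d \<in> path_image c1 - {a, b}" and s: "pathfinish d \<in> path_image c2 - {a, b}"
    and dJ: "path_image d \<inter> (path_image c1 \<union> path_image c2) = {pathstart d, pathfinish d}"
    and dc: "path_image d \<inter> path_image c = {}"
    and cin: "path_image c \<inter> inside (path_image c1 \<union> path_image c2) \<noteq> {}"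
    and din: "path_image d \<inter> inside (path_image c1 \<union> path_image c2) \<noteq> {}"
  shows False
proof -
  have ab: "a \<noteq> b" using arc_distinct_ends[OF arcs(1)] ends by auto
  define J where "J = path_image c1 \<union> path_image c2"
  define I1 where "I1 = inside (path_image c1 \<union> path_image c)"
  define I2 where "I2 = inside (path_image c2 \<union> path_image c)"
  have split: "I1 \<inter> I2 = {}" "I1 \<union> I2 \<union> (path_image c - {a, b}) = inside J"
    using split_inside_simple_closed_curve[OF arc_imp_simple_path[OF arcs(1)] ends(1,2)
        arc_imp_simple_path[OF arcs(2)] ends(3,4) arc_imp_simple_path[OF arcs(3)] ends(5,6) ab int cin]
    unfolding I1_def I2_def J_def by metis+
  have cl: "closed (path_image c1 \<union> path_image c)" "closed (path_image c2 \<union> path_image c)" "closed J"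
    unfolding J_def by (simp_all add: arcs closed_arc_image closed_Un)
  have op: "open I1" "open I2" "open (inside J)"
    unfolding I1_def I2_def by (simp_all add: cl open_inside)
  define D where "D = path_image d - {pathstart d, pathfinish d}"
  have conD: "connected D"
    using connected_simple_path_endless[OF arc_imp_simple_path[OF arcs(4)]] by (simp add: D_def)
  \<comment> \<open>An arc has no isolated points, so its ends are limits of its interior.\<close>
  have Dcl: "pathstart d \<in> closure D" "pathfinish d \<in> closure D"
  proof -
    have eq: "path_image d = insert (pathstart d) (insert (pathfinish d) D)" by (auto simp: D_def)
    have ne: "path_image d \<noteq> {x}" for x
      using arc_distinct_ends[OF arcs(4)] eq by (metis insertI1 insertI2 singletonD)
    have "x islimpt path_image d" if "x \<in> path_image d" for x
      using connected_imp_perfect[OF connected_arc_image[OF arcs(4)] that ne] .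
    then have "x islimpt D" if "x \<in> path_image d" for x
      using that unfolding eq islimpt_insert by blast
    then show "pathstart d \<in> closure D" "pathfinish d \<in> closure D"
      unfolding closure_def by blast+
  qed
  have DJ: "D \<inter> J = {}" using dJ by (auto simp: D_def J_def)
  have "D \<inter> inside J \<noteq> {}"
  proof -
    obtain x where "x \<in> path_image d" "x \<in> inside J" using din by (auto simp: J_def)
    moreover then have "x \<notin> J" using inside_no_overlap by blast
    ultimately show ?thesis using q s by (auto simp: D_def J_def)
  qed
  have "D \<subseteq> inside J"
  proof -
    have "D \<subseteq> inside J \<union> outside J" using DJ inside_Un_outside by blast
    moreover have "open (outside J)" by (simp add: cl open_outside)
    ultimately show ?thesis
      using conD op(3) \<open>D \<inter> inside J \<noteq> {}\<close> inside_Int_outside[of J] connectedD[OF conD op(3) \<open>open (outside J)\<close>]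
      by blast
  qed
  then have "D \<subseteq> I1 \<union> I2" using split(2) dc by (auto simp: D_def)
  then have "D \<subseteq> I1 \<or> D \<subseteq> I2"
    using connectedD[OF conD op(1,2)] split(1) by blast
  then show False
  proof
    assume "D \<subseteq> I1"
    \<comment> \<open>Closing an inside region adds at most its boundary curve. The end of
      \<open>d\<close> on \<open>c2\<close> lies neither on \<open>c1\<close> nor on
      \<open>c\<close>, so it would have to be strictly inside \<open>J\<close> although it lies on
      \<open>J\<close>.\<close>
    then have "closure D \<subseteq> I1 \<union> (path_image c1 \<union> path_image c)"
      using closure_inside_subset[OF cl(1)] closure_mono unfolding I1_def by blast
    then have "pathfinish d \<in> I1" using Dcl s dc int by blast
    then show False using split(2) s inside_no_overlap[of J] unfolding J_def by blast
  next
    assume "D \<subseteq> I2"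
    then have "closure D \<subseteq> I2 \<union> (path_image c2 \<union> path_image c)"
      using closure_inside_subset[OF cl(2)] closure_mono unfolding I2_def by blast
    then have "pathstart d \<in> I2" using Dcl q dc int by blast
    then show False using split(2) q inside_no_overlap[of J] unfolding J_def by blast
  qed
qed

text \<open>The inversion at a point inside the cycle exchanges the two sides.\<close>

lemma crossing_chords_outside:
  fixes c1 c2 c d :: "real \<Rightarrow> complex"
  assumes arcs: "arc c1" "arc c2" "arc c" "arc d"
    and ends: "pathstart c1 = a" "pathfinish c1 = b" "pathstart c2 = a" "pathfinish c2 = b"
      "pathstart c = a" "pathfinish c = b"
    and int: "path_image c1 \<inter> path_image c2 = {a, b}" "path_image c1 \<inter> path_image c = {a, b}"
      "path_image c2 \<inter> path_image c = {a, b}"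
    and q: "pathstart d \<in> path_image c1 - {a, b}" and s: "pathfinish d \<in> path_image c2 - {a, b}"
    and dJ: "path_image d \<inter> (path_image c1 \<union> path_image c2) = {pathstart d, pathfinish d}"
    and dc: "path_image d \<inter> path_image c = {}"
    and cout: "path_image c \<inter> inside (path_image c1 \<union> path_image c2) = {}"
    and dout: "path_image d \<inter> inside (path_image c1 \<union> path_image c2) = {}"
  shows False
proof -
  have ab: "a \<noteq> b" using arc_distinct_ends[OF arcs(1)] ends by auto
  define J where "J = path_image c1 \<union> path_image c2"
  define r where "r = c1 +++ reversepath c2"
  have r: "simple_path r" "pathfinish r = pathstart r" "path_image r = J"
    using arcs ends int unfolding r_def J_def
    by (auto simp: simple_path_join_loop_eq arc_reversepath path_image_join)
  have clJ: "closed J" using closed_simple_path_image[OF r(1)] r(3) by simp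
  \<comment> \<open>Neither chord enters the inside, so the centre of the inversion lies on none of
    the four arcs.\<close>
  obtain z0 where z0: "z0 \<in> inside J" using Jordan_inside_outside[OF r(1,2)] r(3) by auto
  have z0n: "z0 \<notin> J" "z0 \<notin> path_image c" "z0 \<notin> path_image d"
    using z0 cout dout inside_no_overlap[of J] unfolding J_def by blast+
  define f where "f = (\<lambda>z. inverse (z - z0))"
  have finj: "f x = f y \<longleftrightarrow> x = y" for x y by (simp add: f_def)
  then have finj_on: "inj_on f T" for T by (simp add: inj_on_def)
  have contf: "continuous_on T f" if "z0 \<notin> T" for T
    unfolding f_def using that by (auto intro!: continuous_intros)
  have arcf: "arc (f \<circ> g)" if "arc g" "z0 \<notin> path_image g" for g
    using that contf[of "path_image g"] finj_on[of UNIV]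
    by (auto simp: arc_def intro: path_continuous_image comp_inj_on inj_on_subset)
  have pe: "pathstart (f \<circ> g) = f (pathstart g)" "pathfinish (f \<circ> g) = f (pathfinish g)" for g
    by (simp_all add: pathstart_compose pathfinish_compose)
  have pim: "path_image (f \<circ> g) = f ` path_image g" for g by (simp add: path_image_compose)
  have fint: "f ` S \<inter> f ` T = f ` (S \<inter> T)" for S T using finj by auto
  define J' where "J' = f ` J"
  have clJ': "compact J'"
    unfolding J'_def using z0n(1) r
    by (intro compact_continuous_image contf) (metis compact_simple_path_image)+
  \<comment> \<open>If \<open>f z\<close> were outside \<open>J'\<close>, pulling that outside
    region back would give a connected set off \<open>J\<close> that contains \<open>z\<close> as
    well as points near \<open>z0\<close>, hence points on both sides of \<open>J\<close>.\<close>
  have inside: "f z \<in> inside J'" if z: "z \<notin> J" "z \<notin> inside J" for z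
  proof (rule ccontr)
    assume "f z \<notin> inside J'"
    moreover have "f z \<notin> J'" using z finj by (auto simp: J'_def)
    ultimately have fz: "f z \<in> outside J'" using inside_Un_outside[of J'] by blast
    have rf: "simple_path (f \<circ> r)" "pathfinish (f \<circ> r) = pathstart (f \<circ> r)" "path_image (f \<circ> r) = J'"
    proof -
      have "f \<circ> r = (f \<circ> c1) +++ reversepath (f \<circ> c2)"
        by (auto simp: r_def joinpaths_def reversepath_def fun_eq_iff)
      moreover have "simple_path ((f \<circ> c1) +++ reversepath (f \<circ> c2))"
        using arcf[OF arcs(1)] arcf[OF arcs(2)] z0n(1) ends int(1)
        by (subst simple_path_join_loop_eq) (auto simp: arc_reversepath pe pim fint J_def)
      ultimately show "simple_path (f \<circ> r)" by simp
      show "pathfinish (f \<circ> r) = pathstart (f \<circ> r)" by (simp add: pe r(2))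
      show "path_image (f \<circ> r) = J'" by (simp add: pim r(3) J'_def)
    qed
    \<comment> \<open>The inverse map \<open>g\<close> is discontinuous at 0, the image of
      \<open>z0\<close>; an open connected set of the plane stays connected without one
      point.\<close>
    define T where "T = outside J' - {0}"
    have "connected (outside J')" "open (outside J')" "\<not> bounded (outside J')"
      using Jordan_inside_outside[OF rf(1,2)] rf(3) by auto
    then have conT: "connected T" unfolding T_def by (simp add: connected_open_delete)
    define g where "g = (\<lambda>w. z0 + inverse w)"
    have gf: "g (f w) = w" for w by (simp add: g_def f_def)
    have fg: "f (g w) = w" for w by (simp add: g_def f_def)
    have "connected (g ` T)"
      unfolding g_def using conT by (intro connected_continuous_image continuous_intros) (auto simp: T_def)
    moreover have "g ` T \<inter> J = {}"
    proof -
      have "g w \<notin> J" if "w \<in> T" for w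
      proof
        assume "g w \<in> J"
        then have "f (g w) \<in> J'" by (simp add: J'_def)
        then show False using that outside_no_overlap[of J'] unfolding fg T_def by blast
      qed
      then show ?thesis by blast
    qed
    then have "g ` T \<subseteq> inside J \<union> outside J" using inside_Un_outside[of J] by blast
    moreover have "open (inside J)" "open (outside J)" using clJ open_inside open_outside by blast+
    moreover have "z \<in> g ` T"
    proof -
      have "z \<noteq> z0" using z z0 by blast
      then have "f z \<in> T" using fz by (simp add: T_def f_def)
      then show ?thesis using gf by (metis image_eqI)
    qed
    moreover have "z \<in> outside J" using z inside_Un_outside[of J] by blast
    moreover have "\<exists>y\<in>g ` T. y \<in> inside J"
    proof -
      \<comment> \<open>The outside of \<open>J'\<close> is unbounded, and its points of large norm
        are pulled back into a small ball around \<open>z0\<close>.\<close>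
      obtain e where e: "e > 0" "ball z0 e \<subseteq> inside J"
        using \<open>open (inside J)\<close> z0 open_contains_ball by blast
      obtain w where w: "w \<in> outside J'" "norm w > 1 / e"
        using \<open>\<not> bounded (outside J')\<close> unfolding bounded_iff by (metis not_le)
      have wp: "norm w > 0" using w(2) e(1) by (meson less_trans zero_less_divide_1_iff)
      then have "norm (inverse w) < e" using w(2) e(1) by (simp add: norm_inverse norm_divide field_simps)
      then have "g w \<in> inside J" using e(2) by (auto simp: g_def dist_norm subset_iff)
      moreover have "w \<in> T" using w wp by (auto simp: T_def)
      ultimately show ?thesis by blast
    qed
    ultimately show False
      using connectedD[of "g ` T" "inside J" "outside J"] inside_Int_outside[of J] by blast
  qed
  have J'_eq: "path_image (f \<circ> c1) \<union> path_image (f \<circ> c2) = J'" by (auto simp: pim J'_def J_def)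
  have dJ': "path_image d \<inter> J = {pathstart d, pathfinish d}" using dJ by (simp add: J_def)
  \<comment> \<open>The midpoint of a chord is not an end, so it lies off \<open>J\<close>; by the
    assumption it is not inside either, and the inversion carries it inside
    \<open>J'\<close>.\<close>
  have nc: "\<exists>x. x \<in> path_image c \<and> x \<notin> J"
  proof -
    have "c (1/2) \<in> path_image c" by (simp add: path_image_def)
    moreover have "c (1/2) \<noteq> a" "c (1/2) \<noteq> b"
      using arcs(3) ends inj_onD[of c "{0..1}" "1/2" 0] inj_onD[of c "{0..1}" "1/2" 1]
      by (auto simp: arc_def pathstart_def pathfinish_def)
    ultimately show ?thesis using int by (auto simp: J_def)
  qed
  have nd: "\<exists>x. x \<in> path_image d \<and> x \<notin> J"
  proof -
    have "d (1/2) \<in> path_image d" by (simp add: path_image_def)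
    moreover have "d (1/2) \<noteq> pathstart d" "d (1/2) \<noteq> pathfinish d"
      using arcs(4) inj_onD[of d "{0..1}" "1/2" 0] inj_onD[of d "{0..1}" "1/2" 1]
      by (auto simp: arc_def pathstart_def pathfinish_def)
    ultimately show ?thesis using dJ' by blast
  qed
  have z1: "z0 \<notin> path_image c1" "z0 \<notin> path_image c2" using z0n by (auto simp: J_def)
  show False
  proof (rule crossing_chords_inside[where ?c1.0 = "f \<circ> c1" and ?c2.0 = "f \<circ> c2" and c = "f \<circ> c" and d = "f \<circ> d"
        and a = "f a" and b = "f b"])
    show "path_image (f \<circ> c) \<inter> inside (path_image (f \<circ> c1) \<union> path_image (f \<circ> c2)) \<noteq> {}"
    proof -
      obtain x where x: "x \<in> path_image c" "x \<notin> J" using nc by auto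
      then have "f x \<in> inside J'" using inside cout by (auto simp: J_def)
      then have "f x \<in> f ` path_image c \<inter> inside J'" using x by simp
      then show ?thesis unfolding J'_eq unfolding pim by (metis emptyE)
    qed
    show "path_image (f \<circ> d) \<inter> inside (path_image (f \<circ> c1) \<union> path_image (f \<circ> c2)) \<noteq> {}"
    proof -
      obtain x where x: "x \<in> path_image d" "x \<notin> J" using nd by auto
      then have "f x \<in> inside J'" using inside dout by (auto simp: J_def)
      then have "f x \<in> f ` path_image d \<inter> inside J'" using x by simp
      then show ?thesis unfolding J'_eq unfolding pim by (metis emptyE)
    qed
    show "path_image (f \<circ> d) \<inter> (path_image (f \<circ> c1) \<union> path_image (f \<circ> c2)) = {pathstart (f \<circ> d), pathfinish (f \<circ> d)}"
      unfolding J'_eq unfolding pim pe J'_def fint dJ' by simp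
    show "path_image (f \<circ> c1) \<inter> path_image (f \<circ> c2) = {f a, f b}"
      "path_image (f \<circ> c1) \<inter> path_image (f \<circ> c) = {f a, f b}"
      "path_image (f \<circ> c2) \<inter> path_image (f \<circ> c) = {f a, f b}"
      "path_image (f \<circ> d) \<inter> path_image (f \<circ> c) = {}"
      unfolding pim fint int dc by simp_all
    show "pathstart (f \<circ> d) \<in> path_image (f \<circ> c1) - {f a, f b}"
      "pathfinish (f \<circ> d) \<in> path_image (f \<circ> c2) - {f a, f b}"
      using q s finj by (auto simp: pim pe)
  qed (simp_all add: arcf arcs z0n z1 pe ends)
qed

section \<open>Paths and cycles of a drawn graph as curves\<close>

fun walk_edges :: "'a list \<Rightarrow> 'a set set" where
  "walk_edges (x # y # r) = insert {x, y} (walk_edges (y # r))"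
| "walk_edges _ = {}"

lemma walk_edges_subset: "e \<in> walk_edges xs \<Longrightarrow> e \<subseteq> set xs"
  by (induction xs rule: walk_edges.induct) auto

text \<open>A drawing leaves the direction of an edge arc open; reversing the path when necessary
  fixes it.\<close>

lemma edge_arc:
  assumes "plane_drawing G p \<gamma>" "{x, y} \<in> edges G"
  obtains g where "arc g" "pathstart g = p x" "pathfinish g = p y" "path_image g = path_image (\<gamma> {x, y})"
proof -
  note D = plane_drawingD(2,3)[OF assms]
  then have "{pathstart (\<gamma> {x, y}), pathfinish (\<gamma> {x, y})} = {p x, p y}" by simp
  then consider "pathstart (\<gamma> {x, y}) = p x \<and> pathfinish (\<gamma> {x, y}) = p y"
    | "pathstart (\<gamma> {x, y}) = p y \<and> pathfinish (\<gamma> {x, y}) = p x"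
    by (auto simp: doubleton_eq_iff)
  then show ?thesis
  proof cases
    case 1 then show ?thesis using D that by blast
  next
    case 2
    show ?thesis
      by (rule that[of "reversepath (\<gamma> {x, y})"]) (use 2 D in \<open>auto simp: arc_reversepath\<close>)
  qed
qed

text \<open>The first arc meets the rest only in \<open>p y\<close>: the vertex \<open>x\<close>
  does not occur later, so no later edge shares any other end with \<open>{x, y}\<close>.\<close>

lemma walk_arc:
  assumes d: "plane_drawing G p \<gamma>"
  shows "distinct xs \<Longrightarrow> 2 \<le> length xs \<Longrightarrow> walk_edges xs \<subseteq> edges G \<Longrightarrow>
    \<exists>g. arc g \<and> pathstart g = p (hd xs) \<and> pathfinish g = p (last xs) \<and>
      path_image g = (\<Union>e\<in>walk_edges xs. path_image (\<gamma> e))"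
proof (induction xs rule: walk_edges.induct)
  case (1 x y r)
  have xy: "{x, y} \<in> edges G" using 1 by auto
  obtain g0 where g0: "arc g0" "pathstart g0 = p x" "pathfinish g0 = p y" "path_image g0 = path_image (\<gamma> {x, y})"
    using edge_arc[OF d xy] by metis
  show ?case
  proof (cases r)
    case Nil
    then show ?thesis using g0 by auto
  next
    case (Cons z r')
    obtain g where g: "arc g" "pathstart g = p y" "pathfinish g = p (last (y # r))"
        "path_image g = (\<Union>e\<in>walk_edges (y # r). path_image (\<gamma> e))"
      using 1 Cons by auto
    have "path_image g0 \<inter> path_image g \<subseteq> {p y}"
    proof
      fix w assume "w \<in> path_image g0 \<inter> path_image g"
      then obtain e where e: "e \<in> walk_edges (y # r)" "w \<in> path_image (\<gamma> e)" "w \<in> path_image (\<gamma> {x, y})"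
        unfolding g0(4) g(4) by blast
      have "x \<notin> e" using walk_edges_subset[OF e(1)] 1(2) by auto
      moreover have "w \<in> p ` ({x, y} \<inter> e)"
        using plane_drawingD(5)[OF d xy, of e] e 1(4) \<open>x \<notin> e\<close> by auto
      ultimately show "w \<in> {p y}" by auto
    qed
    then have "arc (g0 +++ g)" using g0 g by (intro arc_join) auto
    moreover have "path_image (g0 +++ g) = (\<Union>e\<in>walk_edges (x # y # r). path_image (\<gamma> e))"
      using g0 g by (subst path_image_join) auto
    ultimately show ?thesis using g0 g by (intro exI[of _ "g0 +++ g"]) auto
  qed
qed auto

lemma walk_vertex:
  assumes "plane_drawing G p \<gamma>"
  shows "2 \<le> length xs \<Longrightarrow> walk_edges xs \<subseteq> edges G \<Longrightarrow> x \<in> set xs \<Longrightarrow>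
    p x \<in> (\<Union>e\<in>walk_edges xs. path_image (\<gamma> e))"
proof (induction xs rule: walk_edges.induct)
  case (1 a b r)
  have ab: "{a, b} \<in> edges G" using 1 by auto
  have e: "p a \<in> path_image (\<gamma> {a, b})" "p b \<in> path_image (\<gamma> {a, b})"
    using edge_arc[OF assms ab] by (metis pathstart_in_path_image pathfinish_in_path_image)+
  show ?case
  proof (cases "x = a \<or> x = b")
    case True then show ?thesis using e by auto
  next
    case False
    then have "r \<noteq> []" "x \<in> set (b # r)" using 1 by auto
    then have "2 \<le> length (b # r)" by (cases r) auto
    then show ?thesis using 1 \<open>x \<in> set (b # r)\<close> by auto
  qed
qed auto

text \<open>Entering the inside of the cycle is a two-valued side, and chords with interleaving ends
  take different values. The cycle is given by its edge set \<open>W\<close>, so that different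
  splittings into two paths yield literally the same \<open>J\<close> and several instances can be
  chained.\<close>

lemma crossing_chords:
  assumes d: "plane_drawing G p \<gamma>" and wf: "wf_graph G"
    and dist: "distinct (a # b # xs @ ys)"
    and W: "walk_edges (a # xs @ [b]) \<union> walk_edges (a # ys @ [b]) = W" "W \<subseteq> edges G"
    and ab: "{a, b} \<in> edges G" "{a, b} \<notin> W" and xy: "{x, y} \<in> edges G" "x \<in> set xs" "y \<in> set ys"
  defines "J \<equiv> \<Union>e\<in>W. path_image (\<gamma> e)"
  shows "path_image (\<gamma> {a, b}) \<inter> inside J = {} \<longleftrightarrow> path_image (\<gamma> {x, y}) \<inter> inside J \<noteq> {}"
proof -
  let ?P = "a # xs @ [b]" and ?Q = "a # ys @ [b]"
  let ?I = "\<lambda>F. \<Union>e\<in>F. path_image (\<gamma> e)"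
  have PQ: "walk_edges ?P \<subseteq> edges G" "walk_edges ?Q \<subseteq> edges G" using W by auto
  obtain c1 where c1: "arc c1" "pathstart c1 = p a" "pathfinish c1 = p b" "path_image c1 = ?I (walk_edges ?P)"
    using walk_arc[OF d, of ?P] dist PQ by auto
  obtain c2 where c2: "arc c2" "pathstart c2 = p a" "pathfinish c2 = p b" "path_image c2 = ?I (walk_edges ?Q)"
    using walk_arc[OF d, of ?Q] dist PQ by auto
  obtain c where c: "arc c" "pathstart c = p a" "pathfinish c = p b" "path_image c = path_image (\<gamma> {a, b})"
    using edge_arc[OF d ab(1)] by metis
  obtain f where f: "arc f" "pathstart f = p x" "pathfinish f = p y" "path_image f = path_image (\<gamma> {x, y})"
    using edge_arc[OF d xy(1)] by metis
  have J: "J = path_image c1 \<union> path_image c2" unfolding J_def W(1)[symmetric] c1 c2 by blast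
  have V: "a \<in> verts G" "b \<in> verts G" "x \<in> verts G" "y \<in> verts G"
    using wf ab xy by (auto simp: wf_graph_def)
  have pinj: "p s = p t \<longleftrightarrow> s = t" if "s \<in> verts G" "t \<in> verts G" for s t
    using plane_drawingD(1)[OF d] that by (auto simp: inj_on_def)
  have xyab: "x \<noteq> a" "x \<noteq> b" "y \<noteq> a" "y \<noteq> b" "x \<noteq> y" "x \<notin> set ys" "y \<notin> set xs"
    using dist xy by auto
  have meet: "path_image (\<gamma> e) \<inter> path_image (\<gamma> e') \<subseteq> p ` (e \<inter> e')"
    if "e \<in> W \<or> e = {a, b} \<or> e = {x, y}" "e' \<in> W \<or> e' = {a, b} \<or> e' = {x, y}" "e \<noteq> e'" for e e'
    using plane_drawingD(5)[OF d, of e e'] that W(2) ab xy by auto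
  have ends: "{p a, p b} \<subseteq> path_image c1" "{p a, p b} \<subseteq> path_image c2" "{p a, p b} \<subseteq> path_image c"
      "{p x, p y} \<subseteq> path_image f"
    using c1 c2 c f by (metis empty_subsetI insert_subset pathfinish_in_path_image pathstart_in_path_image)+
  have i12: "path_image c1 \<inter> path_image c2 = {p a, p b}"
  proof
    show "path_image c1 \<inter> path_image c2 \<subseteq> {p a, p b}"
    proof
      fix z assume "z \<in> path_image c1 \<inter> path_image c2"
      then obtain e e' where e: "e \<in> walk_edges ?P" "e' \<in> walk_edges ?Q" "z \<in> path_image (\<gamma> e)" "z \<in> path_image (\<gamma> e')"
        unfolding c1 c2 by blast
      have sub: "e \<inter> e' \<subseteq> {a, b}"
        using walk_edges_subset[OF e(1)] walk_edges_subset[OF e(2)] dist by auto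
      \<comment> \<open>An edge on both paths could only join \<open>a\<close> and \<open>b\<close>,
        but that edge is the chord, which is not in \<open>W\<close>.\<close>
      have "e \<noteq> e'"
      proof
        assume "e = e'"
        then have "e \<subseteq> {a, b}" "card e = 2" using sub wf PQ e(1) by (auto simp: wf_graph_def)
        then have "e = {a, b}" using dist by (intro card_subset_eq) auto
        then show False using ab e W by blast
      qed
      then have "z \<in> p ` (e \<inter> e')" using meet[of e e'] e W(1) by blast
      then show "z \<in> {p a, p b}" using sub by blast
    qed
  qed (use ends in auto)
  have i1c: "path_image c1 \<inter> path_image c = {p a, p b}"
  proof
    show "path_image c1 \<inter> path_image c \<subseteq> {p a, p b}"
    proof
      fix z assume "z \<in> path_image c1 \<inter> path_image c"
      then obtain e where e: "e \<in> walk_edges ?P" "z \<in> path_image (\<gamma> e)" "z \<in> path_image (\<gamma> {a, b})"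
        unfolding c1 c by blast
      have "e \<in> W" "e \<noteq> {a, b}" using e W ab by blast+
      then have "z \<in> p ` (e \<inter> {a, b})" using meet[of e "{a, b}"] e by blast
      then show "z \<in> {p a, p b}" by blast
    qed
  qed (use ends in auto)
  have i2c: "path_image c2 \<inter> path_image c = {p a, p b}"
  proof
    show "path_image c2 \<inter> path_image c \<subseteq> {p a, p b}"
    proof
      fix z assume "z \<in> path_image c2 \<inter> path_image c"
      then obtain e where e: "e \<in> walk_edges ?Q" "z \<in> path_image (\<gamma> e)" "z \<in> path_image (\<gamma> {a, b})"
        unfolding c2 c by blast
      have "e \<in> W" "e \<noteq> {a, b}" using e W ab by blast+
      then have "z \<in> p ` (e \<inter> {a, b})" using meet[of e "{a, b}"] e by blast
      then show "z \<in> {p a, p b}" by blast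
    qed
  qed (use ends in auto)
  have px: "p x \<in> path_image c1 - {p a, p b}"
    using walk_vertex[OF d, of ?P x] PQ xy xyab pinj V unfolding c1 by auto
  have py: "p y \<in> path_image c2 - {p a, p b}"
    using walk_vertex[OF d, of ?Q y] PQ xy xyab pinj V unfolding c2 by auto
  have fJ: "path_image f \<inter> (path_image c1 \<union> path_image c2) = {p x, p y}"
  proof
    show "path_image f \<inter> (path_image c1 \<union> path_image c2) \<subseteq> {p x, p y}"
    proof
      fix z assume "z \<in> path_image f \<inter> (path_image c1 \<union> path_image c2)"
      then obtain e where e: "e \<in> W" "z \<in> path_image (\<gamma> e)" "z \<in> path_image (\<gamma> {x, y})"
        unfolding J[symmetric] J_def f by blast
      have "e \<noteq> {x, y}"
        using e(1) xyab walk_edges_subset[of e ?P] walk_edges_subset[of e ?Q] unfolding W(1)[symmetric] by auto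
      then have "z \<in> p ` (e \<inter> {x, y})" using meet[of e "{x, y}"] e by blast
      then show "z \<in> {p x, p y}" by blast
    qed
  qed (use ends px py in auto)
  have fc: "path_image f \<inter> path_image c = {}"
  proof -
    have "{x, y} \<noteq> {a, b}" "{x, y} \<inter> {a, b} = {}" using xyab by auto
    then show ?thesis using meet[of "{x, y}" "{a, b}"] unfolding f c by auto
  qed
  show ?thesis
    using crossing_chords_inside[OF c1(1) c2(1) c(1) f(1) c1(2,3) c2(2,3) c(2,3) i12 i1c i2c]
      crossing_chords_outside[OF c1(1) c2(1) c(1) f(1) c1(2,3) c2(2,3) c(2,3) i12 i1c i2c]
      px py fJ fc unfolding f(2,3) J f(4)[symmetric] c(4)[symmetric] by blast
qed

text \<open>The hexagon a, x, b, y, c, z has three long diagonals that cross pairwise, and three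
  chords cannot have pairwise different sides when there are only two.\<close>

lemma K33_nonplanar:
  assumes "wf_graph G" "distinct [a, b, c, x, y, z]"
    "{{a, x}, {a, y}, {a, z}, {b, x}, {b, y}, {b, z}, {c, x}, {c, y}, {c, z}} \<subseteq> edges G"
  shows "\<not> planar G"
proof
  assume "planar G"
  then obtain p \<gamma> where d: "plane_drawing G p \<gamma>" by (auto simp: planar_def)
  define W where "W = {{a, x}, {x, b}, {b, y}, {y, c}, {c, z}, {z, a}}"
  have W: "W \<subseteq> edges G" using assms(3) by (simp add: W_def insert_commute)
  note X = crossing_chords[OF d assms(1) _ _ W]
  have "path_image (\<gamma> {a, y}) \<inter> inside (\<Union>e\<in>W. path_image (\<gamma> e)) = {} \<longleftrightarrow>
      path_image (\<gamma> {b, z}) \<inter> inside (\<Union>e\<in>W. path_image (\<gamma> e)) \<noteq> {}"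
    by (rule X[of a y "[x, b]" "[z, c]"])
      (use assms(2,3) in \<open>auto simp: W_def insert_commute doubleton_eq_iff\<close>)
  moreover have "path_image (\<gamma> {b, z}) \<inter> inside (\<Union>e\<in>W. path_image (\<gamma> e)) = {} \<longleftrightarrow>
      path_image (\<gamma> {c, x}) \<inter> inside (\<Union>e\<in>W. path_image (\<gamma> e)) \<noteq> {}"
    by (rule X[of b z "[y, c]" "[x, a]"])
      (use assms(2,3) in \<open>auto simp: W_def insert_commute doubleton_eq_iff\<close>)
  moreover have "path_image (\<gamma> {a, y}) \<inter> inside (\<Union>e\<in>W. path_image (\<gamma> e)) = {} \<longleftrightarrow>
      path_image (\<gamma> {x, c}) \<inter> inside (\<Union>e\<in>W. path_image (\<gamma> e)) \<noteq> {}"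
    by (rule X[of a y "[x, b]" "[z, c]"])
      (use assms(2,3) in \<open>auto simp: W_def insert_commute doubleton_eq_iff\<close>)
  ultimately show False by (auto simp: insert_commute)
qed

text \<open>Each of the five diagonals of the pentagon a, b, c, d, e crosses the next one in the
  order ac, bd, ce, da, eb; sides would have to alternate around a cycle of odd length.\<close>

lemma K5_nonplanar:
  assumes "wf_graph G" "distinct [a, b, c, d, e]"
    "{{a, b}, {a, c}, {a, d}, {a, e}, {b, c}, {b, d}, {b, e}, {c, d}, {c, e}, {d, e}} \<subseteq> edges G"
  shows "\<not> planar G"
proof
  assume "planar G"
  then obtain p \<gamma> where dr: "plane_drawing G p \<gamma>" by (auto simp: planar_def)
  define W where "W = {{a, b}, {b, c}, {c, d}, {d, e}, {e, a}}"
  have W: "W \<subseteq> edges G" using assms(3) by (simp add: W_def insert_commute)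
  define S where "S = (\<lambda>f. path_image (\<gamma> f) \<inter> inside (\<Union>e\<in>W. path_image (\<gamma> e)) = {})"
  note X = crossing_chords[OF dr assms(1) _ _ W]
  have "S {a, c} \<longleftrightarrow> \<not> S {b, d}"
    unfolding S_def by (rule X[of a c "[b]" "[e, d]"]) (use assms(2,3) in \<open>auto simp: W_def insert_commute doubleton_eq_iff\<close>)
  moreover have "S {b, d} \<longleftrightarrow> \<not> S {c, e}"
    unfolding S_def by (rule X[of b d "[c]" "[a, e]"]) (use assms(2,3) in \<open>auto simp: W_def insert_commute doubleton_eq_iff\<close>)
  moreover have "S {c, e} \<longleftrightarrow> \<not> S {d, a}"
    unfolding S_def by (rule X[of c e "[d]" "[b, a]"]) (use assms(2,3) in \<open>auto simp: W_def insert_commute doubleton_eq_iff\<close>)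
  moreover have "S {d, a} \<longleftrightarrow> \<not> S {e, b}"
    unfolding S_def by (rule X[of d a "[e]" "[c, b]"]) (use assms(2,3) in \<open>auto simp: W_def insert_commute doubleton_eq_iff\<close>)
  moreover have "S {e, b} \<longleftrightarrow> \<not> S {a, c}"
    unfolding S_def by (rule X[of e b "[a]" "[d, c]"]) (use assms(2,3) in \<open>auto simp: W_def insert_commute doubleton_eq_iff\<close>)
  ultimately show False by blast
qed

subsection \<open>Minors of apex graphs\<close>

lemma graph_iso_sym:
  assumes "graph_iso G H" "wf_graph G"
  shows "graph_iso H G"
proof -
  obtain f where f: "bij_betw f (verts G) (verts H)" "edges H = (`) f ` edges G"
    using assms(1) by (auto simp: graph_iso_def)
  have "inv_into (verts G) f ` f ` e = e" if "e \<in> edges G" for e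
    using inv_into_image_cancel[of f "verts G" e] f(1) assms(2) that
    by (auto simp: bij_betw_def wf_graph_def)
  then have "edges G = (`) (inv_into (verts G) f) ` edges H"
    unfolding f(2) by (force simp: image_image)
  then show ?thesis using bij_betw_inv_into[OF f(1)] by (auto simp: graph_iso_def)
qed

text \<open>No loop arises: the ends of an edge are identified only if they are \<open>u\<close> and
  \<open>v\<close>, and that edge has been removed.\<close>

lemma wf_contract_edge:
  assumes "wf_graph G" "{u, v} \<in> edges G" "u \<noteq> v"
  shows "wf_graph (contract_edge u v G)"
  unfolding wf_graph_def
proof
  let ?f = "\<lambda>x. if x = v then u else x"
  fix e' assume "e' \<in> edges (contract_edge u v G)"
  then obtain e where e: "e \<in> edges G" "e \<noteq> {u, v}" "e' = ?f ` e"
    by (auto simp: contract_edge_def)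
  have eV: "e \<subseteq> verts G" "card e = 2" and uV: "u \<in> verts G" using assms e by (auto simp: wf_graph_def)
  have fin: "finite e" using eV(2) by (simp add: card_ge_0_finite)
  have "inj_on ?f e"
  proof (rule inj_onI, rule ccontr)
    fix x y assume xy: "x \<in> e" "y \<in> e" "?f x = ?f y" "x \<noteq> y"
    then have "{u, v} \<subseteq> e" by (auto split: if_splits)
    then show False using card_subset_eq[OF fin, of "{u, v}"] eV(2) assms(3) e(2) by auto
  qed
  then have "card e' = 2" using e(3) eV(2) by (simp only: card_image)
  moreover have "e' \<subseteq> verts G - {v}" using e(3) eV(1) uV assms(3) by auto
  ultimately show "e' \<subseteq> verts (contract_edge u v G) \<and> card e' = 2"
    by (simp add: contract_edge_def)
qed

lemma wf_delete_vertex: "wf_graph G \<Longrightarrow> wf_graph (delete_vertex G v)"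
  by (auto simp: wf_graph_def delete_vertex_def)

definition apex :: "'a graph \<Rightarrow> bool" where
  "apex G \<longleftrightarrow> (\<exists>w\<in>verts G. planar (delete_vertex G w))"

text \<open>If the apex \<open>w\<close> of \<open>G\<close> is missing from \<open>H\<close>, then
  \<open>H\<close> already lies in the planar graph \<open>G - w\<close>, and any vertex of
  \<open>H\<close> can be deleted instead.\<close>

lemma apex_mono:
  assumes "apex G" "wf_graph H" "verts H \<noteq> {}" "verts H \<subseteq> verts G" "edges H \<subseteq> edges G"
  shows "apex H"
proof -
  obtain w where w: "w \<in> verts G" "planar (delete_vertex G w)" using assms(1) by (auto simp: apex_def)
  show ?thesis
  proof (cases "w \<in> verts H")
    case True
    have "planar (delete_vertex H w)"
      by (rule planar_mono[OF w(2)]) (use assms in \<open>auto simp: delete_vertex_def\<close>)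
    then show ?thesis using True by (auto simp: apex_def)
  next
    case False
    obtain x where x: "x \<in> verts H" using assms(3) by auto
    have "planar (delete_vertex H x)"
      by (rule planar_mono[OF w(2)]) (use assms False in \<open>auto simp: delete_vertex_def wf_graph_def\<close>)
    then show ?thesis using x by (auto simp: apex_def)
  qed
qed

lemma apex_iso:
  assumes "apex G" "wf_graph G" "graph_iso G H"
  shows "apex H"
proof -
  obtain w where w: "w \<in> verts G" "planar (delete_vertex G w)" using assms(1) by (auto simp: apex_def)
  obtain f where f: "bij_betw f (verts G) (verts H)" "edges H = (`) f ` edges G"
    using assms(3) by (auto simp: graph_iso_def)
  have inj: "f x = f y \<longleftrightarrow> x = y" if "x \<in> verts G" "y \<in> verts G" for x y
    using f(1) that by (auto simp: bij_betw_def inj_on_def)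
  have fw: "f w \<in> verts H" using f(1) w(1) by (auto simp: bij_betw_def)
  have mem: "f w \<in> f ` e \<longleftrightarrow> w \<in> e" if "e \<in> edges G" for e
    using that assms(2) inj w(1) by (auto simp: wf_graph_def)
  have "bij_betw f (verts G - {w}) (verts H - {f w})"
    using f(1) w(1) by (auto simp: bij_betw_def inj_on_def)
  moreover have "{e \<in> edges H. f w \<notin> e} = (`) f ` {e \<in> edges G. w \<notin> e}"
    unfolding f(2) using mem by auto
  ultimately have "graph_iso (delete_vertex G w) (delete_vertex H (f w))"
    by (auto simp: graph_iso_def delete_vertex_def)
  then have "planar (delete_vertex H (f w))"
    using planar_iso[OF w(2) wf_delete_vertex[OF assms(2)]] by blast
  then show ?thesis using fw by (auto simp: apex_def)
qed

text \<open>\<open>contract_edge\<close> names the merged vertex after its first argument. A minor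
  may contract in either order, whereas a certificate treats only one.\<close>

lemma contract_edge_commute_iso:
  assumes "u \<in> verts G" "v \<in> verts G" "u \<noteq> v"
  shows "graph_iso (contract_edge u v G) (contract_edge v u G)"
  unfolding graph_iso_def
proof (intro exI conjI)
  let ?f = "\<lambda>x. if x = u then v else x"
  show "bij_betw ?f (verts (contract_edge u v G)) (verts (contract_edge v u G))"
    using assms by (auto simp: bij_betw_def contract_edge_def inj_on_def)
  have "?f ` (\<lambda>x. if x = v then u else x) ` e = ?f ` e" for e
    unfolding image_image by (rule image_cong) auto
  then show "edges (contract_edge v u G) = (`) ?f ` edges (contract_edge u v G)"
    by (simp add: contract_edge_def image_image insert_commute)
qed

lemma delete_vertex_contract_edge:
  assumes "wf_graph G" "{u, v} \<in> edges G" "u \<noteq> v" "w \<noteq> u" "w \<noteq> v"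
  shows "delete_vertex (contract_edge u v G) w = contract_edge u v (delete_vertex G w)"
  using assms by (auto simp: delete_vertex_def contract_edge_def image_iff split: if_splits)

text \<open>If the apex is an end of the contracted edge, deleting the merged vertex removes both
  ends and leaves a subgraph of \<open>G - w\<close>. Otherwise deletion and contraction
  commute.\<close>

lemma apex_contract_edge:
  assumes "apex G" "wf_graph G" "{u, v} \<in> edges G" "u \<noteq> v"
  shows "apex (contract_edge u v G)"
proof -
  obtain w where w: "w \<in> verts G" "planar (delete_vertex G w)" using assms(1) by (auto simp: apex_def)
  have uv: "u \<in> verts G" "v \<in> verts G" using assms by (auto simp: wf_graph_def)
  show ?thesis
  proof (cases "w = u \<or> w = v")
    case True
    have "edges (delete_vertex (contract_edge u v G) u) \<subseteq> {e \<in> edges G. u \<notin> e \<and> v \<notin> e}"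
    proof
      fix e' assume "e' \<in> edges (delete_vertex (contract_edge u v G) u)"
      then obtain e where e: "e \<in> edges G" "e' = (\<lambda>x. if x = v then u else x) ` e" "u \<notin> e'"
        by (auto simp: delete_vertex_def contract_edge_def)
      then have "v \<notin> e" by auto
      then have "e' = e" using e(2) by (auto simp: image_iff)
      then show "e' \<in> {e \<in> edges G. u \<notin> e \<and> v \<notin> e}" using e \<open>v \<notin> e\<close> by simp
    qed
    then have "planar (delete_vertex (contract_edge u v G) u)"
      using True by (intro planar_mono[OF w(2)]) (auto simp: delete_vertex_def contract_edge_def)
    then show ?thesis using uv assms(4) by (auto simp: apex_def contract_edge_def)
  next
    case False
    have "planar (contract_edge u v (delete_vertex G w))"
      using False assms w(2)
      by (intro planar_contract_edge wf_delete_vertex) (auto simp: delete_vertex_def)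
    moreover have "delete_vertex (contract_edge u v G) w = contract_edge u v (delete_vertex G w)"
      using delete_vertex_contract_edge[OF assms(2-4)] False by blast
    moreover have "w \<in> verts (contract_edge u v G)"
      using False w(1) by (simp add: contract_edge_def)
    ultimately show ?thesis unfolding apex_def by metis
  qed
qed

lemma apex_contracts_rtranclp:
  "contracts\<^sup>*\<^sup>* G H \<Longrightarrow> apex G \<Longrightarrow> wf_graph G \<Longrightarrow> apex H \<and> wf_graph H"
proof (induction rule: rtranclp_induct)
  case (step H K)
  then obtain u v where uv: "u \<noteq> v" "{u, v} \<in> edges H" and K: "K = contract_edge u v H"
    by (auto simp: contracts_def)
  have "apex H" "wf_graph H" using step by auto
  then show ?case unfolding K using apex_contract_edge[OF _ _ uv(2,1)] wf_contract_edge[OF _ uv(2,1)] by simp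
qed auto

lemma NA_iff: "NA G \<longleftrightarrow> simple_graph G \<and> \<not> apex G"
  by (auto simp: NA_def apex_def)

lemma simple_imp_wf: "simple_graph G \<Longrightarrow> wf_graph G"
  by (auto simp: simple_graph_def wf_graph_def)

section \<open>Minimality from single edge operations\<close>

lemma MMNA_I:
  assumes NA: "NA G"
    and cover: "\<And>x. x \<in> verts G \<Longrightarrow> \<exists>e\<in>edges G. x \<in> e"
    and del: "\<And>e. e \<in> edges G \<Longrightarrow> apex (Graph (verts G) (edges G - {e}))"
    and con: "\<And>e. e \<in> edges G \<Longrightarrow> \<exists>u v. e = {u, v} \<and> u \<noteq> v \<and> apex (contract_edge u v G)"
  shows "MMNA G"
  unfolding MMNA_def
proof (intro conjI allI impI)
  fix H assume "proper_minor H G"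
  then obtain S K where S: "subgraph S G" "contracts\<^sup>*\<^sup>* S K" "graph_iso K H" and H: "\<not> graph_iso H G"
    by (auto simp: proper_minor_def minor_def)
  have wfG: "wf_graph G" using NA by (simp add: NA_iff simple_imp_wf)
  have wfS: "wf_graph S" and S': "verts S \<noteq> {}" "verts S \<subseteq> verts G" "edges S \<subseteq> edges G"
    using S(1) by (auto simp: subgraph_def simple_imp_wf simple_graph_def)
  have con': "apex (contract_edge u v G)" if uv: "{u, v} \<in> edges G" "u \<noteq> v" for u v
  proof -
    obtain u' v' where u': "{u, v} = {u', v'}" "apex (contract_edge u' v' G)"
      using con[OF uv(1)] by auto
    have "u' \<noteq> v'" "{u', v'} \<in> edges G" using u' uv by auto
    \<comment> \<open>The hypothesis provides the contraction for one order of the ends only; the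
      other order follows by isomorphism.\<close>
    then have "apex (contract_edge v' u' G)"
      using apex_iso[OF u'(2) wf_contract_edge contract_edge_commute_iso] wfG
      by (auto simp: wf_graph_def)
    then show ?thesis using u' by (auto simp: doubleton_eq_iff)
  qed
  have "apex K \<and> wf_graph K"
  proof (cases "S = G")
    case False
    obtain e where e: "e \<in> edges G" "e \<notin> edges S"
    proof (cases "edges S = edges G")
      case True
      \<comment> \<open>A missing vertex would take one of its edges with it, so a subgraph other
        than \<open>G\<close> always misses an edge.\<close>
      then have "verts S \<noteq> verts G" using False by (cases S; cases G) auto
      then obtain x where "x \<in> verts G" "x \<notin> verts S" using S' by auto
      then show ?thesis using cover[of x] True wfS by (auto simp: wf_graph_def)
    qed (use S' that in auto)
    have "apex S" by (rule apex_mono[OF del[OF e(1)] wfS]) (use S' e in auto)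
    then show ?thesis using apex_contracts_rtranclp S(2) wfS by blast
  next
    case True
    from S(2) have "contracts\<^sup>*\<^sup>* G K" by (simp add: True)
    then show ?thesis
    proof (cases rule: converse_rtranclpE)
      case base
      \<comment> \<open>With no deletion and no contraction the minor is isomorphic to
        \<open>G\<close>, hence not proper.\<close>
      then show ?thesis using graph_iso_sym[of G H] S(3) H wfG by auto
    next
      case (step K1)
      then obtain u v where "u \<noteq> v" "{u, v} \<in> edges G" "K1 = contract_edge u v G"
        by (auto simp: contracts_def)
      then show ?thesis
        using con' wf_contract_edge[OF wfG] apex_contracts_rtranclp[OF step(2)] by auto
    qed
  qed
  then show "\<not> NA H" using apex_iso S(3) NA_iff by blast
qed (rule NA)

section \<open>Degree sequences as isomorphism invariants\<close>

definition degrees :: "'a graph \<Rightarrow> nat multiset" where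
  "degrees G = image_mset (\<lambda>v. card {e \<in> edges G. v \<in> e}) (mset_set (verts G))"

lemma degrees_iso:
  assumes "graph_iso G H" "wf_graph G"
  shows "degrees G = degrees H"
proof -
  obtain f where f: "bij_betw f (verts G) (verts H)" "edges H = (`) f ` edges G"
    using assms(1) by (auto simp: graph_iso_def)
  have inj: "f x = f y \<longleftrightarrow> x = y" if "x \<in> verts G" "y \<in> verts G" for x y
    using f(1) that by (auto simp: bij_betw_def inj_on_def)
  have deg: "card {e \<in> edges H. f v \<in> e} = card {e \<in> edges G. v \<in> e}" if v: "v \<in> verts G" for v
  proof -
    have "f v \<in> f ` e \<longleftrightarrow> v \<in> e" if "e \<in> edges G" for e
      using that assms(2) inj v by (auto simp: wf_graph_def)
    then have "{e \<in> edges H. f v \<in> e} = (`) f ` {e \<in> edges G. v \<in> e}"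
      unfolding f(2) by auto
    moreover have "inj_on ((`) f) {e \<in> edges G. v \<in> e}"
      using f(1) assms(2)
      by (intro inj_on_subset[OF inj_on_image_Pow[of f "verts G"]]) (auto simp: bij_betw_def wf_graph_def)
    ultimately show ?thesis by (simp add: card_image)
  qed
  have "mset_set (verts H) = image_mset f (mset_set (verts G))"
    using image_mset_mset_set[of f "verts G"] f(1) by (simp add: bij_betw_def)
  then have "degrees H = image_mset (\<lambda>v. card {e \<in> edges H. f v \<in> e}) (mset_set (verts G))"
    by (simp add: degrees_def image_mset.compositionality comp_def)
  also have "\<dots> = degrees G"
    \<comment> \<open>\<open>mset_set\<close> of an infinite set is empty, so both sides agree in
      that case too.\<close>
    unfolding degrees_def using deg
    by (intro image_mset_cong) (metis elem_mset_set emptyE infinite_set_mset_mset_set)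
  finally show ?thesis by simp
qed

subsection \<open>Two-page book embeddings\<close>

text \<open>Intervals that are nested or do not overlap can carry edges of the same page: an edge with ends
  at \<open>a < b\<close> on the spine is drawn as the parabola arc \<open>y = \<plusminus> (x - a) (b - x)\<close>, and these arcs meet only
  in common ends.\<close>

definition noncrossing :: "'a::linorder \<times> 'a \<Rightarrow> 'a \<times> 'a \<Rightarrow> bool" where
  "noncrossing I J \<longleftrightarrow> (case (I, J) of ((a, b), (c, d)) \<Rightarrow>
     b \<le> c \<or> d \<le> a \<or> (a \<le> c \<and> d \<le> b) \<or> (c \<le> a \<and> b \<le> d))"

text \<open>Strictly between \<open>c\<close> and \<open>d\<close> the outer parabola is strictly
  higher: both of its factors are at least as large, and one is larger because the intervals
  differ.\<close>

lemma nested_parabolas: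
  fixes a b c d x :: real
  assumes "a \<le> c" "d \<le> b" "c \<le> x" "x \<le> d" "(a, b) \<noteq> (c, d)" "c < d"
    "(x - a) * (b - x) = (x - c) * (d - x)"
  shows "(x = a \<or> x = b) \<and> (x = c \<or> x = d)"
proof -
  consider "x = c" | "x = d" | "c < x" "x < d" using assms by linarith
  then show ?thesis
  proof cases
    case 3
    have "(x - c) * (d - x) < (x - a) * (b - x)"
    proof (cases "a < c")
      case True
      then show ?thesis using assms 3 by (intro mult_less_le_imp_less) auto
    next
      case False
      then show ?thesis using assms 3 by (intro mult_le_less_imp_less) auto
    qed
    then show ?thesis using assms by simp
  qed (use assms in auto)
qed

lemma noncrossing_parabolas:
  fixes a b c d x :: real
  assumes "noncrossing (a, b) (c, d)" "(a, b) \<noteq> (c, d)" "a < b" "c < d"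
    "a \<le> x" "x \<le> b" "c \<le> x" "x \<le> d" "(x - a) * (b - x) = (x - c) * (d - x)"
  shows "(x = a \<or> x = b) \<and> (x = c \<or> x = d)"
proof -
  consider "b \<le> c" | "d \<le> a" | "a \<le> c" "d \<le> b" | "c \<le> a" "b \<le> d"
    using assms(1) by (auto simp: noncrossing_def)
  then show ?thesis
  proof cases
    case 3 then show ?thesis using nested_parabolas[of a c d b x] assms by auto
  next
    case 4 then show ?thesis using nested_parabolas[of c a b d x] assms by auto
  qed (use assms in auto)
qed

text \<open>\<open>q\<close> places the vertices on the real axis and \<open>upper\<close> selects
  the half plane of each edge. Same-page arcs are handled by the parabola lemma, arcs on different
  pages by the sign of their heights.\<close>

lemma book_embedding_planar:
  fixes q :: "'a \<Rightarrow> real" and upper :: "'a set \<Rightarrow> bool"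
  assumes inj: "inj_on q (verts G)" and wf: "wf_graph G"
    and pages: "\<And>e e'. e \<in> edges G \<Longrightarrow> e' \<in> edges G \<Longrightarrow> e \<noteq> e' \<Longrightarrow> upper e = upper e' \<Longrightarrow>
      noncrossing (Min (q ` e), Max (q ` e)) (Min (q ` e'), Max (q ` e'))"
  shows "planar G"
proof -
  define lo where "lo e = Min (q ` e)" for e
  define hi where "hi e = Max (q ` e)" for e
  define s where "s e = (if upper e then 1 else -1 :: real)" for e
  define \<gamma> where "\<gamma> e = (\<lambda>t. Complex (lo e + (hi e - lo e) * t)
     (s e * ((hi e - lo e) * t * ((hi e - lo e) * (1 - t)))))" for e
  have e_eq: "q ` e = {lo e, hi e} \<and> lo e < hi e" if "e \<in> edges G" for e
  proof -
    have "e \<subseteq> verts G" "card e = 2" using wf that by (auto simp: wf_graph_def)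
    then obtain x y where xy: "e = {x, y}" "x \<noteq> y" "x \<in> verts G" "y \<in> verts G"
      by (auto simp: card_2_iff)
    then have "q x \<noteq> q y" using inj by (auto simp: inj_on_def)
    then show ?thesis using xy(1) by (auto simp: lo_def hi_def min_def max_def)
  qed
  have pim: "path_image (\<gamma> e) = {Complex x (s e * ((x - lo e) * (hi e - x))) | x. lo e \<le> x \<and> x \<le> hi e}"
    if "e \<in> edges G" for e
  proof -
    have l: "lo e < hi e" using e_eq[OF that] by simp
    have "Complex x (s e * ((x - lo e) * (hi e - x))) \<in> path_image (\<gamma> e)" if x: "lo e \<le> x" "x \<le> hi e" for x
    proof -
      define t where "t = (x - lo e) / (hi e - lo e)"
      have t: "0 \<le> t" "t \<le> 1" and 1: "(hi e - lo e) * t = x - lo e"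
        using x l by (auto simp: t_def field_simps)
      have 2: "(hi e - lo e) * (1 - t) = hi e - x" using 1 by (simp add: algebra_simps)
      have "\<gamma> e t = Complex x (s e * ((x - lo e) * (hi e - x)))"
        unfolding \<gamma>_def 1 2 by simp
      then show ?thesis using t unfolding path_image_def by (metis atLeastAtMost_iff imageI)
    qed
    moreover have "\<exists>x. \<gamma> e t = Complex x (s e * ((x - lo e) * (hi e - x))) \<and> lo e \<le> x \<and> x \<le> hi e"
      if "0 \<le> t" "t \<le> 1" for t
    proof (intro exI[of _ "lo e + (hi e - lo e) * t"] conjI)
      have "(hi e - lo e) * t \<le> hi e - lo e" "0 \<le> (hi e - lo e) * t" using l that by (simp_all add: mult_left_le)
      then show "lo e + (hi e - lo e) * t \<le> hi e" "lo e \<le> lo e + (hi e - lo e) * t" by simp_all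
      have "(hi e - lo e) * (1 - t) = hi e - (lo e + (hi e - lo e) * t)" by (simp add: algebra_simps)
      then show "\<gamma> e t = Complex (lo e + (hi e - lo e) * t)
          (s e * ((lo e + (hi e - lo e) * t - lo e) * (hi e - (lo e + (hi e - lo e) * t))))"
        unfolding \<gamma>_def by simp
    qed
    ultimately show ?thesis by (auto simp: path_image_def)
  qed
  have mem: "v \<in> e" if "e \<in> edges G" "v \<in> verts G" "q v = lo e \<or> q v = hi e" for e v
  proof -
    have "q v \<in> q ` e" using that e_eq[OF that(1)] by auto
    then obtain w where "w \<in> e" "q v = q w" by auto
    then show ?thesis using inj that wf by (auto simp: inj_on_def wf_graph_def)
  qed
  have vert: "\<exists>v\<in>e. q v = x" if "e \<in> edges G" "x = lo e \<or> x = hi e" for e x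
    using e_eq[OF that(1)] that(2) by (metis imageE insertCI)
  have "plane_drawing G (\<lambda>v. Complex (q v) 0) \<gamma>"
    unfolding plane_drawing_def
  proof (intro conjI ballI impI)
    show "inj_on (\<lambda>v. Complex (q v) 0) (verts G)" using inj by (auto simp: inj_on_def)
  next
    fix e assume e: "e \<in> edges G"
    have l: "lo e < hi e" using e_eq[OF e] by simp
    have "continuous_on {0..1} (\<gamma> e)"
      unfolding \<gamma>_def by (intro continuous_intros)
    moreover have "inj_on (\<gamma> e) {0..1}"
      using l by (auto simp: inj_on_def \<gamma>_def)
    ultimately show "arc (\<gamma> e)" by (simp add: arc_def path_def)
    have "pathstart (\<gamma> e) = Complex (lo e) 0" "pathfinish (\<gamma> e) = Complex (hi e) 0"
      by (simp_all add: \<gamma>_def pathstart_def pathfinish_def)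
    moreover have "(\<lambda>v. Complex (q v) 0) ` e = (\<lambda>x. Complex x 0) ` q ` e"
      by (simp add: image_image)
    ultimately show "{pathstart (\<gamma> e), pathfinish (\<gamma> e)} = (\<lambda>v. Complex (q v) 0) ` e"
      using e_eq[OF e] by simp
    fix v assume v: "v \<in> verts G" "Complex (q v) 0 \<in> path_image (\<gamma> e)"
    \<comment> \<open>The parabola has height 0 only at its two ends, so the arc passes over or
      under every vertex between them.\<close>
    then have "(q v - lo e) * (hi e - q v) = 0" unfolding pim[OF e] by (auto simp: s_def split: if_splits)
    then show "v \<in> e" using mem[OF e v(1)] by auto
  next
    fix e e' assume e: "e \<in> edges G" "e' \<in> edges G" and ne: "e \<noteq> e'"
    have l: "lo e < hi e" "lo e' < hi e'" using e_eq e by auto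
    \<comment> \<open>An edge is determined by its interval because \<open>q\<close> is injective on
      the vertices.\<close>
    have ne': "(lo e, hi e) \<noteq> (lo e', hi e')"
    proof
      assume eq: "(lo e, hi e) = (lo e', hi e')"
      have sub: "e1 \<subseteq> e2" if "e1 \<in> edges G" "e2 \<in> edges G" "(lo e1, hi e1) = (lo e2, hi e2)" for e1 e2
      proof
        fix v assume v: "v \<in> e1"
        then have "q v = lo e2 \<or> q v = hi e2" using e_eq[OF that(1)] that(3) by auto
        then show "v \<in> e2" using mem[OF that(2)] v that(1) wf by (auto simp: wf_graph_def)
      qed
      show False using sub[OF e eq] sub[OF e(2,1) eq[symmetric]] ne by auto
    qed
    show "path_image (\<gamma> e) \<inter> path_image (\<gamma> e') \<subseteq> (\<lambda>v. Complex (q v) 0) ` (e \<inter> e')"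
    proof
      fix z assume "z \<in> path_image (\<gamma> e) \<inter> path_image (\<gamma> e')"
      then obtain x where x: "lo e \<le> x" "x \<le> hi e" "lo e' \<le> x" "x \<le> hi e'"
        "z = Complex x (s e * ((x - lo e) * (hi e - x)))"
        "s e * ((x - lo e) * (hi e - x)) = s e' * ((x - lo e') * (hi e' - x))"
        unfolding pim[OF e(1)] pim[OF e(2)] by auto
      have "(x = lo e \<or> x = hi e) \<and> (x = lo e' \<or> x = hi e')"
      proof (cases "upper e = upper e'")
        case True
        then have "(x - lo e) * (hi e - x) = (x - lo e') * (hi e' - x)"
          using x(6) by (auto simp: s_def split: if_splits)
        then show ?thesis
          using noncrossing_parabolas[OF pages[OF e ne True, folded lo_def hi_def] ne' l x(1-4)] by simp
      next
        case False
        \<comment> \<open>On different pages the two heights have opposite signs, so a common point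
          has height 0 and is an end of both arcs.\<close>
        have "(x - lo e) * (hi e - x) \<ge> 0" "(x - lo e') * (hi e' - x) \<ge> 0" using x by auto
        moreover have "(x - lo e) * (hi e - x) = - ((x - lo e') * (hi e' - x))"
          using x(6) False by (auto simp: s_def split: if_splits)
        ultimately have "(x - lo e) * (hi e - x) = 0" "(x - lo e') * (hi e' - x) = 0"
          by linarith+
        then show ?thesis by auto
      qed
      then have xe: "x = lo e \<or> x = hi e" "x = lo e' \<or> x = hi e'" by auto
      obtain v where v: "v \<in> e" "q v = x" using vert[OF e(1) xe(1)] by auto
      have "v \<in> e'" using mem[OF e(2), of v] v xe(2) e(1) wf by (auto simp: wf_graph_def)
      moreover have "z = Complex (q v) 0" using x(5) xe(1) v(2) by auto
      ultimately show "z \<in> (\<lambda>v. Complex (q v) 0) ` (e \<inter> e')" using v by blast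
    qed
  qed
  then show ?thesis by (auto simp: planar_def)
qed

subsection \<open>Checking certificates\<close>

definition edge_sets :: "('a \<times> 'a) list \<Rightarrow> 'a set set" where
  "edge_sets es = (\<lambda>(a, b). {a, b}) ` set es"

definition list_graph :: "nat \<Rightarrow> (nat \<times> nat) list \<Rightarrow> nat graph" where
  "list_graph n es = Graph {..<n} (edge_sets es)"

definition no_loops :: "('a \<times> 'a) list \<Rightarrow> bool" where
  "no_loops es \<longleftrightarrow> (\<forall>(a, b)\<in>set es. a \<noteq> b)"

definition del_list :: "'a \<Rightarrow> ('a \<times> 'a) list \<Rightarrow> ('a \<times> 'a) list" where
  "del_list w es = filter (\<lambda>(a, b). a \<noteq> w \<and> b \<noteq> w) es"

text \<open>The contracted edge turns into a loop and is filtered out. Parallel edges remain as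
  repeated or reversed pairs and are merged only by \<open>edge_sets\<close>.\<close>

definition contract_list :: "'a \<Rightarrow> 'a \<Rightarrow> ('a \<times> 'a) list \<Rightarrow> ('a \<times> 'a) list" where
  "contract_list u v es = filter (\<lambda>(a, b). a \<noteq> b)
     (map (\<lambda>(a, b). (if a = v then u else a, if b = v then u else b)) es)"

lemma edge_sets_iff: "e \<in> edge_sets es \<longleftrightarrow> (\<exists>a b. (a, b) \<in> set es \<and> e = {a, b})"
  by (auto simp: edge_sets_def)

lemma edge_setsI: "(a, b) \<in> set es \<Longrightarrow> {a, b} \<in> edge_sets es"
  by (auto simp: edge_sets_iff)

lemma edge_setsE:
  assumes "e \<in> edge_sets es"
  obtains a b where "(a, b) \<in> set es" "e = {a, b}"
  using assms unfolding edge_sets_iff by blast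

lemma delete_vertex_list: "delete_vertex (Graph V (edge_sets es)) w = Graph (V - {w}) (edge_sets (del_list w es))"
proof -
  have "{e \<in> edge_sets es. w \<notin> e} = edge_sets (del_list w es)"
    by (auto simp: del_list_def intro!: edge_setsI elim!: edge_setsE)
  then show ?thesis by (simp add: delete_vertex_def)
qed

text \<open>In a list without loops only the pair of \<open>u\<close> and \<open>v\<close> becomes a
  loop, so filtering loops after renaming amounts to removing \<open>{u, v}\<close> before
  it.\<close>

lemma edge_sets_contract_list:
  assumes "no_loops es" "u \<noteq> v"
  shows "edge_sets (contract_list u v es) = (`) (\<lambda>x. if x = v then u else x) ` (edge_sets es - {{u, v}})"
    (is "?L = (`) ?f ` ?R")
proof (intro equalityI subsetI)
  fix e assume "e \<in> ?L"
  then obtain a b where ab: "(a, b) \<in> set es" "?f a \<noteq> ?f b" "e = {?f a, ?f b}"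
    by (auto simp: edge_sets_iff contract_list_def)
  then have "{a, b} \<in> ?R" by (auto simp: edge_sets_iff doubleton_eq_iff)
  moreover have "e = ?f ` {a, b}" using ab by simp
  ultimately show "e \<in> (`) ?f ` ?R" by blast
next
  fix e assume "e \<in> (`) ?f ` ?R"
  then obtain e0 where e0: "e0 \<in> edge_sets es" "e0 \<noteq> {u, v}" "e = ?f ` e0" by blast
  obtain a b where "(a, b) \<in> set es" "e0 = {a, b}" using e0(1) by (rule edge_setsE)
  then have ab: "(a, b) \<in> set es" "{a, b} \<noteq> {u, v}" "e = ?f ` {a, b}" using e0 by simp_all
  have "a \<noteq> b" using assms(1) ab(1) by (auto simp: no_loops_def)
  then have "?f a \<noteq> ?f b" using ab(2) by (auto split: if_splits)
  then have "(?f a, ?f b) \<in> set (contract_list u v es)"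
    using ab(1) by (force simp: contract_list_def)
  moreover have "e = {?f a, ?f b}" using ab(3) by simp
  ultimately show "e \<in> ?L" unfolding edge_sets_iff by blast
qed

lemma contract_edge_list:
  assumes "no_loops es" "u \<noteq> v"
  shows "contract_edge u v (Graph V (edge_sets es)) = Graph (V - {v}) (edge_sets (contract_list u v es))"
  using edge_sets_contract_list[OF assms] by (simp add: contract_edge_def)

lemma no_loops_contract_list: "no_loops (contract_list u v es)"
  by (auto simp: no_loops_def contract_list_def)

section \<open>Certificates for nonplanarity\<close>

fun joined :: "('a \<times> 'a) list \<Rightarrow> 'a \<Rightarrow> 'a \<Rightarrow> bool" where
  "joined es a b \<longleftrightarrow> (a, b) \<in> set es \<or> (b, a) \<in> set es"

text \<open>The length of the list decides the type: five vertices for K5, six for K33 with the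
  first three forming one side.\<close>

fun kuratowski :: "('a \<times> 'a) list \<Rightarrow> 'a list \<Rightarrow> bool" where
  "kuratowski es [a, b, c, d, e] \<longleftrightarrow> distinct [a, b, c, d, e] \<and>
     list_all (\<lambda>(x, y). joined es x y)
       [(a, b), (a, c), (a, d), (a, e), (b, c), (b, d), (b, e), (c, d), (c, e), (d, e)]"
| "kuratowski es [a, b, c, x, y, z] \<longleftrightarrow> distinct [a, b, c, x, y, z] \<and>
     list_all (\<lambda>(x, y). joined es x y)
       [(a, x), (a, y), (a, z), (b, x), (b, y), (b, z), (c, x), (c, y), (c, z)]"
| "kuratowski es _ \<longleftrightarrow> False"

fun kuratowski_minor :: "('a \<times> 'a) list \<Rightarrow> ('a \<times> 'a) list \<times> 'a list \<Rightarrow> bool" where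
  "kuratowski_minor es ([], br) \<longleftrightarrow> kuratowski es br"
| "kuratowski_minor es ((u, v) # cs, br) \<longleftrightarrow>
     u \<noteq> v \<and> joined es u v \<and> kuratowski_minor (contract_list u v es) (cs, br)"

lemma joined_edge: "joined es a b \<longleftrightarrow> {a, b} \<in> edge_sets es"
  by (auto simp: edge_sets_iff doubleton_eq_iff)

lemma kuratowski_nonplanar:
  assumes "kuratowski es br" "wf_graph (Graph V (edge_sets es))"
  shows "\<not> planar (Graph V (edge_sets es))"
  using assms(1)
proof (cases "(es, br)" rule: kuratowski.cases)
  case (1 es' a b c d e)
  then show ?thesis using assms
    by (intro K5_nonplanar[of _ a b c d e]) (auto simp: joined_edge simp del: joined.simps)
next
  case (2 es' a b c x y z)
  then show ?thesis using assms
    by (intro K33_nonplanar[of _ a b c x y z]) (auto simp: joined_edge simp del: joined.simps)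
qed auto

text \<open>Contraction preserves planarity, used contrapositively one step at a time.
  \<open>V\<close> varies because every contraction removes a vertex.\<close>

lemma kuratowski_minor_nonplanar:
  "kuratowski_minor es c \<Longrightarrow> no_loops es \<Longrightarrow> wf_graph (Graph V (edge_sets es)) \<Longrightarrow>
    \<not> planar (Graph V (edge_sets es))"
proof (induction es c arbitrary: V rule: kuratowski_minor.induct)
  case (1 es br)
  then show ?case by (simp add: kuratowski_nonplanar)
next
  case (2 es u v cs br)
  then have uv: "u \<noteq> v" "{u, v} \<in> edges (Graph V (edge_sets es))"
    and k: "kuratowski_minor (contract_list u v es) (cs, br)"
    by (simp_all add: joined_edge del: joined.simps)
  have "wf_graph (contract_edge u v (Graph V (edge_sets es)))"
    using wf_contract_edge[OF 2(4) uv(2,1)] .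
  then have "\<not> planar (contract_edge u v (Graph V (edge_sets es)))"
    unfolding contract_edge_list[OF 2(3) uv(1)] using 2(1)[OF k no_loops_contract_list] by blast
  then show ?case using planar_contract_edge[OF _ 2(4) uv(2,1)] by blast
qed

section \<open>Certificates for planarity\<close>

text \<open>Intervals with equal left ends are always nested; otherwise one condition remains,
  depending on which interval starts first.\<close>

fun fits :: "nat \<Rightarrow> nat \<Rightarrow> (nat \<times> nat) list \<Rightarrow> bool" where
  "fits a b [] \<longleftrightarrow> True"
| "fits a b ((c, d) # es) \<longleftrightarrow>
     (if a < c then c < b \<longrightarrow> d \<le> b else c < a \<longrightarrow> a < d \<longrightarrow> b \<le> d) \<and> fits a b es"

text \<open>First fit without backtracking: an edge goes to the lower page only if it crosses one on
  the upper page. A certificate thus gives just the order on the spine; rejection proves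
  nothing.\<close>

fun two_pages :: "(nat \<times> nat) list \<Rightarrow> (nat \<times> nat) list \<Rightarrow> (nat \<times> nat) list \<Rightarrow> bool" where
  "two_pages [] U L \<longleftrightarrow> True"
| "two_pages ((a, b) # es) U L \<longleftrightarrow>
     (if fits a b U then two_pages es ((a, b) # U) L else fits a b L \<and> two_pages es U ((a, b) # L))"

text \<open>\<open>pos ! v\<close> is the position of the vertex \<open>v\<close> on the spine, not
  the vertex at position \<open>v\<close>.\<close>

definition book_check :: "nat list \<Rightarrow> (nat \<times> nat) list \<Rightarrow> bool" where
  "book_check pos es \<longleftrightarrow> distinct pos \<and>
     two_pages (map (\<lambda>(a, b). let i = pos ! a; j = pos ! b in if i < j then (i, j) else (j, i)) es) [] []"

lemma fits_noncrossing: "fits a b es \<Longrightarrow> I \<in> set es \<Longrightarrow> noncrossing (a, b) I \<and> noncrossing I (a, b)"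
  by (induction a b es rule: fits.induct) (auto simp: noncrossing_def split: if_splits)

text \<open>Each interval is compared with all earlier ones on the page it joins, and the
  accumulators only grow, so noncrossing pages stay noncrossing up to the end of the run.\<close>

lemma two_pages_noncrossing:
  assumes "two_pages es U L" "\<And>I J. I \<in> set U \<Longrightarrow> J \<in> set U \<Longrightarrow> noncrossing I J"
    "\<And>I J. I \<in> set L \<Longrightarrow> J \<in> set L \<Longrightarrow> noncrossing I J"
  obtains U' L' where "set es \<subseteq> U' \<union> L'" "set U \<subseteq> U'" "set L \<subseteq> L'"
    "\<And>I J. I \<in> U' \<Longrightarrow> J \<in> U' \<Longrightarrow> noncrossing I J" "\<And>I J. I \<in> L' \<Longrightarrow> J \<in> L' \<Longrightarrow> noncrossing I J"
  using assms
proof (induction es U L arbitrary: thesis rule: two_pages.induct)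
  case (1 U L)
  show ?case by (rule 1(1)[of "set U" "set L"]) (use 1 in auto)
next
  case (2 a b es U L)
  have refl: "noncrossing (a, b) (a, b)" by (auto simp: noncrossing_def)
  show ?case
  proof (cases "fits a b U")
    case True
    show ?thesis
    proof (rule 2(1)[OF True])
      show "two_pages es ((a, b) # U) L" using 2(4) True by simp
      show "noncrossing I J" if "I \<in> set ((a, b) # U)" "J \<in> set ((a, b) # U)" for I J
        using that refl fits_noncrossing[OF True] 2(5) unfolding list.set insert_iff by metis
      fix U' L' assume "set es \<subseteq> U' \<union> L'" "set ((a, b) # U) \<subseteq> U'" "set L \<subseteq> L'"
        "\<And>I J. I \<in> U' \<Longrightarrow> J \<in> U' \<Longrightarrow> noncrossing I J" "\<And>I J. I \<in> L' \<Longrightarrow> J \<in> L' \<Longrightarrow> noncrossing I J"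
      then show thesis by (intro 2(3)[of U' L']) auto
    qed (use 2(6) in auto)
  next
    case False
    then have fL: "fits a b L" using 2(4) by simp
    show ?thesis
    proof (rule 2(2)[OF False])
      show "two_pages es U ((a, b) # L)" using 2(4) False by simp
      show "noncrossing I J" if "I \<in> set ((a, b) # L)" "J \<in> set ((a, b) # L)" for I J
        using that refl fits_noncrossing[OF fL] 2(6) unfolding list.set insert_iff by metis
      fix U' L' assume "set es \<subseteq> U' \<union> L'" "set U \<subseteq> U'" "set ((a, b) # L) \<subseteq> L'"
        "\<And>I J. I \<in> U' \<Longrightarrow> J \<in> U' \<Longrightarrow> noncrossing I J" "\<And>I J. I \<in> L' \<Longrightarrow> J \<in> L' \<Longrightarrow> noncrossing I J"
      then show thesis by (intro 2(3)[of U' L']) auto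
    qed (use 2(5) in auto)
  qed
qed

lemma noncrossing_of_nat:
  "noncrossing (a, b) (c, d) \<Longrightarrow> noncrossing (real a, real b) (real c, real d)"
  by (auto simp: noncrossing_def)

lemma book_check_planar:
  assumes "book_check pos es" "length pos = n" and wf: "wf_graph (Graph V (edge_sets es))" and V: "V \<subseteq> {..<n}"
  shows "planar (Graph V (edge_sets es))"
proof -
  let ?f = "\<lambda>(a, b). let i = pos ! a; j = pos ! b in if i < j then (i, j) else (j, i)"
  have dist: "distinct pos" and tp: "two_pages (map ?f es) [] []"
    using assms(1) by (auto simp: book_check_def)
  obtain U L where UL: "set (map ?f es) \<subseteq> U \<union> L"
    "\<And>I J. I \<in> U \<Longrightarrow> J \<in> U \<Longrightarrow> noncrossing I J" "\<And>I J. I \<in> L \<Longrightarrow> J \<in> L \<Longrightarrow> noncrossing I J"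
    by (rule two_pages_noncrossing[OF tp]) auto
  define q where "q = (\<lambda>v. real (pos ! v))"
  define I where "I e = (Min ((!) pos ` e), Max ((!) pos ` e))" for e
  have IUL: "I e \<in> U \<union> L" if e: "e \<in> edge_sets es" for e
  proof -
    obtain a b where ab: "(a, b) \<in> set es" "e = {a, b}" using e by (rule edge_setsE)
    have "I e = ?f (a, b)" by (auto simp: I_def ab(2) Let_def min_def max_def)
    moreover have "?f (a, b) \<in> set (map ?f es)" using ab(1) by (simp only: set_map image_eqI)
    ultimately show ?thesis using UL(1) by (simp only: subsetD)
  qed
  have fin: "finite e \<and> e \<noteq> {}" if "e \<in> edge_sets es" for e using that by (rule edge_setsE) simp
  have mm: "Min (q ` e) = real (fst (I e)) \<and> Max (q ` e) = real (snd (I e))" if "e \<in> edge_sets es" for e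
  proof -
    have "q ` e = real ` ((!) pos ` e)" by (simp add: q_def image_image)
    then show ?thesis using fin[OF that]
      by (simp add: I_def mono_Min_commute[of real, symmetric] mono_Max_commute[of real, symmetric] mono_def)
  qed
  show ?thesis
  \<comment> \<open>\<open>U\<close> and \<open>L\<close> may overlap. An interval outside
    \<open>U\<close> lies in \<open>L\<close>, so membership in \<open>U\<close> alone can serve as
    the page.\<close>
  proof (rule book_embedding_planar[where q = q and upper = "\<lambda>e. I e \<in> U"])
    show "inj_on q (verts (Graph V (edge_sets es)))"
      using dist assms(2) V by (auto simp: inj_on_def q_def nth_eq_iff_index_eq subset_iff)
    fix e e' assume "e \<in> edges (Graph V (edge_sets es))" "e' \<in> edges (Graph V (edge_sets es))"
      "(I e \<in> U) = (I e' \<in> U)"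
    then have e: "e \<in> edge_sets es" "e' \<in> edge_sets es" "(I e \<in> U) = (I e' \<in> U)" by auto
    then have "noncrossing (I e) (I e')" using UL(2,3) IUL by (metis UnE)
    then show "noncrossing (Min (q ` e), Max (q ` e)) (Min (q ` e'), Max (q ` e'))"
      using mm e noncrossing_of_nat by (metis prod.collapse)
  qed (rule wf)
qed

section \<open>Soundness of the combined check\<close>

text \<open>\<open>pos\<close> also gives positions to the deleted apex and to a vertex lost by
  contraction, so vertices never have to be renumbered.\<close>

definition apex_check :: "nat \<Rightarrow> (nat \<times> nat) list \<Rightarrow> nat \<times> nat list \<Rightarrow> bool" where
  "apex_check n es = (\<lambda>(w, pos). w < n \<and> length pos = n \<and> book_check pos (del_list w es))"

text \<open>In \<open>MMNA_check\<close>, \<open>ks\<close> gives a Kuratowski minor of \<open>G - w\<close> for each vertex \<open>w\<close>, and \<open>ds\<close>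
  (\<open>cs\<close>) gives, for each edge, an apex of the graph after deleting (contracting) it together with
  the spine positions of a two-page book embedding.\<close>

definition MMNA_check :: "nat \<Rightarrow> (nat \<times> nat) list \<Rightarrow> ((nat \<times> nat) list \<times> nat list) list \<Rightarrow>
    (nat \<times> nat list) list \<Rightarrow> (nat \<times> nat list) list \<Rightarrow> bool" where
  "MMNA_check n es ks ds cs \<longleftrightarrow> n > 0 \<and> list_all (\<lambda>(a, b). a < b \<and> b < n) es \<and>
     list_all (\<lambda>x. list_ex (\<lambda>(a, b). a = x \<or> b = x) es) [0..<n] \<and>
     list_all2 (\<lambda>w. kuratowski_minor (del_list w es)) [0..<n] ks \<and>
     list_all2 (\<lambda>e. apex_check n (removeAll e es)) es ds \<and>
     list_all2 (\<lambda>(a, b) c. fst c \<noteq> b \<and> apex_check n (contract_list a b es) c) es cs"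

lemma list_all2_witness: "list_all2 P xs ys \<Longrightarrow> x \<in> set xs \<Longrightarrow> \<exists>y. P x y"
  by (auto simp: list_all2_conv_all_nth in_set_conv_nth)

lemma wf_edge_sets: "(\<And>a b. (a, b) \<in> set es \<Longrightarrow> a \<in> V \<and> b \<in> V \<and> a \<noteq> b) \<Longrightarrow> wf_graph (Graph V (edge_sets es))"
  by (force simp: wf_graph_def edge_sets_iff)

lemma apex_check_apex:
  assumes "apex_check n es (w, pos)" "wf_graph (Graph V (edge_sets es))" "V \<subseteq> {..<n}" "w \<in> V"
  shows "apex (Graph V (edge_sets es))"
proof -
  have "wf_graph (Graph (V - {w}) (edge_sets (del_list w es)))"
    using wf_delete_vertex[OF assms(2), of w] by (simp add: delete_vertex_list)
  then have "planar (Graph (V - {w}) (edge_sets (del_list w es)))"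
    using assms by (intro book_check_planar[where pos = pos and n = n]) (auto simp: apex_check_def)
  then show ?thesis unfolding apex_def using assms(4) by (auto simp: delete_vertex_list)
qed

lemma MMNA_check_MMNA:
  assumes "MMNA_check n es ks ds cs"
  shows "MMNA (list_graph n es)"
proof (rule MMNA_I)
  have ok: "a < b \<and> b < n" if "(a, b) \<in> set es" for a b
    using assms that by (auto simp: MMNA_check_def list_all_iff)
  have wf: "wf_graph (Graph {..<n} (edge_sets es))" by (rule wf_edge_sets) (use ok in fastforce)
  have nl: "no_loops es" using ok by (auto simp: no_loops_def)
  show "NA (list_graph n es)"
    unfolding NA_def
  proof (intro conjI ballI)
    show "simple_graph (list_graph n es)"
      using wf assms by (auto simp: simple_graph_def wf_graph_def list_graph_def MMNA_check_def)
    fix w assume w: "w \<in> verts (list_graph n es)"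
    have "list_all2 (\<lambda>w. kuratowski_minor (del_list w es)) [0..<n] ks"
      using assms by (simp add: MMNA_check_def)
    from list_all2_witness[OF this, of w] w obtain k where "kuratowski_minor (del_list w es) k"
      by (force simp: list_graph_def)
    moreover have "no_loops (del_list w es)" using nl by (auto simp: no_loops_def del_list_def)
    ultimately show "\<not> planar (delete_vertex (list_graph n es) w)"
      using kuratowski_minor_nonplanar wf_delete_vertex[OF wf, of w]
      by (simp add: list_graph_def delete_vertex_list)
  qed
  show "\<exists>e\<in>edges (list_graph n es). x \<in> e" if "x \<in> verts (list_graph n es)" for x
  proof -
    have "list_ex (\<lambda>(a, b). a = x \<or> b = x) es"
      using assms that by (auto simp: MMNA_check_def list_graph_def list_all_iff)
    then show ?thesis by (auto simp: list_ex_iff list_graph_def edge_sets_def)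
  qed
  fix e assume "e \<in> edges (list_graph n es)"
  then obtain a b where ab: "(a, b) \<in> set es" "e = {a, b}" by (auto simp: list_graph_def edge_sets_iff)
  have abn: "a < b" "b < n" using ok[OF ab(1)] by auto
  \<comment> \<open>All pairs are increasing, so the edge cannot occur a second time as
    \<open>(b, a)\<close>, and removing the pair removes the edge.\<close>
  have eq: "edge_sets es - {e} = edge_sets (removeAll (a, b) es)"
  proof (intro equalityI subsetI)
    fix f assume "f \<in> edge_sets es - {e}"
    then obtain c d where "(c, d) \<in> set es" "f = {c, d}" "(c, d) \<noteq> (a, b)"
      using ab by (blast elim: edge_setsE)
    then show "f \<in> edge_sets (removeAll (a, b) es)" by (auto intro: edge_setsI)
  next
    fix f assume "f \<in> edge_sets (removeAll (a, b) es)"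
    then obtain c d where cd: "(c, d) \<in> set es" "f = {c, d}" "(c, d) \<noteq> (a, b)"
      by (auto elim!: edge_setsE)
    then have "f \<noteq> e" using ok[OF cd(1)] abn ab(2) by (auto simp: doubleton_eq_iff)
    then show "f \<in> edge_sets es - {e}" using cd edge_setsI[of c d es] by simp
  qed
  have "list_all2 (\<lambda>e. apex_check n (removeAll e es)) es ds"
    using assms by (simp add: MMNA_check_def)
  from list_all2_witness[OF this ab(1)] obtain w pos where d: "apex_check n (removeAll (a, b) es) (w, pos)"
    by force
  have "apex (Graph {..<n} (edge_sets (removeAll (a, b) es)))"
  proof (rule apex_check_apex[OF d])
    show "wf_graph (Graph {..<n} (edge_sets (removeAll (a, b) es)))"
      using wf by (simp add: wf_graph_def eq[symmetric])
  qed (use d in \<open>auto simp: apex_check_def\<close>)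
  then show "apex (Graph (verts (list_graph n es)) (edges (list_graph n es) - {e}))"
    by (simp add: list_graph_def eq)
  have "list_all2 (\<lambda>(a, b) c. fst c \<noteq> b \<and> apex_check n (contract_list a b es) c) es cs"
    using assms by (simp add: MMNA_check_def)
  from list_all2_witness[OF this ab(1)]
  obtain w' pos' where c: "w' \<noteq> b" "apex_check n (contract_list a b es) (w', pos')" by force
  have con: "contract_edge a b (list_graph n es) = Graph ({..<n} - {b}) (edge_sets (contract_list a b es))"
    unfolding list_graph_def by (rule contract_edge_list[OF nl]) (use abn in simp)
  have "wf_graph (contract_edge a b (list_graph n es))"
    using wf_contract_edge[OF wf, of a b] edge_setsI[OF ab(1)] abn by (simp add: list_graph_def)
  then have "apex (contract_edge a b (list_graph n es))"
    unfolding con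
  proof (rule apex_check_apex[OF c(2)])
    \<comment> \<open>The vertex \<open>b\<close> vanishes in the contraction and could not serve as
      apex; this is why the check demands \<open>fst c \<noteq> b\<close>.\<close>
    show "w' \<in> {..<n} - {b}" using c by (simp add: apex_check_def)
  qed auto
  then show "\<exists>u v. e = {u, v} \<and> u \<noteq> v \<and> apex (contract_edge u v (list_graph n es))"
    using ab(2) abn by blast
qed

text \<open>The conclusion keeps the graph as a named constant, and the hypothesis becomes a closed
  boolean term that \<open>code_simp\<close> evaluates by rewriting inside the logic.\<close>

lemma MMNA_certified:
  assumes "case_prod MMNA_check X ks ds cs"
  shows "MMNA (case_prod list_graph X)"
  using assms MMNA_check_MMNA by (cases X) auto

section \<open>Computable degree sequences\<close>

definition degree_list :: "nat \<Rightarrow> (nat \<times> nat) list \<Rightarrow> nat list" where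
  "degree_list n es = sort (map (\<lambda>v. length (filter (\<lambda>(a, b). a = v \<or> b = v) es)) [0..<n])"

text \<open>In a repetition-free list of increasing pairs different entries are different edges, so
  counting entries counts edges.\<close>

lemma degrees_list_graph:
  assumes "distinct es" "\<forall>(a, b)\<in>set es. a < b"
  shows "degrees (list_graph n es) = mset (degree_list n es)"
proof -
  have "card {e \<in> edge_sets es. v \<in> e} = length (filter (\<lambda>(a, b). a = v \<or> b = v) es)" for v
  proof -
    have "{e \<in> edge_sets es. v \<in> e} = (\<lambda>(a, b). {a, b}) ` set (filter (\<lambda>(a, b). a = v \<or> b = v) es)"
      by (auto simp: edge_sets_def)
    moreover have "inj_on (\<lambda>(a, b). {a, b}) (set (filter (\<lambda>(a, b). a = v \<or> b = v) es))"
    proof (rule inj_onI)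
      fix x y assume "x \<in> set (filter (\<lambda>(a, b). a = v \<or> b = v) es)"
        "y \<in> set (filter (\<lambda>(a, b). a = v \<or> b = v) es)"
        and eq: "(case x of (a, b) \<Rightarrow> {a, b}) = (case y of (a, b) \<Rightarrow> {a, b})"
      then have "fst x < snd x" "fst y < snd y" using assms(2) by auto
      then show "x = y" using eq by (auto simp: doubleton_eq_iff case_prod_beta prod_eq_iff)
    qed
    ultimately have "card {e \<in> edge_sets es. v \<in> e} = card (set (filter (\<lambda>(a, b). a = v \<or> b = v) es))"
      by (simp only: card_image)
    then show ?thesis using assms(1) by (simp only: distinct_card distinct_filter)
  qed
  then show ?thesis
    unfolding degrees_def list_graph_def degree_list_def graph.sel mset_sort mset_map mset_upt lessThan_atLeast0
    by (rule image_mset_cong)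
qed

subsection \<open>The graphs\<close>

text \<open>The graphs and their certificates were found by computer search; there are more MMNA graphs, and
  these were picked to have pairwise different degree sequences.\<close>

definition graph_1 :: "nat \<times> (nat \<times> nat) list" where
  "graph_1 = (6,
    [(0,1), (0,2), (0,3), (0,4), (0,5), (1,2), (1,3), (1,4), (1,5), (2,3), (2,4), (2,5), (3,4),
     (3,5), (4,5)])"

lemma MMNA_graph_1: "MMNA (case_prod list_graph graph_1)"
  by (rule MMNA_certified[of graph_1
    "[([],[1,2,3,4,5]), ([],[0,2,3,4,5]), ([],[0,1,3,4,5]), ([],[0,1,2,4,5]), ([],[0,1,2,3,5]),
     ([],[0,1,2,3,4])]"
    "[(2,[4,2,1,0,5,3]), (1,[1,0,3,4,5,2]), (1,[1,0,2,4,5,3]), (1,[1,0,2,4,3,5]), (1,[1,0,4,5,2,3]),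
     (0,[4,5,1,2,0,3]), (0,[4,1,2,5,0,3]), (0,[2,5,0,1,3,4]), (0,[5,2,1,0,3,4]), (0,[2,5,1,4,3,0]),
     (0,[1,3,2,0,5,4]), (0,[5,3,4,2,0,1]), (0,[0,4,1,5,2,3]), (0,[1,5,4,0,2,3]), (0,[0,3,4,1,5,2])]"
    "[(0,[1,4,2,5,0,3]), (0,[1,0,5,2,3,4]), (0,[4,1,0,3,5,2]), (0,[5,1,4,3,2,0]), (0,[0,1,4,5,2,3]),
     (0,[4,1,0,3,5,2]), (0,[1,2,5,0,4,3]), (0,[1,3,5,2,0,4]), (0,[3,1,0,2,4,5]), (0,[4,0,1,3,5,2]),
     (0,[3,0,5,4,2,1]), (0,[5,1,4,2,3,0]), (0,[3,1,2,4,5,0]), (0,[1,3,5,4,2,0]), (0,[0,2,5,4,1,3])]"]) code_simp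

text \<open>The complete tripartite graph K133, with 6 as the vertex adjacent to all others.\<close>

definition graph_2 :: "nat \<times> (nat \<times> nat) list" where
  "graph_2 = (7,
    [(0,1), (0,2), (0,3), (0,6), (1,4), (1,5), (1,6), (2,4), (2,5), (2,6), (3,4), (3,5), (3,6),
     (4,6), (5,6)])"

lemma MMNA_graph_2: "MMNA (case_prod list_graph graph_2)"
  by (rule MMNA_certified[of graph_2
    "[([],[1,2,3,4,5,6]), ([],[0,4,5,2,3,6]), ([],[0,4,5,1,3,6]), ([],[0,4,5,1,2,6]),
     ([],[0,5,6,1,2,3]), ([],[0,4,6,1,2,3]), ([],[0,4,5,1,2,3])]"
    "[(2,[5,0,1,4,3,2,6]), (1,[3,6,0,4,2,1,5]), (1,[5,3,2,0,1,6,4]), (1,[6,4,0,3,5,2,1]),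
     (0,[4,5,0,3,2,1,6]), (0,[2,3,6,4,5,0,1]), (0,[3,6,4,0,5,1,2]), (0,[4,3,2,6,0,5,1]),
     (0,[2,5,0,6,1,4,3]), (0,[6,3,4,1,2,5,0]), (0,[6,0,5,3,1,4,2]), (0,[0,3,6,4,2,1,5]),
     (0,[2,6,4,5,3,0,1]), (1,[4,2,6,3,5,0,1]), (1,[4,3,2,5,0,1,6])]"
    "[(0,[5,0,3,2,4,1,6]), (0,[4,2,3,5,1,6,0]), (0,[5,6,1,3,2,0,4]), (0,[5,6,1,3,2,4,0]),
     (0,[2,3,4,6,1,5,0]), (0,[1,6,0,3,2,5,4]), (0,[3,1,0,5,6,4,2]), (0,[3,2,4,5,0,1,6]),
     (0,[3,0,5,4,6,2,1]), (0,[6,5,2,3,0,4,1]), (0,[1,4,2,6,0,5,3]), (0,[2,6,3,0,4,5,1]),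
     (0,[6,3,1,4,2,0,5]), (0,[6,0,5,4,1,3,2]), (0,[3,2,1,0,6,5,4])]"]) code_simp

text \<open>K6 with a triangle on 1, 2, 3 replaced by a claw centred at 0.\<close>

definition graph_3 :: "nat \<times> (nat \<times> nat) list" where
  "graph_3 = (7,
    [(0,1), (0,2), (0,3), (1,4), (1,5), (1,6), (2,4), (2,5), (2,6), (3,4), (3,5), (3,6), (4,5),
     (4,6), (5,6)])"

lemma MMNA_graph_3: "MMNA (case_prod list_graph graph_3)"
  by (rule MMNA_certified[of graph_3
    "[([],[1,2,3,4,5,6]), ([(0,3)],[0,2,4,5,6]), ([(0,3)],[0,1,4,5,6]), ([(0,1)],[0,2,4,5,6]),
     ([],[0,5,6,1,2,3]), ([],[0,4,6,1,2,3]), ([],[0,4,5,1,2,3])]"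
    "[(2,[0,3,1,6,2,5,4]), (1,[4,1,2,6,5,3,0]), (1,[1,3,2,6,5,4,0]), (0,[0,6,5,3,4,1,2]),
     (0,[3,6,4,0,5,2,1]), (0,[2,0,3,6,1,5,4]), (0,[3,2,6,0,1,4,5]), (0,[1,5,2,0,4,6,3]),
     (0,[6,2,4,5,1,3,0]), (0,[1,3,5,2,6,4,0]), (0,[6,3,1,0,5,2,4]), (0,[2,1,4,5,6,0,3]),
     (1,[3,0,4,2,5,1,6]), (1,[0,6,1,3,5,4,2]), (1,[4,1,2,3,6,0,5])]"
    "[(0,[0,1,5,3,6,4,2]), (0,[1,6,4,3,5,2,0]), (0,[2,5,0,3,1,6,4]), (0,[5,3,6,2,0,4,1]),
     (0,[4,2,1,6,3,5,0]), (0,[3,6,1,4,0,2,5]), (0,[4,6,5,2,1,0,3]), (0,[6,1,3,4,2,0,5]),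
     (0,[5,0,1,2,4,3,6]), (0,[5,2,6,4,0,1,3]), (0,[2,1,6,3,0,4,5]), (0,[2,5,0,3,6,1,4]),
     (0,[5,6,2,3,0,4,1]), (0,[0,1,4,2,5,3,6]), (0,[6,2,5,1,4,0,3])]"]) code_simp

text \<open>K133 with apex vertex 7, in which the triangle 1, 2, 7 is replaced by a claw centred at
  0.\<close>

definition graph_4 :: "nat \<times> (nat \<times> nat) list" where
  "graph_4 = (8,
    [(0,1), (0,2), (0,7), (1,3), (1,4), (2,5), (2,6), (3,5), (3,6), (3,7), (4,5), (4,6), (4,7),
     (5,7), (6,7)])"

lemma MMNA_graph_4: "MMNA (case_prod list_graph graph_4)"
  by (rule MMNA_certified[of graph_4
    "[([(2,5), (1,4)],[1,2,3,6,7]), ([(0,2)],[0,3,4,5,6,7]), ([(0,1)],[0,5,6,3,4,7]),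
     ([(1,4)],[0,5,6,1,2,7]), ([(0,1)],[0,5,6,2,3,7]), ([(2,6)],[0,3,4,1,2,7]),
     ([(2,5)],[0,3,4,1,2,7]), ([(0,2)],[0,3,4,1,5,6])]"
    "[(2,[0,5,4,2,6,3,7,1]), (1,[7,6,2,1,5,4,3,0]), (1,[0,6,5,1,4,7,2,3]), (0,[4,0,1,2,6,3,7,5]),
     (0,[5,1,7,2,6,3,0,4]), (0,[1,5,3,6,0,7,4,2]), (0,[4,3,7,1,5,6,2,0]), (0,[6,7,3,5,0,2,4,1]),
     (0,[4,6,0,3,7,5,1,2]), (0,[5,0,4,1,2,6,7,3]), (0,[2,7,4,5,6,1,3,0]), (0,[1,0,4,2,7,6,3,5]),
     (0,[1,2,4,0,5,6,3,7]), (0,[6,4,2,3,7,0,1,5]), (0,[2,1,5,3,7,4,6,0])]"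
    "[(0,[2,5,1,3,7,6,0,4]), (0,[4,0,7,1,6,2,5,3]), (0,[3,4,1,0,6,7,2,5]), (1,[5,4,0,7,2,1,3,6]),
     (1,[2,7,5,6,4,0,3,1]), (1,[3,0,7,4,1,6,5,2]), (1,[1,0,6,4,2,3,5,7]), (0,[3,7,1,4,0,2,5,6]),
     (0,[2,1,0,5,4,7,3,6]), (0,[0,5,2,6,7,4,1,3]), (0,[6,0,2,5,7,1,3,4]), (0,[1,0,7,4,2,6,3,5]),
     (0,[1,0,5,7,6,4,3,2]), (0,[1,0,3,2,6,5,7,4]), (0,[4,7,2,5,1,3,6,0])]"]) code_simp

text \<open>K44 with sides {0,5,6,7} and {1,2,3,4}, without the edge from 0 to 1.\<close>

definition graph_5 :: "nat \<times> (nat \<times> nat) list" where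
  "graph_5 = (8,
    [(0,2), (0,3), (0,4), (1,5), (1,6), (1,7), (2,5), (2,6), (2,7), (3,5), (3,6), (3,7), (4,5),
     (4,6), (4,7)])"

lemma MMNA_graph_5: "MMNA (case_prod list_graph graph_5)"
  by (rule MMNA_certified[of graph_5
    "[([],[1,3,4,5,6,7]), ([],[0,5,7,2,3,4]), ([],[1,3,4,5,6,7]), ([],[1,2,4,5,6,7]),
     ([],[1,2,3,5,6,7]), ([],[0,6,7,2,3,4]), ([],[0,5,7,2,3,4]), ([],[0,5,6,2,3,4])]"
    "[(5,[4,0,6,2,3,7,5,1]), (5,[3,5,0,7,4,1,2,6]), (5,[5,2,0,4,1,7,6,3]), (2,[2,6,0,5,3,1,4,7]),
     (2,[6,3,7,1,5,2,0,4]), (2,[5,1,6,3,4,0,2,7]), (3,[3,1,0,6,4,5,2,7]), (3,[5,1,4,2,0,6,7,3]),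
     (3,[5,1,4,0,3,6,7,2]), (2,[5,3,7,4,6,1,2,0]), (2,[2,0,7,3,4,1,5,6]), (2,[0,5,2,3,7,4,1,6]),
     (2,[7,4,3,1,6,2,5,0]), (2,[6,2,5,7,3,4,1,0]), (2,[6,1,0,5,4,7,3,2])]"
    "[(5,[6,3,0,2,7,5,1,4]), (5,[7,2,1,0,5,4,3,6]), (5,[5,1,0,3,4,6,7,2]), (2,[4,0,6,1,3,7,5,2]),
     (2,[7,3,5,2,0,1,6,4]), (2,[3,0,5,1,4,7,2,6]), (2,[1,6,2,0,7,3,4,5]), (2,[3,7,6,2,5,4,0,1]),
     (2,[1,6,5,2,0,4,3,7]), (2,[3,5,6,0,2,7,4,1]), (2,[2,7,3,6,4,0,1,5]), (2,[5,2,3,4,7,6,0,1]),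
     (2,[3,5,1,0,4,6,7,2]), (2,[7,5,4,1,0,6,2,3]), (2,[1,6,2,4,3,7,5,0])]"]) code_simp

text \<open>The Petersen graph with one vertex replaced by the triangle 6, 7, 8 on its
  neighbours.\<close>

definition graph_6 :: "nat \<times> (nat \<times> nat) list" where
  "graph_6 = (9,
    [(0,1), (0,2), (0,6), (1,3), (1,7), (2,4), (2,8), (3,5), (3,8), (4,5), (4,7), (5,6), (6,7),
     (6,8), (7,8)])"

lemma MMNA_graph_6: "MMNA (case_prod list_graph graph_6)"
  by (rule MMNA_certified[of graph_6
    "[([(2,4), (1,3)],[1,2,6,5,7,8]), ([(3,5), (0,2)],[0,3,7,4,6,8]), ([(0,1),
     (4,7)],[0,5,8,3,4,6]), ([(4,5), (1,7)],[0,4,8,1,2,6]), ([(3,5), (0,2)],[0,3,7,1,6,8]), ([(4,7),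
     (3,8)],[0,3,4,1,2,6]), ([(0,2), (4,5)],[0,3,7,1,4,8]), ([(1,3), (2,4)],[0,5,8,1,2,6]), ([(3,5),
     (0,2)],[0,3,7,1,4,6])]"
    "[(2,[3,8,6,0,5,7,4,1,2]), (1,[3,4,7,8,6,0,1,5,2]), (1,[6,7,8,2,0,5,3,4,1]),
     (0,[4,6,8,3,7,5,2,1,0]), (0,[6,8,1,0,5,2,3,4,7]), (0,[1,4,8,2,6,3,7,5,0]),
     (0,[3,1,5,4,6,7,8,2,0]), (0,[5,0,3,8,2,4,7,1,6]), (0,[2,8,6,0,5,7,3,1,4]),
     (0,[6,1,5,2,7,0,4,3,8]), (0,[0,1,4,5,3,2,7,8,6]), (0,[6,4,8,5,1,2,0,3,7]),
     (0,[4,8,1,5,3,6,2,0,7]), (0,[6,0,4,1,5,7,8,3,2]), (1,[0,2,8,7,3,6,4,1,5])]"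
    "[(0,[1,2,4,8,5,6,7,3,0]), (0,[5,2,8,3,1,4,0,7,6]), (0,[5,4,2,3,7,0,1,8,6]),
     (1,[7,6,0,8,5,4,3,1,2]), (1,[1,6,2,5,7,4,3,8,0]), (1,[7,6,2,0,5,1,8,4,3]),
     (1,[4,8,5,7,2,0,1,3,6]), (0,[6,4,7,8,5,2,1,3,0]), (0,[4,8,0,7,3,2,6,5,1]),
     (0,[7,5,1,0,4,2,3,6,8]), (0,[0,4,1,5,3,7,8,2,6]), (0,[4,8,2,7,5,6,0,3,1]),
     (0,[7,0,5,2,4,3,1,6,8]), (0,[5,6,0,2,8,1,7,4,3]), (0,[0,5,2,6,1,7,3,8,4])]"]) code_simp

text \<open>The Petersen graph: removing 0 and its neighbours 1, 2, 3 leaves a hexagon whose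
  opposite vertices share one of these neighbours.\<close>

definition graph_7 :: "nat \<times> (nat \<times> nat) list" where
  "graph_7 = (10,
    [(0,1), (0,2), (0,3), (1,4), (1,5), (2,6), (2,7), (3,8), (3,9), (4,6), (4,8), (5,7), (5,9),
     (6,9), (7,8)])"

lemma MMNA_graph_7: "MMNA (case_prod list_graph graph_7)"
  by (rule MMNA_certified[of graph_7
    "[([(2,6), (3,9), (1,5)],[1,2,8,3,4,7]), ([(5,7), (4,8), (0,2)],[0,4,9,3,5,6]), ([(6,9), (5,7),
     (0,3)],[0,4,5,1,6,8]), ([(0,1), (7,8), (6,9)],[0,6,7,2,4,5]), ([(7,8), (2,6),
     (0,1)],[0,7,9,2,3,5]), ([(7,8), (1,4), (3,9)],[0,6,7,1,2,3]), ([(3,9), (0,2),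
     (4,8)],[0,4,5,1,3,7]), ([(3,8), (1,5), (2,6)],[0,4,9,1,2,3]), ([(1,4), (2,7),
     (0,3)],[0,5,6,1,2,9]), ([(2,6), (3,8), (1,5)],[0,4,7,1,2,3])]"
    "[(2,[6,9,7,2,8,3,0,4,5,1]), (1,[0,3,5,1,9,6,2,8,7,4]), (1,[2,6,8,0,5,9,7,1,3,4]),
     (0,[9,1,8,2,4,0,7,3,5,6]), (0,[9,1,7,4,3,8,2,5,6,0]), (0,[1,2,4,7,3,9,0,8,5,6]),
     (0,[0,5,8,2,7,6,1,3,9,4]), (0,[8,6,0,2,5,7,4,1,9,3]), (0,[4,0,6,3,9,8,5,1,2,7]),
     (0,[6,4,8,0,3,5,9,2,1,7]), (0,[1,2,5,7,4,0,3,9,6,8]), (0,[6,8,3,9,4,0,1,5,7,2]),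
     (0,[3,7,6,0,5,8,4,2,9,1]), (0,[5,0,2,8,1,7,6,4,3,9]), (0,[8,5,3,1,7,4,0,9,6,2])]"
    "[(0,[6,5,2,9,1,4,3,7,8,0]), (0,[1,0,9,6,2,3,7,4,5,8]), (0,[3,9,5,4,8,1,7,6,2,0]),
     (1,[0,8,3,9,7,4,1,5,6,2]), (1,[8,2,1,0,6,9,7,3,4,5]), (1,[1,6,3,4,5,9,2,8,7,0]),
     (1,[6,9,3,5,0,4,1,2,7,8]), (1,[7,3,9,6,4,0,2,8,5,1]), (1,[8,7,1,4,2,6,3,9,0,5]),
     (0,[7,6,0,2,1,5,8,9,3,4]), (0,[0,3,5,2,9,7,1,8,6,4]), (0,[1,3,4,6,2,5,8,9,0,7]),
     (0,[0,6,3,8,4,7,5,2,1,9]), (0,[2,7,1,0,9,8,3,4,5,6]), (0,[0,9,6,3,7,1,8,4,2,5])]"]) code_simp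

definition graph_8 :: "nat \<times> (nat \<times> nat) list" where
  "graph_8 = (9,
    [(0,1), (0,2), (0,3), (0,4), (1,2), (1,5), (1,7), (2,6), (2,8), (3,5), (3,6), (3,7), (4,5),
     (4,6), (4,8), (5,8), (6,7), (7,8)])"

lemma MMNA_graph_8: "MMNA (case_prod list_graph graph_8)"
  by (rule MMNA_certified[of graph_8
    "[([(4,6)],[1,4,8,2,5,7]), ([(3,7)],[0,6,8,2,3,4]), ([(0,4)],[0,5,7,1,3,8]),
     ([(4,6)],[1,4,8,2,5,7]), ([(0,2)],[0,5,7,1,3,8]), ([(0,1)],[0,6,8,2,4,7]),
     ([(2,8)],[0,5,7,1,2,3]), ([(3,5)],[0,6,8,2,3,4]), ([(1,2)],[0,5,6,1,3,4])]"
    "[(2,[6,2,0,5,4,3,7,1,8]), (1,[0,2,4,8,7,6,1,3,5]), (1,[2,5,1,4,3,7,0,6,8]),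
     (2,[6,2,3,5,0,4,8,7,1]), (0,[4,8,2,5,1,0,3,6,7]), (0,[7,2,3,0,5,6,1,8,4]),
     (2,[8,6,4,5,0,7,1,2,3]), (0,[5,7,8,1,3,6,2,0,4]), (1,[7,1,0,2,8,6,3,5,4]),
     (2,[8,0,2,1,4,7,3,6,5]), (7,[8,0,3,7,5,6,4,1,2]), (6,[2,1,8,3,4,5,6,0,7]),
     (8,[2,1,8,3,7,4,6,5,0]), (1,[1,4,0,2,8,7,3,5,6]), (5,[0,6,5,8,1,7,2,4,3]),
     (4,[8,3,1,4,0,5,7,6,2]), (3,[3,7,6,2,4,1,5,8,0]), (0,[1,6,0,4,3,2,7,5,8])]"
    "[(0,[7,5,2,4,8,6,3,1,0]), (0,[1,4,6,0,7,3,8,2,5]), (2,[3,2,0,7,5,4,8,1,6]),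
     (1,[8,4,3,1,5,0,2,6,7]), (1,[3,4,6,5,7,8,2,0,1]), (2,[8,2,1,3,7,0,6,4,5]),
     (0,[2,8,7,0,6,3,1,5,4]), (1,[6,7,1,5,8,3,4,2,0]), (0,[0,2,1,5,8,3,7,6,4]),
     (6,[3,1,0,2,5,8,4,7,6]), (1,[6,3,8,5,2,4,7,0,1]), (2,[1,0,6,8,4,3,5,2,7]),
     (2,[3,4,2,0,5,6,8,1,7]), (5,[0,5,1,6,8,7,3,4,2]), (1,[1,2,8,3,6,5,7,4,0]),
     (0,[0,6,5,2,3,1,7,8,4]), (0,[4,6,2,7,8,1,5,3,0]), (3,[3,0,2,6,7,8,4,5,1])]"]) code_simp

definition graph_9 :: "nat \<times> (nat \<times> nat) list" where
  "graph_9 = (10,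
    [(0,4), (0,5), (0,6), (1,4), (1,5), (1,6), (2,4), (2,7), (2,8), (3,5), (3,7), (3,8), (4,9),
     (5,9), (6,7), (6,8), (7,9), (8,9)])"

lemma MMNA_graph_9: "MMNA (case_prod list_graph graph_9)"
  by (rule MMNA_certified[of graph_9
    "[([(1,4)],[1,7,8,2,6,9]), ([(0,6)],[0,2,9,4,7,8]), ([(1,5)],[1,7,8,3,6,9]),
     ([(0,4)],[0,7,8,2,6,9]), ([(1,5)],[1,7,8,3,6,9]), ([(0,6)],[0,2,9,4,7,8]), ([(1,5),
     (2,4)],[1,7,8,2,3,9]), ([(6,8)],[0,1,9,4,5,6]), ([(6,7)],[0,1,9,4,5,6]), ([(2,4),
     (1,5)],[1,7,8,2,3,6])]"
    "[(7,[7,1,4,8,3,9,6,0,5,2]), (7,[8,5,9,4,7,6,1,0,2,3]), (7,[0,8,5,3,6,9,7,1,4,2]),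
     (7,[9,7,3,6,2,5,8,0,1,4]), (7,[6,4,1,8,2,9,3,7,5,0]), (7,[7,8,0,3,1,6,4,5,2,9]),
     (5,[4,6,9,0,3,2,5,8,7,1]), (5,[8,5,7,1,6,3,2,0,9,4]), (5,[1,3,0,7,4,6,2,9,8,5]),
     (4,[3,0,8,7,2,5,1,9,4,6]), (4,[5,2,9,4,8,6,3,1,0,7]), (4,[0,4,7,1,5,3,9,2,8,6]),
     (5,[7,2,6,0,4,5,3,1,8,9]), (4,[8,6,3,1,4,0,7,9,5,2]), (4,[2,8,5,4,3,1,7,0,6,9]),
     (4,[6,9,4,5,7,0,8,3,2,1]), (4,[4,0,6,1,9,2,5,8,7,3]), (4,[8,9,3,1,4,7,6,5,2,0])]"
    "[(7,[9,6,1,5,7,4,8,2,0,3]), (7,[4,3,1,7,9,2,6,5,0,8]), (7,[8,6,1,4,7,5,3,9,0,2]),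
     (7,[6,3,1,8,0,5,7,2,9,4]), (7,[5,6,1,8,4,7,0,2,9,3]), (7,[1,9,6,4,0,2,7,8,3,5]),
     (5,[5,4,6,1,9,8,2,3,0,7]), (5,[0,8,6,5,9,3,4,7,2,1]), (5,[6,7,2,0,4,5,3,8,1,9]),
     (4,[5,3,1,6,4,8,0,2,9,7]), (4,[0,2,7,9,8,4,1,6,3,5]), (4,[1,4,9,8,5,3,6,7,2,0]),
     (3,[2,5,7,8,3,4,9,1,6,0]), (2,[6,8,5,3,0,1,7,2,4,9]), (4,[2,9,4,7,0,1,8,5,6,3]),
     (4,[5,6,0,2,1,3,4,9,8,7]), (4,[8,0,3,6,4,7,2,5,1,9]), (4,[5,6,1,2,8,7,4,0,9,3])]"]) code_simp

text \<open>Two disjoint copies of K33. A disjoint union of two nonplanar graphs is NA, since one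
  vertex cannot destroy both.\<close>

definition graph_10 :: "nat \<times> (nat \<times> nat) list" where
  "graph_10 = (12,
    [(0,1), (0,2), (0,3), (1,4), (1,5), (2,4), (2,5), (3,4), (3,5), (6,7), (6,8), (6,9), (7,10),
     (7,11), (8,10), (8,11), (9,10), (9,11)])"

lemma MMNA_graph_10: "MMNA (case_prod list_graph graph_10)"
  by (rule MMNA_certified[of graph_10
    "[([],[6,10,11,7,8,9]), ([],[6,10,11,7,8,9]), ([],[6,10,11,7,8,9]), ([],[6,10,11,7,8,9]),
     ([],[6,10,11,7,8,9]), ([],[6,10,11,7,8,9]), ([],[0,4,5,1,2,3]), ([],[0,4,5,1,2,3]),
     ([],[0,4,5,1,2,3]), ([],[0,4,5,1,2,3]), ([],[0,4,5,1,2,3]), ([],[0,4,5,1,2,3])]"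
    "[(6,[10,7,4,3,8,6,5,1,2,9,0,11]), (6,[4,3,6,5,1,2,9,11,8,7,0,10]),
     (6,[7,5,0,9,8,10,6,2,1,3,11,4]), (6,[1,9,10,0,11,8,6,4,3,7,2,5]),
     (6,[5,4,0,11,2,1,9,10,7,6,8,3]), (6,[6,8,7,3,4,5,11,1,0,9,10,2]),
     (6,[11,0,10,5,8,4,9,6,2,1,7,3]), (6,[0,6,10,11,8,1,2,7,3,4,5,9]),
     (6,[5,11,4,6,1,3,2,7,9,8,10,0]), (0,[5,6,2,3,1,4,0,10,7,9,8,11]),
     (0,[1,5,7,3,6,4,10,0,8,11,9,2]), (0,[10,2,4,5,3,8,7,6,9,0,1,11]),
     (0,[11,4,3,6,5,8,1,10,2,0,7,9]), (0,[8,11,9,0,1,10,4,3,7,5,2,6]),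
     (0,[4,8,9,5,7,3,10,2,11,6,1,0]), (0,[3,2,11,1,0,4,7,6,5,10,9,8]),
     (0,[4,0,2,3,1,6,8,9,7,10,5,11]), (0,[0,8,4,5,6,3,9,2,1,7,10,11])]"
    "[(6,[3,5,4,1,9,2,6,11,10,7,0,8]), (6,[1,11,4,2,3,5,6,0,8,10,7,9]),
     (6,[0,11,1,6,2,3,9,8,5,7,10,4]), (6,[3,1,2,10,4,0,9,7,11,8,5,6]),
     (6,[6,4,5,0,3,1,9,2,7,10,8,11]), (6,[2,3,1,7,11,4,0,5,9,8,6,10]),
     (6,[7,11,8,6,9,1,4,2,0,10,3,5]), (6,[6,8,11,7,0,9,10,5,3,2,4,1]),
     (6,[3,2,10,4,5,0,7,1,9,8,11,6]), (0,[3,11,0,9,10,5,2,8,1,6,4,7]),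
     (0,[11,3,7,2,1,4,10,9,5,0,8,6]), (0,[3,7,8,10,4,6,0,1,5,9,2,11]),
     (0,[3,1,4,2,0,7,11,10,8,5,9,6]), (0,[5,0,6,1,3,11,10,7,8,4,9,2]),
     (0,[2,0,7,6,4,5,10,8,9,11,1,3]), (0,[0,5,3,2,7,4,6,1,8,11,9,10]),
     (0,[8,4,11,10,0,1,5,2,7,9,3,6]), (0,[11,5,9,7,8,6,0,1,3,2,4,10])]"]) code_simp

definition graph_11 :: "nat \<times> (nat \<times> nat) list" where
  "graph_11 = (10,
    [(0,2), (0,3), (0,5), (1,2), (1,4), (1,6), (2,7), (2,8), (3,4), (3,7), (3,9), (4,8), (4,9),
     (5,7), (5,8), (5,9), (6,7), (6,8), (6,9)])"

lemma MMNA_graph_11: "MMNA (case_prod list_graph graph_11)"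
  by (rule MMNA_certified[of graph_11
    "[([(3,4)],[3,5,6,7,8,9]), ([(3,4)],[0,7,8,2,3,5]), ([(3,4)],[3,5,6,7,8,9]), ([(0,5),
     (0,9)],[0,1,8,2,4,6]), ([(2,8), (2,6)],[0,7,9,2,3,5]), ([(3,4)],[1,7,8,2,3,6]),
     ([(4,8)],[0,4,7,2,3,5]), ([(0,5), (0,9)],[0,1,8,2,4,6]), ([(1,6), (0,2)],[0,7,9,1,3,5]),
     ([(4,8)],[0,4,7,2,3,5])]"
    "[(4,[8,3,4,9,7,0,5,1,2,6]), (4,[2,4,5,7,0,1,9,6,3,8]), (6,[7,3,4,8,9,1,6,5,2,0]),
     (3,[7,3,6,4,2,1,9,8,5,0]), (3,[9,7,6,5,3,0,4,8,2,1]), (5,[3,5,0,4,6,7,1,2,9,8]),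
     (6,[2,7,0,1,9,4,8,3,6,5]), (5,[3,4,2,9,6,7,1,0,5,8]), (2,[4,9,8,3,6,5,7,1,0,2]),
     (2,[6,9,4,7,3,5,0,1,2,8]), (4,[4,7,8,3,9,2,6,5,0,1]), (2,[0,3,5,6,2,9,4,7,8,1]),
     (3,[9,1,0,6,2,4,7,8,3,5]), (4,[3,1,4,6,0,7,9,5,2,8]), (2,[8,4,1,6,5,7,0,9,3,2]),
     (2,[7,0,2,4,1,8,5,6,9,3]), (2,[2,4,6,0,9,1,5,8,7,3]), (3,[3,5,4,1,7,2,9,0,6,8]),
     (2,[3,7,8,4,5,1,6,2,9,0])]"
    "[(6,[9,2,3,1,4,8,5,0,6,7]), (6,[5,2,6,4,1,9,3,8,7,0]), (4,[7,9,8,6,2,3,1,0,4,5]),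
     (5,[2,3,0,7,5,1,8,9,4,6]), (5,[8,1,7,9,3,0,4,6,5,2]), (3,[5,7,4,1,2,8,9,6,3,0]),
     (2,[4,1,2,6,7,5,9,0,8,3]), (2,[5,0,1,4,2,6,8,7,9,3]), (3,[9,2,4,6,1,8,3,5,0,7]),
     (4,[3,6,4,9,2,1,7,8,5,0]), (2,[2,5,9,4,1,3,6,7,8,0]), (3,[7,9,5,2,3,6,0,8,4,1]),
     (2,[0,8,6,9,7,5,2,1,3,4]), (1,[2,9,4,3,5,1,7,0,8,6]), (1,[1,3,2,0,5,4,7,9,8,6]),
     (2,[8,0,7,6,9,2,5,3,1,4]), (0,[3,1,2,6,5,9,0,8,4,7]), (0,[8,2,4,0,1,9,6,5,3,7]),
     (2,[1,6,5,3,4,0,7,9,2,8])]"]) code_simp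

definition graph_12 :: "nat \<times> (nat \<times> nat) list" where
  "graph_12 = (10,
    [(0,5), (0,6), (0,7), (1,3), (1,4), (1,9), (2,3), (2,4), (2,9), (3,5), (3,6), (4,7), (4,8),
     (5,8), (5,9), (6,8), (6,9), (7,8), (7,9)])"

lemma MMNA_graph_12: "MMNA (case_prod list_graph graph_12)"
  by (rule MMNA_certified[of graph_12
    "[([(5,8)],[1,2,5,3,4,9]), ([],[0,8,9,5,6,7]), ([],[0,8,9,5,6,7]), ([],[0,8,9,5,6,7]),
     ([],[0,8,9,5,6,7]), ([(6,8)],[1,2,6,3,4,9]), ([(4,8)],[1,2,5,3,4,9]), ([(5,8)],[1,2,5,3,4,9]),
     ([(0,7), (0,4)],[0,3,9,2,5,6]), ([(0,7), (2,3)],[0,2,8,4,5,6])]"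
    "[(3,[9,6,7,3,1,5,4,0,2,8]), (3,[6,0,2,5,1,7,3,9,4,8]), (3,[7,9,1,2,0,8,6,3,4,5]),
     (5,[8,3,2,6,4,5,1,9,7,0]), (5,[7,9,1,0,2,6,8,4,5,3]), (5,[9,6,5,7,2,4,0,3,1,8]),
     (5,[2,0,8,4,9,5,3,7,6,1]), (5,[5,7,8,0,3,2,9,4,1,6]), (5,[7,0,4,1,5,9,2,6,3,8]),
     (6,[2,0,4,9,8,5,7,1,6,3]), (5,[3,5,0,9,7,8,2,1,6,4]), (8,[6,2,0,4,1,5,8,7,3,9]),
     (7,[9,1,2,4,3,7,8,5,6,0]), (3,[9,6,4,1,5,0,8,7,3,2]), (3,[1,8,6,3,9,2,5,4,0,7]),
     (3,[3,5,7,1,6,9,0,2,4,8]), (3,[6,4,1,7,2,8,9,5,0,3]), (4,[5,8,0,7,3,1,4,2,6,9]),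
     (4,[3,0,1,2,9,7,4,6,5,8])]"
    "[(3,[8,2,4,5,1,3,9,7,0,6]), (3,[3,9,0,7,8,1,4,5,2,6]), (4,[2,8,7,0,4,3,6,9,5,1]),
     (5,[7,5,9,1,0,3,6,2,4,8]), (5,[9,6,1,2,4,3,0,8,5,7]), (5,[6,4,3,8,2,1,7,0,9,5]),
     (5,[5,2,8,6,1,4,7,0,9,3]), (5,[4,0,9,1,6,7,3,8,5,2]), (5,[3,9,0,8,7,2,4,6,5,1]),
     (3,[3,7,6,1,5,2,0,9,4,8]), (3,[6,0,8,2,4,3,1,7,5,9]), (4,[5,1,8,3,0,7,6,2,4,9]),
     (4,[6,3,8,9,0,7,1,5,2,4]), (3,[7,1,0,3,4,9,8,5,6,2]), (3,[9,6,7,3,5,1,0,8,4,2]),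
     (3,[3,8,7,6,9,4,5,0,2,1]), (3,[9,2,1,7,3,8,5,0,4,6]), (3,[8,1,4,2,0,9,6,7,3,5]),
     (3,[2,8,6,9,4,0,1,3,7,5])]"]) code_simp

text \<open>The disjoint union of K33 and K5.\<close>

definition graph_13 :: "nat \<times> (nat \<times> nat) list" where
  "graph_13 = (11,
    [(0,1), (0,2), (0,3), (1,4), (1,5), (2,4), (2,5), (3,4), (3,5), (6,7), (6,8), (6,9), (6,10),
     (7,8), (7,9), (7,10), (8,9), (8,10), (9,10)])"

lemma MMNA_graph_13: "MMNA (case_prod list_graph graph_13)"
  by (rule MMNA_certified[of graph_13
    "[([],[6,7,8,9,10]), ([],[6,7,8,9,10]), ([],[6,7,8,9,10]), ([],[6,7,8,9,10]), ([],[6,7,8,9,10]),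
     ([],[6,7,8,9,10]), ([],[0,4,5,1,2,3]), ([],[0,4,5,1,2,3]), ([],[0,4,5,1,2,3]),
     ([],[0,4,5,1,2,3]), ([],[0,4,5,1,2,3])]"
    "[(6,[4,10,6,9,3,8,5,1,0,2,7]), (6,[0,9,2,1,3,5,4,7,8,6,10]), (6,[0,10,1,7,5,9,8,6,2,4,3]),
     (6,[3,2,4,1,10,5,0,8,6,7,9]), (6,[4,6,3,7,5,2,10,0,1,9,8]), (6,[3,1,7,6,4,8,2,0,9,10,5]),
     (6,[8,3,10,1,9,2,0,7,5,6,4]), (6,[1,4,0,10,2,9,6,8,7,5,3]), (6,[6,4,5,0,2,3,10,1,9,8,7]),
     (0,[1,7,4,9,6,8,0,3,10,2,5]), (0,[5,3,4,8,2,6,10,1,7,0,9]), (0,[1,8,5,4,3,6,10,9,0,2,7]),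
     (0,[1,3,4,0,6,2,9,7,10,8,5]), (0,[9,3,0,4,10,2,6,7,5,1,8]), (0,[7,4,3,2,5,8,9,1,0,10,6]),
     (0,[5,0,9,7,6,8,1,4,3,10,2]), (0,[2,8,5,7,6,9,0,4,3,10,1]), (0,[0,6,7,10,5,8,1,4,3,2,9]),
     (0,[0,4,5,8,7,3,6,9,1,2,10])]"
    "[(6,[10,6,8,4,5,9,7,3,0,1,2]), (6,[8,3,5,1,4,2,7,0,6,9,10]), (6,[10,5,7,0,6,8,3,2,1,9,4]),
     (6,[3,1,0,2,9,4,10,5,6,8,7]), (6,[6,1,5,8,9,0,7,4,3,10,2]), (6,[8,9,1,7,4,10,5,2,0,3,6]),
     (6,[5,4,1,2,3,6,0,8,9,10,7]), (6,[1,6,4,5,2,8,7,10,9,3,0]), (6,[2,0,3,5,7,4,6,9,10,1,8]),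
     (0,[2,6,8,7,1,4,9,5,3,0,10]), (0,[4,9,8,2,10,7,3,0,1,5,6]), (0,[1,2,6,8,9,7,5,0,4,10,3]),
     (0,[0,9,2,8,10,7,4,3,6,1,5]), (0,[10,2,7,0,1,3,4,9,8,5,6]), (0,[0,3,1,4,2,9,6,10,7,8,5]),
     (0,[6,7,10,1,0,8,5,3,2,4,9]), (0,[5,6,7,8,4,0,10,2,1,9,3]), (0,[1,10,4,2,0,3,9,6,5,8,7]),
     (0,[0,10,3,1,4,9,6,7,5,8,2])]"]) code_simp

definition graph_14 :: "nat \<times> (nat \<times> nat) list" where
  "graph_14 = (9,
    [(0,1), (0,2), (0,4), (1,3), (1,5), (1,6), (2,3), (2,5), (2,7), (3,4), (3,8), (4,6), (4,7),
     (4,8), (5,6), (5,7), (5,8), (6,7), (6,8), (7,8)])"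

lemma MMNA_graph_14: "MMNA (case_prod list_graph graph_14)"
  by (rule MMNA_certified[of graph_14
    "[([(6,7)],[1,2,8,3,5,6]), ([(0,4)],[0,5,7,2,6,8]), ([(0,4)],[0,5,6,1,7,8]),
     ([(0,1)],[0,7,8,4,5,6]), ([(1,6)],[1,2,8,3,5,7]), ([(6,7)],[0,3,6,1,2,4]),
     ([(5,7)],[0,3,5,1,2,4]), ([(5,6)],[0,3,5,1,2,4]), ([(5,6)],[0,3,5,1,2,4])]"
    "[(6,[0,4,1,5,7,3,8,2,6]), (7,[2,8,6,7,3,0,1,5,4]), (3,[8,7,6,3,2,5,0,4,1]),
     (7,[6,3,5,7,2,4,1,8,0]), (2,[1,0,6,2,8,4,7,5,3]), (4,[5,4,1,2,3,6,8,7,0]),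
     (6,[7,8,6,4,5,0,2,1,3]), (1,[7,4,8,1,2,5,3,6,0]), (4,[0,1,8,5,6,2,4,3,7]),
     (8,[7,8,1,0,5,2,6,4,3]), (4,[4,7,2,5,3,8,6,1,0]), (1,[1,6,3,4,2,7,8,0,5]),
     (2,[4,5,0,6,3,7,2,1,8]), (3,[1,3,2,7,0,4,6,8,5]), (1,[7,4,8,1,2,0,5,6,3]),
     (2,[7,0,6,8,5,1,2,3,4]), (3,[6,7,4,2,3,5,8,1,0]), (3,[6,5,2,7,3,8,4,1,0]),
     (2,[6,5,4,3,7,1,0,8,2]), (1,[1,8,7,3,2,6,5,0,4])]"
    "[(7,[1,4,3,5,6,0,7,2,8]), (6,[6,4,3,1,0,5,7,8,2]), (8,[3,4,0,2,8,1,5,7,6]),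
     (6,[4,2,5,8,1,6,3,7,0]), (1,[0,4,2,1,8,3,6,5,7]), (1,[6,8,0,1,7,2,3,5,4]),
     (7,[8,1,3,6,5,2,7,0,4]), (2,[3,2,4,5,1,0,8,7,6]), (1,[8,3,2,7,0,5,1,4,6]),
     (3,[8,0,3,7,1,2,6,4,5]), (0,[2,5,7,3,1,6,4,8,0]), (2,[5,4,7,1,0,6,3,8,2]),
     (1,[4,0,5,6,2,3,1,7,8]), (1,[6,5,7,4,2,8,1,3,0]), (2,[4,3,1,2,8,5,6,7,0]),
     (1,[4,7,3,5,2,6,0,1,8]), (1,[2,8,4,3,1,5,0,6,7]), (1,[8,0,4,5,7,3,1,2,6]),
     (0,[8,2,7,1,6,0,3,5,4]), (0,[8,4,7,6,5,2,3,0,1])]"]) code_simp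

definition graph_15 :: "nat \<times> (nat \<times> nat) list" where
  "graph_15 = (9,
    [(0,2), (0,3), (0,4), (1,2), (1,3), (1,4), (2,5), (2,6), (3,5), (3,7), (3,8), (4,6), (4,7),
     (4,8), (5,6), (5,7), (5,8), (6,7), (6,8), (7,8)])"

lemma MMNA_graph_15: "MMNA (case_prod list_graph graph_15)"
  by (rule MMNA_certified[of graph_15
    "[([(2,6)],[1,7,8,2,3,4]), ([(0,2)],[0,7,8,3,4,6]), ([(0,4)],[0,5,7,3,6,8]),
     ([(1,2)],[1,7,8,4,5,6]), ([(0,3)],[0,5,6,2,7,8]), ([(6,7)],[0,1,6,2,3,4]),
     ([(5,8)],[0,1,5,2,3,4]), ([(4,6)],[0,1,5,2,3,4]), ([(4,6)],[0,1,5,2,3,4])]"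
    "[(7,[2,6,8,7,3,0,4,5,1]), (7,[0,1,8,2,4,7,6,3,5]), (7,[8,4,7,3,5,0,6,1,2]),
     (7,[2,3,6,4,0,5,7,1,8]), (7,[3,0,2,5,7,4,1,8,6]), (7,[0,4,7,5,1,3,8,6,2]),
     (3,[7,5,6,1,8,3,0,2,4]), (4,[1,0,2,3,6,4,5,7,8]), (2,[8,7,0,6,1,3,2,4,5]),
     (4,[4,6,5,3,1,7,2,8,0]), (4,[2,6,4,1,5,3,7,0,8]), (2,[8,7,1,3,0,4,5,2,6]),
     (3,[2,0,1,4,3,8,5,6,7]), (3,[5,4,8,6,7,2,0,3,1]), (2,[4,5,3,7,2,8,1,6,0]),
     (3,[7,6,5,0,8,1,4,3,2]), (3,[5,7,4,6,0,3,2,8,1]), (3,[1,7,8,2,3,5,6,0,4]),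
     (3,[3,1,2,0,7,4,8,6,5]), (2,[7,4,3,6,2,0,1,5,8])]"
    "[(7,[4,5,2,3,7,1,8,0,6]), (7,[5,1,2,0,8,3,7,4,6]), (7,[5,3,6,4,2,1,7,0,8]),
     (7,[6,7,4,3,2,8,0,5,1]), (7,[0,4,8,6,1,5,7,2,3]), (7,[2,8,0,7,1,3,4,5,6]),
     (2,[2,8,1,0,5,3,6,7,4]), (2,[0,6,2,1,7,3,4,5,8]), (3,[2,8,1,3,6,0,4,5,7]),
     (2,[8,7,6,0,3,1,2,4,5]), (2,[3,4,2,7,1,6,5,0,8]), (3,[1,0,2,8,7,6,5,4,3]),
     (2,[3,6,7,4,0,2,1,5,8]), (2,[1,4,5,2,6,0,8,7,3]), (3,[2,3,0,5,4,8,1,7,6]),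
     (2,[4,2,8,5,3,7,0,6,1]), (2,[1,2,6,0,8,5,4,3,7]), (2,[8,2,4,7,1,6,0,3,5]),
     (2,[3,4,0,5,2,8,7,1,6]), (0,[4,1,0,6,2,7,3,5,8])]"]) code_simp

definition graph_16 :: "nat \<times> (nat \<times> nat) list" where
  "graph_16 = (10,
    [(0,1), (0,2), (0,3), (0,4), (1,2), (1,3), (1,4), (2,3), (2,4), (3,4), (5,6), (5,7), (5,8),
     (5,9), (6,7), (6,8), (6,9), (7,8), (7,9), (8,9)])"

lemma MMNA_graph_16: "MMNA (case_prod list_graph graph_16)"
  by (rule MMNA_certified[of graph_16
    "[([],[5,6,7,8,9]), ([],[5,6,7,8,9]), ([],[5,6,7,8,9]), ([],[5,6,7,8,9]), ([],[5,6,7,8,9]),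
     ([],[0,1,2,3,4]), ([],[0,1,2,3,4]), ([],[0,1,2,3,4]), ([],[0,1,2,3,4]), ([],[0,1,2,3,4])]"
    "[(5,[4,6,1,3,5,8,9,0,7,2]), (5,[6,1,0,9,8,4,3,2,7,5]), (5,[8,0,5,6,7,9,4,2,1,3]),
     (5,[4,5,3,6,7,8,1,9,2,0]), (5,[3,4,0,2,5,6,9,8,7,1]), (5,[3,2,4,5,1,6,8,9,0,7]),
     (5,[9,0,8,1,6,2,4,5,3,7]), (5,[1,3,2,5,0,9,8,4,6,7]), (5,[7,0,9,8,5,6,2,4,1,3]),
     (5,[7,5,8,6,0,3,9,2,1,4]), (0,[8,5,1,2,3,6,9,7,0,4]), (0,[1,6,5,3,4,9,8,7,2,0]),
     (0,[7,9,8,0,1,6,4,2,3,5]), (0,[1,3,4,2,0,9,8,7,5,6]), (0,[2,0,1,9,8,3,4,6,7,5]),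
     (0,[0,6,9,5,7,4,2,1,8,3]), (0,[8,0,3,1,9,5,6,7,2,4]), (0,[1,7,5,6,8,2,9,0,4,3]),
     (0,[9,8,7,2,0,4,1,5,6,3]), (0,[0,6,7,4,5,2,8,1,3,9])]"
    "[(5,[0,3,8,2,1,9,5,4,6,7]), (5,[5,7,3,8,6,9,2,0,1,4]), (5,[3,1,2,7,4,5,6,8,9,0]),
     (5,[8,9,3,7,4,5,6,2,1,0]), (5,[4,7,1,5,6,2,8,0,9,3]), (5,[2,1,3,6,9,4,0,5,7,8]),
     (5,[8,4,5,7,2,6,0,3,1,9]), (5,[8,9,4,6,5,7,0,3,2,1]), (5,[1,4,2,3,0,5,7,9,6,8]),
     (5,[2,6,1,3,4,5,7,9,8,0]), (0,[3,5,9,0,8,2,6,1,7,4]), (0,[5,0,8,7,6,4,9,2,3,1]),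
     (0,[4,2,7,6,5,1,3,8,9,0]), (0,[6,7,3,1,2,5,0,8,9,4]), (0,[5,7,8,6,4,1,0,3,2,9]),
     (0,[7,1,6,2,0,3,4,8,9,5]), (0,[6,4,9,8,7,2,5,1,3,0]), (0,[4,0,7,8,9,1,5,6,2,3]),
     (0,[8,4,0,7,9,1,3,2,6,5]), (0,[8,9,6,7,5,2,4,0,3,1])]"]) code_simp

definition graph_17 :: "nat \<times> (nat \<times> nat) list" where
  "graph_17 = (10,
    [(0,2), (0,3), (0,4), (1,2), (1,5), (1,6), (2,7), (2,8), (3,5), (3,7), (3,9), (4,6), (4,7),
     (4,9), (5,8), (5,9), (6,8), (6,9), (7,8), (8,9)])"

lemma MMNA_graph_17: "MMNA (case_prod list_graph graph_17)"
  by (rule MMNA_certified[of graph_17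
    "[([(1,6), (1,4)],[1,3,8,5,7,9]), ([(2,8)],[0,7,9,2,3,4]), ([(4,7), (1,5)],[1,4,9,3,6,8]),
     ([(0,4), (0,9)],[0,1,8,2,5,6]), ([(0,3), (6,9)],[0,1,8,2,5,6]), ([(2,8)],[0,7,9,2,3,4]),
     ([(8,9)],[0,7,8,2,3,4]), ([(1,5), (0,4)],[0,1,8,2,6,9]), ([(3,9), (1,6)],[0,1,7,2,3,4]),
     ([(4,7), (3,5)],[1,4,8,2,3,6])]"
    "[(1,[5,6,1,0,4,8,3,2,9,7]), (1,[8,7,9,3,6,4,0,2,1,5]), (1,[4,2,1,3,7,5,8,0,9,6]),
     (3,[4,8,3,0,2,7,9,5,1,6]), (0,[3,0,6,2,1,4,9,5,7,8]), (0,[3,5,6,7,9,4,0,8,1,2]),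
     (8,[4,1,2,3,6,0,8,5,9,7]), (1,[2,6,4,3,1,7,9,5,8,0]), (2,[1,8,4,2,0,7,6,3,9,5]),
     (1,[3,9,2,8,6,0,5,4,1,7]), (4,[3,9,8,4,1,2,7,5,6,0]), (2,[6,3,2,9,7,4,1,8,0,5]),
     (1,[1,6,2,0,7,9,5,3,4,8]), (3,[7,6,3,9,8,4,1,0,2,5]), (4,[1,8,0,9,4,5,6,2,7,3]),
     (3,[9,0,8,4,2,7,1,3,6,5]), (3,[0,7,6,2,1,8,9,4,5,3]), (4,[6,8,9,7,2,3,1,5,0,4]),
     (2,[1,7,2,8,0,5,9,3,6,4]), (2,[9,2,8,6,7,1,3,5,4,0])]"
    "[(8,[4,1,0,5,9,3,8,6,2,7]), (1,[3,6,0,1,8,2,5,9,7,4]), (1,[9,8,0,7,1,4,2,6,5,3]),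
     (1,[2,9,3,0,1,7,5,8,6,4]), (4,[2,1,3,7,6,9,0,5,4,8]), (3,[1,3,2,7,6,4,8,0,9,5]),
     (1,[3,7,1,2,4,0,5,8,6,9]), (2,[7,4,5,8,9,3,2,0,1,6]), (3,[4,2,1,9,3,0,7,5,8,6]),
     (1,[4,3,1,0,6,9,7,2,5,8]), (2,[5,1,4,3,6,2,0,7,9,8]), (3,[8,6,7,4,5,2,9,0,1,3]),
     (1,[7,6,8,5,9,2,0,3,4,1]), (2,[5,1,7,4,3,0,9,6,8,2]), (0,[2,0,3,6,4,8,9,7,1,5]),
     (2,[2,5,8,7,3,6,4,0,9,1]), (0,[6,1,8,9,5,0,2,7,4,3]), (2,[1,6,4,9,0,8,7,3,5,2]),
     (0,[9,4,8,6,1,5,0,7,2,3]), (2,[3,4,2,7,9,6,1,8,0,5])]"]) code_simp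

definition graph_18 :: "nat \<times> (nat \<times> nat) list" where
  "graph_18 = (10,
    [(0,3), (0,5), (0,6), (1,3), (1,4), (1,7), (2,3), (2,4), (2,7), (3,8), (4,5), (4,9), (5,8),
     (5,9), (6,7), (6,8), (6,9), (7,8), (7,9), (8,9)])"

lemma MMNA_graph_18: "MMNA (case_prod list_graph graph_18)"
  by (rule MMNA_certified[of graph_18
    "[([(5,8)],[1,2,5,3,4,7]), ([(2,4), (0,6)],[0,2,8,5,7,9]), ([(4,5), (0,6)],[0,1,8,3,4,7]),
     ([(1,4), (0,5)],[0,7,9,1,6,8]), ([(2,7), (2,3)],[0,8,9,2,5,6]), ([(8,9)],[1,2,8,3,4,7]),
     ([(5,8)],[1,2,5,3,4,7]), ([(2,3), (6,9)],[0,4,8,2,5,6]), ([(5,9), (0,3)],[0,4,7,1,2,5]),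
     ([(5,8)],[1,2,5,3,4,7])]"
    "[(4,[8,4,5,3,2,0,7,6,1,9]), (3,[2,8,0,6,9,7,3,4,5,1]), (1,[2,7,5,6,4,3,0,8,1,9]),
     (0,[7,3,2,1,4,5,9,0,6,8]), (0,[5,0,9,8,7,4,2,1,3,6]), (0,[6,8,0,9,4,5,2,1,7,3]),
     (0,[4,8,3,7,5,6,0,1,9,2]), (0,[7,5,3,4,8,9,1,2,6,0]), (0,[2,3,9,8,1,0,6,7,5,4]),
     (0,[8,5,2,0,1,4,7,9,6,3]), (3,[5,8,9,1,2,4,0,7,6,3]), (5,[2,6,3,7,4,5,0,1,8,9]),
     (3,[0,1,2,4,9,8,7,3,5,6]), (4,[4,0,9,1,2,3,8,7,5,6]), (3,[1,9,6,5,4,0,2,7,8,3]),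
     (4,[7,4,8,6,1,2,9,5,3,0]), (3,[1,6,5,3,2,0,8,7,9,4]), (3,[5,2,3,7,6,8,0,4,9,1]),
     (4,[9,4,2,1,0,7,5,3,8,6]), (3,[6,9,2,7,3,8,5,1,0,4])]"
    "[(0,[1,6,5,7,8,4,2,9,0,3]), (7,[3,2,9,4,0,1,7,5,6,8]), (4,[3,7,4,5,9,1,8,6,0,2]),
     (0,[3,1,0,9,2,4,7,6,5,8]), (0,[4,5,2,3,6,0,8,7,1,9]), (0,[4,9,0,8,1,2,5,6,7,3]),
     (0,[8,9,0,4,2,1,6,7,5,3]), (0,[4,9,0,8,1,7,5,2,3,6]), (0,[0,7,6,9,3,2,5,8,1,4]),
     (3,[1,8,5,2,6,9,3,7,0,4]), (4,[9,0,2,3,5,1,7,8,4,6]), (3,[4,6,8,2,7,3,0,9,5,1]),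
     (3,[5,8,0,1,2,3,4,9,7,6]), (3,[0,8,1,2,9,6,3,7,4,5]), (3,[0,3,2,7,6,1,4,5,9,8]),
     (1,[6,3,1,8,9,5,4,2,7,0]), (3,[3,0,9,8,4,1,5,7,6,2]), (0,[4,8,6,9,5,3,2,0,7,1]),
     (3,[4,7,9,0,8,2,3,5,6,1]), (3,[2,0,9,7,8,6,4,5,1,3])]"]) code_simp

definition graph_19 :: "nat \<times> (nat \<times> nat) list" where
  "graph_19 = (10,
    [(0,4), (0,6), (0,7), (1,4), (1,6), (1,7), (2,4), (2,8), (2,9), (3,4), (3,8), (3,9), (5,6),
     (5,7), (5,8), (5,9), (6,8), (6,9), (7,8), (7,9)])"

lemma MMNA_graph_19: "MMNA (case_prod list_graph graph_19)"
  by (rule MMNA_certified[of graph_19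
    "[([(1,6)],[1,2,3,4,8,9]), ([(0,4)],[0,8,9,2,6,7]), ([(3,4)],[1,8,9,3,6,7]),
     ([(2,4)],[0,1,8,2,6,7]), ([(3,9), (1,7)],[1,3,5,6,8]), ([(2,4)],[0,1,8,2,6,7]),
     ([(1,4)],[1,8,9,2,3,7]), ([(0,6)],[0,2,3,4,8,9]), ([(3,9)],[0,1,3,4,6,7]),
     ([(3,8)],[0,1,3,4,6,7])]"
    "[(8,[3,8,1,9,0,4,5,2,7,6]), (8,[5,3,6,0,2,8,9,4,1,7]), (8,[0,3,8,9,1,6,2,4,5,7]),
     (8,[4,0,3,8,6,1,2,9,5,7]), (8,[8,3,5,6,7,0,9,2,1,4]), (8,[1,8,5,7,4,2,0,3,6,9]),
     (6,[3,5,0,6,4,9,7,2,1,8]), (6,[7,1,2,8,9,5,0,4,6,3]), (6,[6,5,3,1,8,0,2,7,4,9]),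
     (6,[8,7,6,4,9,3,1,2,5,0]), (6,[8,4,9,5,7,2,6,1,0,3]), (6,[7,8,0,9,5,2,6,3,1,4]),
     (4,[4,3,9,6,7,1,5,2,0,8]), (4,[1,2,8,5,7,9,0,4,3,6]), (4,[9,0,6,7,5,1,3,8,4,2]),
     (4,[4,5,0,2,8,6,9,3,7,1]), (4,[7,6,0,3,2,5,8,4,1,9]), (4,[4,5,1,2,9,7,6,3,0,8]),
     (4,[8,9,5,2,0,6,3,7,4,1]), (4,[7,9,5,2,0,1,6,8,4,3])]"
    "[(8,[4,1,7,5,3,9,0,2,6,8]), (8,[0,2,5,6,3,8,4,9,1,7]), (8,[9,3,2,1,0,6,5,4,8,7]),
     (8,[6,0,1,9,4,3,5,8,7,2]), (8,[7,2,4,5,3,1,8,9,6,0]), (8,[5,8,3,2,7,0,9,6,4,1]),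
     (6,[9,6,7,3,4,1,8,0,5,2]), (6,[2,8,6,0,9,4,7,3,1,5]), (6,[0,4,5,8,3,6,9,2,7,1]),
     (6,[6,8,4,5,0,1,3,7,9,2]), (6,[6,3,5,0,4,9,1,8,2,7]), (6,[6,7,8,9,5,3,2,4,0,1]),
     (4,[3,9,6,5,2,8,7,1,4,0]), (4,[4,8,1,0,7,6,2,3,5,9]), (4,[2,4,7,8,0,5,3,9,6,1]),
     (4,[4,1,6,7,2,8,0,3,5,9]), (4,[7,6,9,0,5,1,8,4,3,2]), (4,[8,9,3,0,1,4,5,7,2,6]),
     (4,[5,9,7,6,3,0,1,8,2,4]), (4,[6,7,0,1,9,8,3,4,2,5])]"]) code_simp

text \<open>K34 with sides {6,7,8} and {4,5,9,10}, glued along 9 and 10 to a K33 that lacks the edge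
  between these two vertices.\<close>

definition graph_20 :: "nat \<times> (nat \<times> nat) list" where
  "graph_20 = (11,
    [(0,1), (0,2), (0,9), (1,3), (1,10), (2,3), (2,10), (3,9), (4,6), (4,7), (4,8), (5,6), (5,7),
     (5,8), (6,9), (6,10), (7,9), (7,10), (8,9), (8,10)])"

lemma MMNA_graph_20: "MMNA (case_prod list_graph graph_20)"
  by (rule MMNA_certified[of graph_20
    "[([],[4,9,10,6,7,8]), ([],[4,5,10,6,7,8]), ([],[4,9,10,6,7,8]), ([],[4,5,9,6,7,8]),
     ([],[5,9,10,6,7,8]), ([],[4,9,10,6,7,8]), ([(8,10)],[0,3,8,1,2,9]), ([(8,10)],[0,3,8,1,2,9]),
     ([(6,9)],[0,3,10,1,2,6]), ([],[4,5,10,6,7,8]), ([],[4,5,9,6,7,8])]"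
    "[(6,[2,4,0,3,6,7,8,5,9,1,10]), (6,[3,2,5,4,7,8,1,6,10,9,0]), (6,[3,2,4,5,9,10,7,0,8,6,1]),
     (6,[4,5,6,7,1,0,3,2,9,8,10]), (6,[2,8,1,9,4,5,0,6,3,7,10]), (6,[2,10,1,9,7,5,4,8,6,0,3]),
     (6,[2,0,9,8,6,5,10,1,4,3,7]), (6,[10,9,6,7,4,2,3,5,1,0,8]), (9,[10,2,0,1,8,9,4,5,6,7,3]),
     (9,[10,8,9,0,4,7,5,6,2,3,1]), (9,[2,8,1,3,6,9,7,5,10,0,4]), (9,[9,10,8,4,6,1,3,7,2,5,0]),
     (9,[2,7,6,4,0,10,9,8,1,5,3]), (9,[3,10,4,2,8,0,9,1,7,6,5]), (10,[7,8,6,9,1,0,2,10,4,5,3]),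
     (9,[7,6,9,8,2,4,0,10,1,5,3]), (10,[7,9,8,0,1,5,6,4,3,2,10]), (9,[0,3,5,4,10,8,1,9,7,6,2]),
     (10,[10,9,8,0,7,2,5,1,4,6,3]), (9,[2,3,0,10,7,5,9,8,6,4,1])]"
    "[(6,[5,4,3,1,8,7,0,9,2,10,6]), (6,[5,6,2,4,1,9,0,8,10,3,7]), (6,[3,0,2,1,7,5,6,8,4,10,9]),
     (6,[10,1,6,0,3,4,7,2,8,9,5]), (6,[6,7,5,4,1,8,3,10,0,2,9]), (6,[9,1,0,4,6,5,2,8,7,10,3]),
     (6,[7,6,10,5,3,0,8,2,1,4,9]), (6,[5,4,6,8,1,2,0,9,10,7,3]), (9,[8,9,0,10,2,5,4,1,6,3,7]),
     (9,[5,2,7,4,10,8,0,1,9,6,3]), (9,[2,1,3,0,6,5,9,4,10,8,7]), (9,[3,6,9,8,0,10,5,1,2,7,4]),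
     (9,[10,0,1,8,3,5,6,7,4,9,2]), (9,[6,8,2,9,1,4,0,3,7,10,5]), (6,[10,3,9,0,5,8,1,4,7,2,6]),
     (6,[8,0,7,9,2,10,3,4,1,5,6]), (7,[6,2,3,4,7,9,8,1,10,0,5]), (7,[6,10,8,7,3,1,2,4,5,0,9]),
     (8,[10,0,8,9,5,6,2,7,1,3,4]), (8,[4,3,1,0,5,7,6,8,2,9,10])]"]) code_simp

definition graph_21 :: "nat \<times> (nat \<times> nat) list" where
  "graph_21 = (11,
    [(0,1), (0,2), (0,9), (1,5), (1,10), (2,5), (2,10), (3,6), (3,7), (3,8), (4,6), (4,7), (4,8),
     (5,6), (5,9), (6,10), (7,9), (7,10), (8,9), (8,10)])"

lemma MMNA_graph_21: "MMNA (case_prod list_graph graph_21)"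
  by (rule MMNA_certified[of graph_21
    "[([],[3,4,10,6,7,8]), ([],[3,4,10,6,7,8]), ([],[3,4,10,6,7,8]), ([(8,10)],[0,5,8,1,2,9]),
     ([(5,9)],[3,5,10,6,7,8]), ([],[3,4,10,6,7,8]), ([(8,10)],[0,5,8,1,2,9]),
     ([(8,10)],[0,5,8,1,2,9]), ([(7,10)],[0,5,7,1,2,9]), ([],[3,4,10,6,7,8]),
     ([(5,6)],[3,4,9,5,7,8])]"
    "[(6,[10,6,9,1,2,4,7,5,0,3,8]), (6,[9,8,6,4,0,7,2,1,3,5,10]), (6,[2,3,5,9,0,4,10,8,6,7,1]),
     (6,[3,5,2,9,7,1,4,0,8,10,6]), (6,[3,4,1,9,8,6,5,7,10,2,0]), (6,[3,5,4,9,7,0,8,2,10,6,1]),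
     (6,[4,3,6,9,10,7,5,0,2,1,8]), (5,[7,10,8,5,1,4,2,0,3,6,9]), (5,[9,8,2,6,4,10,5,0,3,1,7]),
     (5,[3,2,0,8,6,10,7,9,4,5,1]), (5,[7,4,5,1,10,8,2,6,0,9,3]), (5,[10,8,7,3,1,9,2,5,0,4,6]),
     (5,[9,3,10,1,7,4,6,5,0,2,8]), (10,[7,4,5,2,9,3,1,0,8,10,6]), (6,[9,7,0,4,5,8,10,1,3,2,6]),
     (5,[1,6,7,3,9,0,4,10,5,2,8]), (8,[7,5,10,2,0,8,1,3,6,9,4]), (9,[8,9,7,3,4,0,1,5,6,10,2]),
     (7,[1,3,9,6,7,2,8,10,5,0,4]), (9,[6,5,7,9,1,4,8,2,0,10,3])]"
    "[(6,[7,2,4,9,10,3,1,8,5,0,6]), (6,[7,6,1,10,4,8,2,0,3,9,5]), (6,[0,5,3,9,7,4,1,10,2,8,6]),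
     (6,[6,5,8,2,10,1,3,0,9,7,4]), (6,[1,10,8,3,6,9,0,2,5,7,4]), (6,[0,9,5,3,7,1,10,4,8,2,6]),
     (6,[1,8,6,3,4,9,0,5,2,10,7]), (5,[8,6,7,3,2,5,0,4,10,1,9]), (5,[2,9,0,3,6,4,5,1,7,8,10]),
     (5,[4,3,5,7,10,6,9,0,8,1,2]), (5,[4,6,2,10,8,5,9,0,1,3,7]), (5,[0,9,2,6,10,4,7,5,3,1,8]),
     (5,[7,10,9,4,1,2,3,6,5,0,8]), (5,[5,10,0,7,2,3,8,1,6,4,9]), (6,[9,10,7,3,1,0,4,5,2,8,6]),
     (6,[0,9,2,4,7,10,1,5,6,8,3]), (7,[6,7,5,1,9,2,10,3,4,0,8]), (5,[4,6,1,8,10,5,9,7,0,2,3]),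
     (8,[10,4,9,6,2,1,8,7,3,0,5]), (5,[8,7,5,3,2,9,1,4,0,6,10])]"]) code_simp

definition graph_22 :: "nat \<times> (nat \<times> nat) list" where
  "graph_22 = (11,
    [(0,1), (0,4), (0,8), (1,5), (1,9), (2,4), (2,6), (2,7), (3,5), (3,6), (3,7), (4,9), (4,10),
     (5,8), (5,10), (6,8), (6,10), (7,9), (7,10), (8,9)])"

lemma MMNA_graph_22: "MMNA (case_prod list_graph graph_22)"
  by (rule MMNA_certified[of graph_22
    "[([(7,9)],[3,8,10,5,6,7]), ([(6,8)],[2,9,10,4,6,7]), ([(4,10)],[0,5,9,1,4,8]),
     ([(5,10)],[0,5,9,1,4,8]), ([(7,9)],[3,8,10,5,6,7]), ([(6,8)],[2,9,10,4,6,7]),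
     ([(5,10)],[0,5,9,1,4,8]), ([(5,10)],[0,5,9,1,4,8]), ([(0,4), (0,1), (0,2)],[0,3,10,5,6,7]),
     ([(3,7), (2,3), (0,8)],[0,2,10,4,5,6]), ([(3,5), (3,6), (2,3)],[0,2,9,1,4,8])]"
    "[(6,[7,10,5,3,6,8,9,2,0,1,4]), (6,[1,0,8,3,9,6,5,4,2,10,7]), (6,[1,0,9,3,10,6,4,5,7,8,2]),
     (6,[5,1,3,7,2,6,0,8,10,9,4]), (6,[2,7,4,9,3,6,1,10,8,0,5]), (5,[8,7,1,4,9,2,0,3,5,6,10]),
     (5,[3,5,1,10,2,6,8,0,4,7,9]), (5,[3,2,7,10,4,9,6,0,8,1,5]), (4,[9,8,5,1,2,10,4,3,7,0,6]),
     (4,[6,8,3,9,0,7,4,1,5,10,2]), (4,[10,1,5,7,8,2,4,3,9,0,6]), (7,[1,9,4,7,5,8,3,0,2,10,6]),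
     (5,[6,7,2,0,3,9,1,4,8,5,10]), (6,[9,8,1,3,5,10,6,2,7,4,0]), (4,[6,5,2,10,1,7,9,3,8,4,0]),
     (4,[3,4,9,8,7,5,6,1,0,2,10]), (4,[7,8,4,5,9,10,3,1,6,2,0]), (4,[5,6,0,9,2,4,10,1,8,7,3]),
     (4,[6,7,1,9,0,8,2,10,4,5,3]), (6,[5,10,7,2,4,1,8,9,0,6,3])]"
    "[(6,[8,7,5,10,3,0,4,1,9,6,2]), (7,[1,2,5,7,10,9,8,3,6,0,4]), (6,[10,6,8,2,9,3,0,4,5,7,1]),
     (6,[2,3,0,4,8,6,9,10,7,5,1]), (6,[8,7,10,1,9,2,3,0,5,6,4]), (5,[5,8,6,1,7,9,3,0,4,10,2]),
     (5,[1,3,9,8,0,5,4,7,6,2,10]), (5,[0,2,7,8,1,4,6,9,5,3,10]), (4,[8,9,5,0,6,4,2,3,7,10,1]),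
     (4,[8,9,4,2,10,1,7,5,6,0,3]), (4,[7,8,1,10,0,6,4,2,5,9,3]), (3,[4,5,10,2,3,6,7,9,1,0,8]),
     (4,[4,0,7,6,1,3,8,10,5,9,2]), (2,[9,10,8,2,7,6,5,3,1,0,4]), (4,[4,2,9,8,10,3,6,1,5,0,7]),
     (6,[4,5,10,2,8,3,0,9,6,7,1]), (0,[3,10,5,2,6,8,7,4,0,1,9]), (7,[10,0,7,3,8,2,5,1,4,9,6]),
     (0,[10,6,0,2,9,7,1,8,3,5,4]), (6,[2,1,5,7,9,10,3,6,4,0,8])]"]) code_simp

text \<open>Two copies of K33 lacking the edges 8-9 and 10-11, with the ends of the missing edges
  joined in a 4-cycle. Contracting an edge of this cycle restores a missing edge.\<close>

definition graph_23 :: "nat \<times> (nat \<times> nat) list" where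
  "graph_23 = (12,
    [(0,1), (0,2), (0,8), (1,3), (1,9), (2,3), (2,9), (3,8), (4,5), (4,6), (4,10), (5,7), (5,11),
     (6,7), (6,11), (7,10), (8,10), (8,11), (9,10), (9,11)])"

lemma MMNA_graph_23: "MMNA (case_prod list_graph graph_23)"
  by (rule MMNA_certified[of graph_23
    "[([(8,10)],[4,7,11,5,6,8]), ([(8,10)],[4,7,11,5,6,8]), ([(9,10)],[4,7,11,5,6,9]),
     ([(8,10)],[4,7,11,5,6,8]), ([(9,11)],[0,3,9,1,2,8]), ([(8,10)],[0,3,9,1,2,8]),
     ([(9,11)],[0,3,9,1,2,8]), ([(9,11)],[0,3,9,1,2,8]), ([(9,10)],[4,7,11,5,6,9]),
     ([(8,10)],[4,7,11,5,6,8]), ([(8,11)],[0,3,9,1,2,8]), ([(8,10)],[0,3,9,1,2,8])]"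
    "[(4,[3,0,2,10,1,5,6,8,7,11,9,4]), (4,[7,6,4,5,10,11,9,1,8,3,2,0]),
     (4,[11,0,1,10,8,7,6,4,5,2,3,9]), (4,[2,4,1,0,8,6,10,7,11,3,9,5]),
     (4,[1,3,5,4,6,9,10,11,2,8,0,7]), (4,[7,3,6,4,10,0,11,9,2,5,8,1]),
     (4,[9,11,10,8,7,4,5,3,6,1,2,0]), (4,[4,3,11,0,1,8,7,6,10,2,5,9]),
     (0,[9,0,1,6,4,10,3,8,5,11,2,7]), (0,[0,8,5,7,3,1,11,2,10,4,6,9]),
     (0,[10,8,7,9,3,1,2,4,6,11,5,0]), (0,[8,2,3,4,7,6,9,10,0,1,11,5]),
     (0,[8,3,0,2,9,7,6,10,5,1,11,4]), (0,[8,11,3,1,9,6,7,5,0,2,4,10]),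
     (0,[6,8,7,4,11,0,1,2,5,9,3,10]), (0,[3,10,9,11,5,6,2,1,4,8,7,0]),
     (9,[6,7,8,5,11,2,0,9,3,4,10,1]), (9,[0,6,8,5,3,9,2,11,4,7,1,10]),
     (8,[6,7,3,4,10,1,9,11,5,8,0,2]), (8,[5,4,7,6,3,10,8,11,1,2,0,9])]"
    "[(4,[5,9,0,11,3,2,8,7,10,4,1,6]), (4,[0,4,1,3,11,7,6,9,2,8,10,5]),
     (4,[6,7,11,10,9,1,5,3,4,8,2,0]), (4,[0,3,1,8,2,9,6,5,11,4,10,7]),
     (4,[7,8,9,10,0,5,4,2,11,3,1,6]), (4,[10,9,11,4,2,5,3,6,1,8,0,7]),
     (4,[11,1,2,10,0,7,6,4,3,8,5,9]), (4,[4,10,3,7,5,0,1,8,6,11,9,2]),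
     (0,[9,3,5,0,7,2,10,8,11,4,1,6]), (0,[8,9,5,6,1,3,0,2,7,10,11,4]),
     (0,[10,6,1,0,2,9,3,8,11,4,5,7]), (0,[11,2,1,4,8,7,9,3,5,10,0,6]),
     (0,[11,2,5,4,7,8,0,10,6,9,1,3]), (0,[3,8,4,7,10,0,11,1,5,9,6,2]),
     (0,[5,7,2,6,9,10,4,11,8,1,0,3]), (0,[2,3,11,1,5,6,9,7,0,10,8,4]),
     (8,[1,5,2,3,10,0,8,7,6,4,9,11]), (8,[1,10,11,9,7,8,6,4,5,2,3,0]),
     (9,[11,0,1,10,5,9,6,8,4,7,2,3]), (9,[8,1,0,3,6,11,5,4,2,9,7,10])]"]) code_simp

text \<open>The triangular prism on 0 to 5 together with two nonadjacent vertices 6 and 7 joined to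
  all of it.\<close>

definition graph_24 :: "nat \<times> (nat \<times> nat) list" where
  "graph_24 = (8,
    [(0,1), (0,2), (0,3), (0,6), (0,7), (1,2), (1,4), (1,6), (1,7), (2,5), (2,6), (2,7), (3,4),
     (3,5), (3,6), (3,7), (4,5), (4,6), (4,7), (5,6), (5,7)])"

lemma MMNA_graph_24: "MMNA (case_prod list_graph graph_24)"
  by (rule MMNA_certified[of graph_24
    "[([],[1,3,5,4,6,7]), ([],[0,4,5,3,6,7]), ([],[1,3,5,4,6,7]), ([],[0,2,4,1,6,7]),
     ([],[0,6,7,1,2,3]), ([],[0,2,4,1,6,7]), ([(0,2)],[0,4,7,1,3,5]), ([(0,3)],[0,2,4,1,5,6])]"
    "[(5,[4,2,3,6,7,0,5,1]), (4,[2,6,5,1,7,4,3,0]), (6,[4,2,5,7,0,1,3,6]), (3,[1,3,2,6,5,7,4,0]),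
     (3,[3,4,2,7,0,6,5,1]), (3,[2,0,3,6,5,4,1,7]), (6,[5,4,2,7,0,1,3,6]), (4,[7,6,4,2,5,1,3,0]),
     (4,[5,4,6,1,3,0,2,7]), (6,[5,0,6,2,1,3,7,4]), (5,[4,2,3,7,0,6,1,5]), (5,[7,5,6,1,3,2,0,4]),
     (2,[7,6,5,1,3,2,0,4]), (1,[7,6,3,5,1,2,0,4]), (0,[7,0,3,5,1,4,2,6]), (0,[2,7,6,3,4,1,0,5]),
     (0,[0,5,4,7,1,3,6,2]), (1,[3,0,2,6,7,5,4,1]), (1,[1,6,4,0,7,3,5,2]), (2,[4,1,5,3,0,7,2,6]),
     (2,[6,0,4,5,3,2,1,7])]"
    "[(3,[6,5,4,2,1,0,7,3]), (3,[0,5,4,3,6,1,7,2]), (0,[2,3,0,5,4,6,1,7]), (0,[3,7,0,2,6,5,4,1]),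
     (0,[5,3,7,1,4,0,2,6]), (4,[7,1,4,6,3,2,5,0]), (1,[7,3,1,6,5,2,4,0]), (1,[7,5,6,1,2,0,4,3]),
     (1,[0,6,7,3,4,5,1,2]), (2,[1,2,4,6,5,0,7,3]), (2,[6,7,1,3,2,4,0,5]), (2,[2,1,5,7,0,4,3,6]),
     (0,[1,5,0,4,6,2,7,3]), (0,[4,7,2,5,6,0,3,1]), (1,[1,3,7,2,4,6,5,0]), (1,[5,1,7,6,2,0,4,3]),
     (1,[4,7,6,2,0,3,1,5]), (0,[7,5,4,1,6,3,0,2]), (0,[4,1,3,6,5,7,0,2]), (0,[7,4,5,2,1,0,6,3]),
     (0,[0,7,4,2,1,3,6,5])]"]) code_simp

text \<open>The same prism construction with one triangle of the prism replaced by a claw centred at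
  0.\<close>

definition graph_25 :: "nat \<times> (nat \<times> nat) list" where
  "graph_25 = (9,
    [(0,1), (0,2), (0,3), (1,4), (1,7), (1,8), (2,5), (2,7), (2,8), (3,6), (3,7), (3,8), (4,5),
     (4,6), (4,7), (4,8), (5,6), (5,7), (5,8), (6,7), (6,8)])"

lemma MMNA_graph_25: "MMNA (case_prod list_graph graph_25)"
  by (rule MMNA_certified[of graph_25
    "[([],[1,5,6,4,7,8]), ([],[2,4,6,5,7,8]), ([],[1,5,6,4,7,8]), ([],[1,5,6,4,7,8]),
     ([],[0,7,8,1,2,3]), ([],[0,7,8,1,2,3]), ([],[0,7,8,1,2,3]), ([(2,5), (1,4)],[0,6,8,1,2,3]),
     ([(4,6), (4,5)],[0,4,7,1,2,3])]"
    "[(5,[3,5,4,8,6,2,0,1,7]), (4,[3,2,1,6,5,0,7,4,8]), (4,[5,8,4,0,6,2,1,3,7]),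
     (7,[3,4,1,2,6,7,8,0,5]), (4,[0,8,1,7,6,3,5,4,2]), (4,[3,2,0,4,5,8,6,1,7]),
     (7,[1,0,8,7,2,3,5,4,6]), (5,[4,2,3,8,6,0,7,1,5]), (5,[5,3,7,6,2,8,1,0,4]),
     (7,[5,6,1,3,7,0,8,4,2]), (6,[3,2,1,4,7,6,0,8,5]), (6,[7,0,1,8,3,4,5,6,2]),
     (3,[4,3,6,5,1,7,0,8,2]), (2,[1,0,8,6,3,4,5,7,2]), (1,[1,8,2,4,7,6,5,3,0]),
     (1,[5,8,3,4,1,7,0,2,6]), (1,[4,7,6,5,1,2,0,3,8]), (2,[2,4,0,3,7,8,6,5,1]),
     (2,[3,2,8,4,0,7,6,1,5]), (3,[1,3,2,6,8,5,7,4,0]), (3,[0,1,8,6,4,3,5,7,2])]"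
    "[(4,[0,5,2,8,3,4,6,1,7]), (5,[8,4,3,0,5,7,1,2,6]), (6,[5,3,7,2,1,0,6,8,4]),
     (1,[0,7,8,1,6,4,2,3,5]), (1,[8,6,7,4,1,5,2,3,0]), (1,[7,2,4,6,0,1,8,5,3]),
     (2,[1,3,8,7,4,2,6,5,0]), (2,[8,0,3,5,7,2,4,6,1]), (2,[7,1,8,5,2,3,0,4,6]),
     (3,[1,8,0,3,5,4,6,2,7]), (3,[3,8,6,5,0,2,1,4,7]), (3,[7,8,1,6,5,3,4,0,2]),
     (1,[2,4,3,5,8,0,7,6,1]), (1,[4,8,2,3,0,6,7,5,1]), (0,[7,4,8,3,5,6,2,0,1]),
     (0,[8,6,2,7,1,3,0,5,4]), (2,[7,5,6,2,4,1,0,8,3]), (0,[3,0,2,4,8,5,7,6,1]),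
     (0,[6,8,1,3,5,7,4,2,0]), (0,[0,6,3,4,1,2,5,7,8]), (0,[5,2,8,1,6,7,3,0,4])]"]) code_simp

definition graph_26 :: "nat \<times> (nat \<times> nat) list" where
  "graph_26 = (10,
    [(0,2), (0,3), (0,4), (1,2), (1,3), (1,4), (2,6), (2,7), (3,6), (3,7), (4,8), (4,9), (5,6),
     (5,7), (5,8), (5,9), (6,8), (6,9), (7,8), (7,9), (8,9)])"

lemma MMNA_graph_26: "MMNA (case_prod list_graph graph_26)"
  by (rule MMNA_certified[of graph_26
    "[([(3,7)],[3,5,6,8,9]), ([(4,9)],[0,6,7,2,3,4]), ([(1,4)],[1,6,7,3,8,9]),
     ([(2,6)],[2,5,7,8,9]), ([(2,6)],[2,5,7,8,9]), ([(1,4)],[1,6,7,3,8,9]), ([(4,8)],[0,1,7,2,3,4]),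
     ([(6,9)],[0,1,6,2,3,4]), ([(6,9)],[0,1,6,2,3,4]), ([(7,8)],[0,1,7,2,3,4])]"
    "[(6,[9,0,1,7,6,3,8,2,5,4]), (6,[9,6,7,5,8,3,0,2,4,1]), (6,[3,4,1,2,0,6,8,7,9,5]),
     (6,[8,4,6,5,9,2,7,1,0,3]), (6,[1,7,8,9,2,5,3,0,4,6]), (6,[1,4,2,5,7,9,3,6,0,8]),
     (3,[5,7,8,3,6,1,2,0,9,4]), (3,[9,1,7,8,0,4,5,3,2,6]), (2,[7,8,0,9,6,2,3,5,4,1]),
     (2,[3,2,7,4,5,0,1,9,8,6]), (9,[0,7,1,4,8,5,3,6,2,9]), (8,[9,1,2,7,8,4,3,5,0,6]),
     (4,[9,8,0,4,2,6,3,7,1,5]), (4,[9,0,8,7,5,4,6,1,2,3]), (4,[0,1,9,8,7,5,6,2,3,4]),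
     (4,[9,8,7,0,1,4,3,6,5,2]), (4,[9,8,5,0,7,4,1,6,3,2]), (4,[0,9,4,1,6,5,3,8,2,7]),
     (4,[1,2,0,3,6,4,8,9,7,5]), (4,[3,5,2,1,4,9,6,0,8,7]), (4,[4,3,1,5,7,8,2,0,6,9])]"
    "[(6,[5,3,6,4,7,9,0,8,1,2]), (6,[5,7,6,2,8,1,4,3,9,0]), (6,[1,8,9,7,3,4,6,5,2,0]),
     (6,[0,5,2,9,1,7,4,6,8,3]), (6,[3,5,2,4,7,9,0,6,1,8]), (6,[6,7,3,2,4,0,5,1,9,8]),
     (2,[8,7,2,1,9,4,5,3,0,6]), (2,[0,1,5,2,9,6,4,3,7,8]), (3,[7,9,8,5,0,4,1,2,3,6]),
     (3,[2,7,3,6,4,9,1,5,0,8]), (4,[1,3,2,0,5,6,9,4,8,7]), (4,[6,7,3,1,4,0,2,8,9,5]),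
     (4,[6,8,7,1,0,5,4,9,2,3]), (4,[0,8,4,2,1,3,7,9,5,6]), (4,[9,6,0,7,4,1,8,5,3,2]),
     (4,[1,0,4,2,8,5,7,3,6,9]), (2,[8,1,5,0,3,6,2,7,9,4]), (2,[7,8,3,6,4,1,9,0,2,5]),
     (2,[5,3,0,6,2,9,7,8,4,1]), (2,[1,7,9,8,2,4,0,6,3,5]), (2,[4,8,3,1,6,0,2,9,7,5])]"]) code_simp

definition graph_27 :: "nat \<times> (nat \<times> nat) list" where
  "graph_27 = (10,
    [(0,2), (0,3), (0,4), (1,2), (1,3), (1,4), (2,7), (2,9), (3,7), (3,9), (4,8), (4,9), (5,6),
     (5,7), (5,8), (5,9), (6,7), (6,8), (6,9), (7,8), (8,9)])"

lemma MMNA_graph_27: "MMNA (case_prod list_graph graph_27)"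
  by (rule MMNA_certified[of graph_27
    "[([(2,9)],[2,5,6,7,8]), ([(2,9)],[2,5,6,7,8]), ([(3,7)],[3,5,6,8,9]), ([(2,7)],[2,5,6,8,9]),
     ([(3,7)],[3,5,6,8,9]), ([],[0,1,9,2,3,4]), ([],[0,1,9,2,3,4]), ([],[0,1,9,2,3,4]),
     ([],[0,1,9,2,3,4]), ([(7,8)],[0,1,7,2,3,4])]"
    "[(7,[8,7,5,9,3,2,1,6,0,4]), (7,[9,1,0,2,8,5,7,4,6,3]), (7,[3,0,2,4,6,7,8,5,9,1]),
     (7,[3,6,2,1,4,7,9,8,5,0]), (7,[7,9,8,2,6,3,4,0,5,1]), (7,[1,3,5,4,6,9,7,8,0,2]),
     (3,[5,8,4,0,7,1,3,2,6,9]), (7,[2,0,1,5,3,7,8,6,4,9]), (2,[0,7,8,9,1,3,6,4,5,2]),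
     (7,[5,4,9,6,7,2,1,0,3,8]), (9,[0,1,3,9,2,4,8,5,7,6]), (8,[5,7,0,4,6,2,1,9,8,3]),
     (4,[2,1,3,6,9,4,7,0,8,5]), (2,[7,5,1,9,6,3,2,0,8,4]), (2,[6,5,1,4,7,0,9,3,8,2]),
     (2,[8,5,9,6,7,1,2,3,0,4]), (2,[4,2,5,3,6,8,0,7,9,1]), (2,[4,5,9,3,6,8,0,1,7,2]),
     (2,[9,2,0,5,1,4,7,6,8,3]), (4,[6,0,5,9,4,8,3,7,2,1]), (4,[7,3,5,6,4,9,0,2,1,8])]"
    "[(7,[9,7,4,6,0,2,3,8,5,1]), (7,[4,1,3,5,0,8,9,7,2,6]), (7,[9,2,8,1,0,6,7,3,5,4]),
     (7,[7,1,3,9,6,8,4,0,5,2]), (7,[3,1,4,2,0,7,8,6,9,5]), (7,[7,6,1,9,0,4,3,8,5,2]),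
     (2,[3,4,0,9,1,6,5,2,7,8]), (2,[4,3,8,5,1,7,2,6,0,9]), (3,[8,3,5,6,7,0,9,4,1,2]),
     (3,[9,6,7,3,8,2,1,5,4,0]), (4,[8,3,0,4,9,1,5,2,7,6]), (4,[5,8,4,6,3,2,1,7,9,0]),
     (2,[8,6,0,5,7,2,9,4,3,1]), (2,[5,2,7,1,3,6,8,9,4,0]), (2,[1,6,3,8,2,4,9,0,7,5]),
     (2,[4,8,7,6,5,9,1,3,0,2]), (2,[6,7,0,5,8,3,2,1,9,4]), (2,[1,0,9,3,2,7,5,4,6,8]),
     (2,[9,7,4,1,8,5,6,2,0,3]), (2,[1,9,0,2,6,5,4,3,8,7]), (0,[0,7,6,2,5,9,1,8,3,4])]"]) code_simp

text \<open>K34 with sides {2,3,4} and {0,1,8,9}, glued along 8 and 9 to a K5 that lacks the edge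
  between them.\<close>

definition graph_28 :: "nat \<times> (nat \<times> nat) list" where
  "graph_28 = (10,
    [(0,2), (0,3), (0,4), (1,2), (1,3), (1,4), (2,8), (2,9), (3,8), (3,9), (4,8), (4,9), (5,6),
     (5,7), (5,8), (5,9), (6,7), (6,8), (6,9), (7,8), (7,9)])"

lemma MMNA_graph_28: "MMNA (case_prod list_graph graph_28)"
  by (rule MMNA_certified[of graph_28
    "[([],[1,8,9,2,3,4]), ([],[0,8,9,2,3,4]), ([(3,9)],[3,5,6,7,8]), ([(4,9)],[4,5,6,7,8]),
     ([(3,8)],[3,5,6,7,9]), ([],[0,1,8,2,3,4]), ([],[0,8,9,2,3,4]), ([],[1,8,9,2,3,4]),
     ([],[0,1,9,2,3,4]), ([],[0,1,8,2,3,4])]"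
    "[(8,[7,6,9,5,8,1,4,0,3,2]), (8,[8,3,7,0,2,6,4,5,1,9]), (8,[0,3,2,9,5,8,6,7,1,4]),
     (8,[2,0,4,3,1,8,6,9,7,5]), (8,[1,2,0,9,3,7,6,8,4,5]), (8,[6,1,2,9,8,4,3,5,7,0]),
     (9,[3,5,4,1,0,6,7,8,9,2]), (8,[8,1,0,9,7,3,2,4,5,6]), (9,[0,8,2,1,6,4,7,5,3,9]),
     (8,[5,3,0,2,4,8,7,6,1,9]), (9,[0,8,4,7,6,2,3,1,9,5]), (8,[2,3,4,0,1,8,6,9,7,5]),
     (2,[0,9,6,7,1,5,3,4,8,2]), (2,[8,7,5,9,3,0,1,4,2,6]), (2,[1,3,7,0,2,8,5,6,4,9]),
     (2,[3,6,9,4,5,1,0,8,2,7]), (2,[7,8,4,6,0,2,5,1,3,9]), (2,[1,3,4,2,0,8,6,7,9,5]),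
     (2,[8,7,9,0,3,1,5,4,6,2]), (2,[0,9,5,7,1,3,6,4,2,8]), (2,[6,7,9,0,5,1,3,2,8,4])]"
    "[(8,[1,7,8,3,0,5,6,9,2,4]), (8,[8,7,2,5,9,4,3,6,1,0]), (8,[0,6,2,8,9,4,3,5,1,7]),
     (8,[3,5,1,4,7,6,8,9,0,2]), (8,[2,6,7,3,5,1,4,0,8,9]), (8,[0,8,1,2,5,4,6,7,9,3]),
     (2,[0,5,8,9,7,4,3,2,6,1]), (2,[9,8,6,0,5,2,7,1,3,4]), (3,[2,4,3,0,6,7,8,5,9,1]),
     (3,[7,0,1,3,8,9,4,2,5,6]), (4,[2,9,1,8,7,0,6,4,5,3]), (4,[8,5,7,4,6,3,2,1,9,0]),
     (2,[3,2,0,4,1,9,8,7,6,5]), (2,[4,9,1,8,3,7,6,2,5,0]), (2,[6,4,5,7,2,8,1,0,9,3]),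
     (2,[7,9,8,1,6,0,5,3,2,4]), (2,[0,4,7,3,9,6,2,8,5,1]), (2,[4,6,7,5,8,0,2,1,3,9]),
     (2,[5,3,1,7,6,0,8,9,2,4]), (2,[9,1,7,8,3,5,6,4,0,2]), (2,[0,8,7,5,9,4,2,1,6,3])]"]) code_simp

text \<open>K33 and K34 glued along two vertices, 9 and 10, that lie on a common side in
  both.\<close>

definition graph_29 :: "nat \<times> (nat \<times> nat) list" where
  "graph_29 = (11,
    [(0,1), (0,2), (0,3), (1,9), (1,10), (2,9), (2,10), (3,9), (3,10), (4,6), (4,7), (4,8), (5,6),
     (5,7), (5,8), (6,9), (6,10), (7,9), (7,10), (8,9), (8,10)])"

lemma MMNA_graph_29: "MMNA (case_prod list_graph graph_29)"
  by (rule MMNA_certified[of graph_29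
    "[([],[5,9,10,6,7,8]), ([],[4,5,9,6,7,8]), ([],[4,5,10,6,7,8]), ([],[4,5,10,6,7,8]),
     ([],[0,9,10,1,2,3]), ([],[0,9,10,1,2,3]), ([],[0,9,10,1,2,3]), ([],[0,9,10,1,2,3]),
     ([],[0,9,10,1,2,3]), ([],[4,5,10,6,7,8]), ([],[4,5,9,6,7,8])]"
    "[(6,[0,5,1,4,9,7,3,6,8,10,2]), (6,[6,7,8,4,10,1,3,2,0,9,5]), (6,[0,9,1,8,3,6,5,4,7,2,10]),
     (6,[3,4,2,1,9,6,8,10,7,0,5]), (6,[0,10,1,2,6,8,5,4,7,9,3]), (6,[3,4,2,1,7,6,8,9,0,10,5]),
     (6,[1,3,2,7,5,10,9,4,8,0,6]), (6,[8,9,7,0,5,3,10,4,2,6,1]), (6,[1,3,10,2,5,6,7,4,9,0,8]),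
     (9,[9,8,10,1,2,5,4,3,6,0,7]), (9,[2,1,6,0,9,4,8,7,3,5,10]), (9,[5,2,4,3,7,0,6,9,10,8,1]),
     (9,[7,9,10,4,5,1,3,8,2,6,0]), (9,[10,8,7,6,2,1,4,3,9,0,5]), (9,[4,5,6,1,10,7,0,8,9,2,3]),
     (10,[3,1,5,2,9,10,8,7,6,0,4]), (9,[5,4,8,6,2,7,0,10,1,9,3]), (10,[9,7,10,6,3,1,5,2,4,0,8]),
     (9,[2,1,3,10,8,9,5,7,4,6,0]), (10,[10,3,5,4,1,8,6,0,7,2,9]), (9,[1,10,3,4,6,0,9,2,7,8,5])]"
    "[(6,[4,0,3,6,9,8,10,2,7,1,5]), (6,[7,10,0,8,2,3,6,4,1,9,5]), (6,[5,6,3,0,9,10,7,8,2,4,1]),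
     (6,[4,5,0,3,7,6,10,8,9,1,2]), (6,[7,4,5,8,2,3,1,10,9,6,0]), (6,[5,8,4,7,0,3,9,1,2,6,10]),
     (6,[5,9,4,7,0,2,1,3,10,8,6]), (6,[1,9,0,2,6,3,8,4,7,5,10]), (6,[8,10,6,5,3,4,0,1,2,9,7]),
     (9,[1,0,2,7,5,9,8,10,6,4,3]), (9,[6,0,7,5,3,10,9,1,2,8,4]), (9,[3,5,1,4,7,8,6,9,0,2,10]),
     (9,[2,3,4,5,0,8,6,9,7,10,1]), (9,[8,0,6,7,10,2,1,9,4,3,5]), (9,[2,0,1,3,8,6,10,7,9,5,4]),
     (6,[2,9,1,0,7,6,5,8,4,3,10]), (6,[0,5,2,3,9,7,1,10,6,4,8]), (7,[8,9,0,6,5,3,2,10,4,7,1]),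
     (7,[4,5,3,2,8,0,10,9,1,7,6]), (8,[2,8,6,3,1,10,0,9,4,7,5]), (8,[4,0,10,1,3,8,6,2,7,9,5])]"]) code_simp

text \<open>K33 without 4-5 and K5 without 9-10, with the ends of the missing edges joined in a
  4-cycle.\<close>

definition graph_30 :: "nat \<times> (nat \<times> nat) list" where
  "graph_30 = (11,
    [(0,1), (0,2), (0,4), (1,3), (1,5), (2,3), (2,5), (3,4), (4,9), (4,10), (5,9), (5,10), (6,7),
     (6,8), (6,9), (6,10), (7,8), (7,9), (7,10), (8,9), (8,10)])"

lemma MMNA_graph_30: "MMNA (case_prod list_graph graph_30)"
  by (rule MMNA_certified[of graph_30
    "[([(4,10)],[4,6,7,8,9]), ([(5,9)],[5,6,7,8,10]), ([(5,9)],[5,6,7,8,10]),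
     ([(4,9)],[4,6,7,8,10]), ([(5,9)],[5,6,7,8,10]), ([(4,10)],[4,6,7,8,9]),
     ([(5,9)],[0,3,5,1,2,4]), ([(5,9)],[0,3,5,1,2,4]), ([(5,9)],[0,3,5,1,2,4]),
     ([(5,10)],[0,3,5,1,2,4]), ([(5,9)],[0,3,5,1,2,4])]"
    "[(6,[0,8,9,6,2,10,7,4,3,1,5]), (6,[10,7,1,0,8,2,9,5,4,3,6]), (6,[0,2,10,3,9,1,6,5,7,4,8]),
     (6,[4,3,6,7,5,10,9,0,1,2,8]), (6,[7,8,6,9,2,5,10,4,1,3,0]), (6,[10,3,2,4,9,1,0,7,6,8,5]),
     (6,[4,3,5,6,7,8,1,0,10,9,2]), (6,[2,1,4,3,6,0,9,8,7,10,5]), (5,[10,8,0,9,7,1,4,3,6,5,2]),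
     (5,[5,6,4,7,10,8,0,9,2,3,1]), (4,[10,7,0,9,2,6,5,3,8,4,1]), (4,[4,5,0,3,1,10,9,7,2,6,8]),
     (0,[5,3,4,2,1,7,0,8,9,10,6]), (0,[4,9,1,0,2,10,7,6,5,3,8]), (0,[1,4,6,7,3,5,0,9,10,8,2]),
     (0,[1,8,6,10,0,7,3,2,4,9,5]), (0,[6,3,1,0,5,2,8,9,7,10,4]), (0,[0,1,10,8,7,2,3,5,6,9,4]),
     (0,[5,7,4,2,1,6,9,10,0,3,8]), (0,[5,9,8,10,0,7,3,4,2,6,1]), (0,[5,6,3,7,8,4,10,1,0,9,2])]"
    "[(6,[2,10,3,1,8,4,9,5,6,7,0]), (6,[7,3,8,6,9,2,4,0,10,5,1]), (6,[7,1,10,0,3,4,2,5,8,9,6]),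
     (6,[4,6,7,0,3,8,5,10,1,2,9]), (6,[10,9,6,7,5,4,3,1,2,0,8]), (6,[10,0,1,4,8,2,6,5,7,9,3]),
     (6,[3,2,1,5,8,4,6,9,0,10,7]), (6,[3,4,2,7,5,6,0,9,10,8,1]), (4,[4,0,3,2,5,6,10,8,9,7,1]),
     (4,[8,7,9,6,4,5,0,1,3,10,2]), (5,[8,7,6,4,1,5,10,2,9,3,0]), (5,[9,3,10,2,5,4,0,7,8,6,1]),
     (0,[0,1,8,6,2,9,3,7,4,10,5]), (0,[10,1,5,4,2,6,7,8,9,0,3]), (0,[1,7,10,0,6,9,3,5,4,2,8]),
     (0,[1,4,6,7,3,5,8,9,10,2,0]), (0,[9,6,8,10,0,7,4,3,1,2,5]), (0,[1,8,5,7,6,3,0,9,10,4,2]),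
     (0,[7,10,8,6,1,0,3,5,4,2,9]), (0,[8,7,10,9,0,5,4,2,1,3,6]), (0,[2,0,1,4,6,10,9,8,7,5,3])]"]) code_simp

definition graph_31 :: "nat \<times> (nat \<times> nat) list" where
  "graph_31 = (11,
    [(0,1), (0,2), (0,8), (1,9), (1,10), (2,9), (2,10), (3,5), (3,6), (3,7), (4,5), (4,6), (4,7),
     (5,8), (5,10), (6,9), (6,10), (7,9), (7,10), (8,9), (8,10)])"

lemma MMNA_graph_31: "MMNA (case_prod list_graph graph_31)"
  by (rule MMNA_certified[of graph_31
    "[([],[3,4,10,5,6,7]), ([],[3,4,10,5,6,7]), ([],[3,4,10,5,6,7]), ([],[0,9,10,1,2,8]),
     ([],[0,9,10,1,2,8]), ([],[0,9,10,1,2,8]), ([],[0,9,10,1,2,8]), ([],[0,9,10,1,2,8]),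
     ([],[3,4,10,5,6,7]), ([],[3,4,10,5,6,7]), ([(5,8)],[3,4,9,5,6,7])]"
    "[(5,[8,10,5,2,1,6,3,0,7,4,9]), (5,[0,1,3,5,8,7,4,6,10,9,2]), (5,[7,8,5,2,0,9,1,3,4,10,6]),
     (5,[3,4,6,9,10,5,8,7,1,0,2]), (5,[1,10,9,7,6,2,8,5,3,0,4]), (5,[0,9,10,4,3,8,2,6,1,5,7]),
     (5,[1,8,0,5,4,9,3,6,10,2,7]), (8,[9,5,8,3,2,1,4,7,10,6,0]), (8,[10,0,8,3,4,2,1,5,7,9,6]),
     (8,[3,4,5,8,7,0,10,1,9,6,2]), (8,[3,2,4,8,6,0,10,7,9,5,1]), (8,[8,10,7,5,1,2,4,0,3,6,9]),
     (8,[7,8,2,0,4,5,3,10,9,1,6]), (10,[0,2,9,4,6,5,1,7,10,8,3]), (8,[9,10,7,2,1,4,6,5,3,0,8]),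
     (10,[3,5,6,1,10,8,0,2,7,4,9]), (9,[9,5,10,6,3,1,2,4,8,7,0]), (10,[5,8,7,2,4,0,6,3,10,9,1]),
     (9,[5,6,4,1,0,8,2,9,3,10,7]), (5,[1,2,10,4,6,0,5,7,9,3,8]), (5,[1,2,9,6,7,5,4,3,10,0,8])]"
    "[(5,[10,4,8,5,6,0,7,3,1,2,9]), (5,[6,2,4,0,10,7,9,3,8,1,5]), (5,[2,10,3,5,6,0,4,8,7,9,1]),
     (5,[10,3,1,6,4,2,7,5,8,9,0]), (5,[0,3,4,8,9,6,5,7,1,10,2]), (5,[6,3,4,0,9,10,8,1,5,2,7]),
     (5,[0,1,10,4,6,7,8,5,9,2,3]), (8,[6,8,5,0,1,9,4,2,7,3,10]), (8,[4,5,3,0,9,10,8,2,1,6,7]),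
     (8,[2,0,1,5,8,9,7,4,6,3,10]), (8,[4,1,5,9,8,0,10,6,2,3,7]), (8,[1,2,5,8,7,10,3,9,4,6,0]),
     (8,[4,5,1,8,0,7,10,2,9,3,6]), (5,[7,8,6,2,0,1,3,4,9,5,10]), (5,[8,6,5,9,2,1,3,0,10,4,7]),
     (6,[3,5,4,2,8,7,1,9,6,0,10]), (6,[7,9,2,1,5,3,8,4,6,0,10]), (7,[9,8,10,1,6,5,2,3,7,4,0]),
     (7,[7,6,8,2,0,10,9,5,1,4,3]), (5,[0,10,1,8,4,2,7,6,9,5,3]), (3,[4,1,3,10,8,7,9,6,2,5,0])]"]) code_simp

definition graph_32 :: "nat \<times> (nat \<times> nat) list" where
  "graph_32 = (11,
    [(0,1), (0,3), (0,5), (1,4), (1,10), (2,6), (2,7), (2,8), (3,4), (3,6), (3,9), (4,5), (4,7),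
     (5,8), (5,10), (6,9), (6,10), (7,9), (7,10), (8,9), (8,10)])"

lemma MMNA_graph_32: "MMNA (case_prod list_graph graph_32)"
  by (rule MMNA_certified[of graph_32
    "[([],[2,9,10,6,7,8]), ([],[2,9,10,6,7,8]), ([(3,6)],[0,4,10,1,3,5]), ([],[2,9,10,6,7,8]),
     ([],[2,9,10,6,7,8]), ([],[2,9,10,6,7,8]), ([(3,9), (3,8)],[0,4,10,1,3,5]),
     ([(3,6)],[0,4,10,1,3,5]), ([(6,10)],[0,4,6,1,3,5]), ([(3,6)],[0,4,10,1,3,5]), ([(4,5),
     (2,6)],[2,4,9,3,7,8])]"
    "[(6,[8,5,0,2,3,6,9,1,7,10,4]), (6,[4,5,10,2,1,3,8,0,7,9,6]), (7,[2,1,5,0,3,8,6,10,7,9,4]),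
     (7,[9,7,0,6,4,3,1,8,2,5,10]), (6,[6,5,10,3,7,4,1,9,2,8,0]), (3,[5,8,2,6,4,7,10,3,1,0,9]),
     (3,[7,8,2,1,6,5,0,10,4,3,9]), (3,[8,7,0,9,6,4,2,1,3,5,10]), (7,[1,8,4,9,7,6,10,2,3,0,5]),
     (9,[0,10,7,1,2,9,4,3,8,6,5]), (6,[7,5,1,4,3,8,6,0,9,2,10]), (6,[1,7,4,10,8,6,3,9,2,0,5]),
     (10,[6,4,8,2,5,7,1,10,9,0,3]), (10,[0,9,2,8,10,1,6,3,5,4,7]), (8,[6,5,1,10,7,8,2,4,9,0,3]),
     (3,[1,0,5,9,10,3,7,8,6,4,2]), (3,[9,7,3,2,6,10,4,1,0,5,8]), (3,[5,3,10,4,2,1,9,0,8,7,6]),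
     (4,[6,5,8,10,2,4,9,1,3,0,7]), (3,[3,5,9,4,2,6,10,1,7,0,8]), (5,[5,7,3,6,8,1,2,9,0,10,4])]"
    "[(7,[2,10,0,7,4,3,8,6,5,9,1]), (7,[9,8,3,2,7,5,1,6,0,10,4]), (6,[8,10,1,6,9,4,7,2,5,3,0]),
     (6,[4,3,10,5,0,6,7,2,9,8,1]), (8,[6,2,3,7,0,10,5,1,8,4,9]), (3,[3,1,7,2,0,4,10,8,6,9,5]),
     (3,[6,5,3,10,4,7,0,1,8,2,9]), (3,[9,10,6,2,8,0,3,7,4,5,1]), (6,[6,8,10,5,1,7,4,2,0,3,9]),
     (3,[2,10,8,1,4,3,5,9,7,6,0]), (3,[6,5,8,2,7,9,0,4,10,3,1]), (7,[8,0,3,7,10,6,5,9,2,4,1]),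
     (4,[10,6,3,9,1,5,8,2,4,0,7]), (5,[6,7,1,3,8,9,4,10,0,2,5]), (2,[2,0,4,3,10,8,7,9,6,5,1]),
     (3,[1,10,6,0,9,5,7,8,4,2,3]), (4,[6,5,2,8,10,9,4,3,0,1,7]), (3,[9,7,4,10,6,0,3,5,1,8,2]),
     (3,[7,8,3,10,9,6,1,5,2,0,4]), (3,[9,5,1,8,7,10,2,0,3,6,4]), (3,[5,6,8,3,4,2,10,9,7,1,0])]"]) code_simp

definition graph_33 :: "nat \<times> (nat \<times> nat) list" where
  "graph_33 = (11,
    [(0,1), (0,8), (0,9), (1,7), (1,10), (2,4), (2,5), (2,6), (3,4), (3,5), (3,6), (4,7), (4,10),
     (5,8), (5,10), (6,9), (6,10), (7,8), (7,9), (8,10), (9,10)])"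

lemma MMNA_graph_33: "MMNA (case_prod list_graph graph_33)"
  by (rule MMNA_certified[of graph_33
    "[([],[2,3,10,4,5,6]), ([],[2,3,10,4,5,6]), ([],[0,7,10,1,8,9]), ([],[0,7,10,1,8,9]),
     ([],[0,7,10,1,8,9]), ([],[0,7,10,1,8,9]), ([],[0,7,10,1,8,9]), ([],[2,3,10,4,5,6]),
     ([],[2,3,10,4,5,6]), ([],[2,3,10,4,5,6]), ([(7,8), (7,9)],[2,3,7,4,5,6])]"
    "[(4,[5,8,2,1,0,10,3,7,4,6,9]), (4,[0,1,6,7,5,8,4,2,3,10,9]), (4,[8,9,6,5,1,4,2,0,3,10,7]),
     (4,[1,0,4,6,9,5,8,3,2,10,7]), (4,[7,1,9,8,2,10,6,4,0,3,5]), (7,[0,3,8,6,5,9,7,1,10,2,4]),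
     (7,[3,2,7,10,8,5,6,9,1,4,0]), (7,[1,0,7,6,4,8,5,3,9,10,2]), (7,[3,2,9,6,10,5,8,0,4,7,1]),
     (7,[8,7,0,1,2,5,10,4,6,9,3]), (7,[6,5,8,0,10,1,9,4,2,7,3]), (10,[8,7,10,5,1,2,0,9,3,6,4]),
     (7,[1,10,3,7,6,4,2,5,8,0,9]), (10,[6,10,1,7,4,3,2,0,5,9,8]), (8,[9,6,4,3,7,2,1,8,0,10,5]),
     (10,[9,7,4,0,5,2,1,3,8,6,10]), (9,[8,10,1,3,5,2,4,0,7,9,6]), (4,[7,6,1,0,4,2,10,8,5,9,3]),
     (4,[2,3,8,9,5,10,6,1,0,7,4]), (5,[0,2,7,4,5,10,6,9,1,3,8]), (6,[1,3,9,7,5,8,6,4,0,2,10])]"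
    "[(4,[10,6,4,3,1,8,2,7,9,5,0]), (4,[4,6,9,0,1,2,10,7,3,8,5]), (4,[8,10,5,4,2,6,7,1,3,9,0]),
     (4,[7,2,8,9,6,4,10,1,5,0,3]), (5,[0,8,5,7,6,2,4,10,9,1,3]), (7,[7,6,1,0,5,9,2,4,8,10,3]),
     (7,[4,1,9,7,8,5,6,3,0,2,10]), (7,[9,0,7,4,6,3,5,1,2,8,10]), (7,[1,2,9,8,4,10,7,3,6,5,0]),
     (7,[8,10,6,3,5,4,7,2,0,9,1]), (7,[3,5,0,9,1,2,7,10,4,8,6]), (4,[1,0,4,7,5,8,3,6,10,2,9]),
     (4,[0,10,4,6,5,8,3,7,9,1,2]), (5,[4,3,7,8,6,10,1,5,0,9,2]), (5,[8,7,2,10,9,6,1,3,4,0,5]),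
     (6,[7,8,3,10,0,4,2,9,6,5,1]), (6,[10,8,1,5,6,3,9,7,4,0,2]), (4,[3,2,7,6,8,9,10,1,0,4,5]),
     (4,[1,0,5,7,6,3,8,9,4,10,2]), (2,[3,5,4,9,10,8,7,6,0,2,1]), (2,[8,7,9,3,1,5,0,2,6,10,4])]"]) code_simp

definition graph_34 :: "nat \<times> (nat \<times> nat) list" where
  "graph_34 = (12,
    [(0,1), (0,2), (0,6), (1,3), (1,7), (2,3), (2,7), (3,6), (4,5), (4,8), (4,9), (5,10), (5,11),
     (6,8), (6,9), (7,10), (7,11), (8,10), (8,11), (9,10), (9,11)])"

lemma MMNA_graph_34: "MMNA (case_prod list_graph graph_34)"
  by (rule MMNA_certified[of graph_34
    "[([],[4,10,11,5,8,9]), ([],[4,10,11,5,8,9]), ([],[4,10,11,5,8,9]), ([],[4,10,11,5,8,9]),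
     ([(0,6), (0,1)],[0,10,11,7,8,9]), ([(0,6), (2,7)],[0,10,11,2,8,9]), ([],[4,10,11,5,8,9]),
     ([],[4,10,11,5,8,9]), ([(9,10), (7,9)],[0,3,7,1,2,6]), ([(8,11), (7,8)],[0,3,7,1,2,6]),
     ([(7,11), (7,9)],[0,3,7,1,2,6]), ([(6,8), (6,10)],[0,3,7,1,2,6])]"
    "[(8,[7,2,10,0,4,5,1,11,8,6,9,3]), (8,[11,8,7,9,2,3,0,6,10,4,1,5]),
     (8,[6,9,5,10,1,3,11,8,7,0,4,2]), (8,[11,5,0,1,7,3,10,2,8,6,9,4]),
     (8,[6,1,10,11,4,8,2,9,0,5,7,3]), (8,[7,11,6,9,3,4,8,0,10,2,1,5]),
     (8,[6,3,4,2,9,10,5,1,0,11,8,7]), (8,[4,0,3,1,7,9,11,5,2,8,6,10]),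
     (6,[7,6,4,8,1,9,5,3,11,0,10,2]), (6,[4,3,6,7,1,0,8,5,9,11,2,10]),
     (6,[11,1,9,10,4,6,0,2,3,7,8,5]), (6,[2,4,5,6,10,9,3,7,1,11,0,8]),
     (6,[8,0,10,11,4,6,9,1,7,5,2,3]), (9,[6,9,4,8,1,2,7,3,11,5,10,0]),
     (8,[3,4,8,5,10,0,6,2,7,11,1,9]), (11,[1,9,0,2,8,5,3,11,7,4,6,10]),
     (10,[6,9,4,8,1,2,10,7,0,3,5,11]), (6,[2,3,1,4,9,8,10,6,11,0,7,5]),
     (6,[1,9,10,11,3,7,4,0,6,2,5,8]), (6,[8,0,9,10,4,6,5,11,1,3,7,2]),
     (6,[8,0,9,11,3,5,4,7,6,2,1,10])]"
    "[(8,[7,11,3,2,10,5,1,6,8,0,4,9]), (8,[4,2,8,1,10,11,7,3,5,9,6,0]),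
     (8,[5,6,4,3,11,0,7,2,10,9,1,8]), (8,[2,5,4,11,8,10,6,3,9,1,0,7]),
     (8,[3,0,5,6,8,11,2,1,4,9,10,7]), (8,[10,9,5,11,3,2,0,8,7,4,6,1]),
     (8,[6,1,0,4,10,11,5,2,3,8,7,9]), (8,[3,4,10,1,6,8,2,9,7,0,11,5]),
     (6,[5,6,2,1,10,3,0,4,8,11,9,7]), (6,[3,2,4,1,11,10,7,6,5,8,0,9]),
     (6,[3,2,4,11,7,10,8,0,6,1,5,9]), (6,[9,10,1,0,3,6,11,8,5,2,7,4]),
     (6,[9,8,10,11,4,0,1,6,3,5,2,7]), (6,[4,5,3,7,11,8,6,2,10,0,1,9]),
     (6,[7,6,3,4,11,10,8,5,0,2,1,9]), (7,[5,9,7,10,1,3,0,8,4,2,11,6]),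
     (7,[5,3,2,4,9,0,6,8,7,1,11,10]), (0,[10,1,0,3,6,7,11,2,9,5,4,8]),
     (0,[7,2,3,5,10,11,8,1,9,6,0,4]), (0,[9,7,8,6,3,2,5,10,4,0,11,1]),
     (0,[9,2,0,10,5,4,11,1,8,7,3,6])]"]) code_simp

definition graph_35 :: "nat \<times> (nat \<times> nat) list" where
  "graph_35 = (12,
    [(0,1), (0,2), (0,7), (1,3), (1,8), (2,3), (2,8), (3,7), (4,5), (4,6), (4,11), (5,9), (5,10),
     (6,9), (6,10), (7,9), (7,11), (8,10), (8,11), (9,11), (10,11)])"

lemma MMNA_graph_35: "MMNA (case_prod list_graph graph_35)"
  by (rule MMNA_certified[of graph_35
    "[([],[4,9,10,5,6,11]), ([],[4,9,10,5,6,11]), ([],[4,9,10,5,6,11]), ([],[4,9,10,5,6,11]),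
     ([(8,11)],[0,3,8,1,2,7]), ([(7,11)],[0,3,8,1,2,7]), ([(8,11)],[0,3,8,1,2,7]),
     ([],[4,9,10,5,6,11]), ([],[4,9,10,5,6,11]), ([(7,11)],[0,3,8,1,2,7]), ([(7,11)],[0,3,8,1,2,7]),
     ([(5,9), (5,7), (5,10)],[0,3,8,1,2,5])]"
    "[(4,[8,11,9,5,10,3,2,6,0,7,1,4]), (4,[7,6,3,2,1,9,10,0,5,11,8,4]),
     (4,[11,0,9,8,2,6,4,7,10,5,1,3]), (4,[2,10,3,1,11,5,9,0,8,6,7,4]),
     (4,[0,2,11,3,9,6,4,1,10,5,8,7]), (4,[4,5,9,1,2,8,11,3,6,10,7,0]),
     (4,[9,6,7,8,2,1,0,10,5,3,11,4]), (4,[1,4,5,3,8,9,7,0,2,10,6,11]),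
     (0,[6,2,3,5,9,4,10,7,1,8,0,11]), (0,[4,0,11,2,9,8,5,3,1,6,7,10]),
     (0,[2,5,6,1,8,9,7,3,4,0,10,11]), (0,[4,10,8,9,1,2,3,7,11,6,5,0]),
     (0,[3,8,10,7,2,0,1,6,9,11,4,5]), (0,[5,4,3,7,11,9,0,2,6,8,10,1]),
     (0,[2,0,8,10,6,5,3,11,9,4,7,1]), (11,[6,7,1,4,10,9,0,5,2,8,11,3]),
     (9,[6,8,11,10,7,4,1,9,0,2,3,5]), (11,[5,6,4,2,10,1,11,8,3,0,9,7]),
     (10,[7,1,10,0,5,4,6,9,11,3,2,8]), (7,[8,5,7,9,0,4,3,6,10,2,1,11]),
     (8,[1,11,2,0,5,8,9,3,10,6,7,4])]"
    "[(4,[6,0,10,8,9,1,3,7,11,5,2,4]), (4,[8,11,6,0,3,2,4,1,9,5,10,7]),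
     (4,[6,4,2,3,7,8,11,10,1,9,0,5]), (4,[8,9,4,6,0,1,3,7,10,5,2,11]),
     (4,[8,6,9,10,11,2,3,7,5,1,0,4]), (4,[1,8,10,3,6,2,4,11,9,0,7,5]),
     (4,[6,5,4,7,2,0,11,3,9,1,10,8]), (4,[9,10,8,5,6,2,0,4,7,11,1,3]),
     (0,[8,1,0,2,5,7,9,10,11,6,3,4]), (0,[11,7,4,6,10,2,0,8,5,1,3,9]),
     (7,[4,7,5,3,2,11,9,6,8,10,1,0]), (0,[7,0,10,11,5,6,3,9,1,4,2,8]),
     (0,[5,6,7,4,2,0,1,9,11,10,8,3]), (0,[1,4,6,7,2,0,10,8,5,11,9,3]),
     (0,[7,6,10,8,0,1,11,5,4,2,9,3]), (7,[5,6,3,2,7,11,9,1,4,10,8,0]),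
     (7,[4,8,3,6,1,10,2,0,7,11,9,5]), (8,[2,5,1,0,6,8,11,3,9,7,10,4]),
     (8,[8,2,4,3,0,10,11,5,7,1,9,6]), (0,[5,3,1,2,7,6,8,4,10,11,9,0]),
     (0,[8,0,9,11,3,1,5,7,10,2,6,4])]"]) code_simp

text \<open>A K33 without the edge 8-9 and a full K33, with 8 and 9 joined to two vertices 10 and 11
  on one side of the latter.\<close>

definition graph_36 :: "nat \<times> (nat \<times> nat) list" where
  "graph_36 = (12,
    [(0,5), (0,6), (0,7), (1,2), (1,3), (1,8), (2,4), (2,9), (3,4), (3,9), (4,8), (5,10), (5,11),
     (6,10), (6,11), (7,10), (7,11), (8,10), (8,11), (9,10), (9,11)])"

lemma MMNA_graph_36: "MMNA (case_prod list_graph graph_36)"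
  by (rule MMNA_certified[of graph_36
    "[([(8,11)],[1,4,9,2,3,8]), ([],[0,10,11,5,6,7]), ([],[0,10,11,5,6,7]), ([],[0,10,11,5,6,7]),
     ([],[0,10,11,5,6,7]), ([(8,10)],[1,4,9,2,3,8]), ([(9,11)],[1,4,9,2,3,8]),
     ([(9,10)],[1,4,9,2,3,8]), ([],[0,10,11,5,6,7]), ([],[0,10,11,5,6,7]), ([(8,11)],[1,4,9,2,3,8]),
     ([(9,10)],[1,4,9,2,3,8])]"
    "[(1,[2,11,9,7,8,0,1,3,6,4,5,10]), (1,[10,0,3,4,5,8,1,11,6,2,9,7]),
     (1,[2,11,6,9,8,3,1,0,7,5,10,4]), (0,[6,0,10,1,11,7,4,5,3,9,2,8]),
     (0,[2,4,1,0,3,9,8,7,5,10,11,6]), (0,[6,4,5,9,8,2,0,1,10,3,7,11]),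
     (0,[1,11,7,2,0,4,9,5,10,6,8,3]), (0,[10,6,5,7,4,11,1,9,8,2,3,0]),
     (0,[4,8,5,6,3,0,10,1,9,7,2,11]), (0,[5,1,0,2,3,7,8,6,10,4,9,11]),
     (0,[0,1,7,8,6,3,4,10,11,5,9,2]), (1,[2,1,9,6,5,11,0,3,4,8,7,10]),
     (1,[1,7,8,9,10,0,3,2,4,6,11,5]), (1,[9,11,2,1,3,6,7,10,4,5,0,8]),
     (1,[5,4,7,8,9,3,0,11,10,2,1,6]), (1,[3,10,7,9,11,2,4,5,1,8,0,6]),
     (1,[8,9,0,3,2,5,10,6,4,1,7,11]), (11,[3,1,2,7,4,8,10,9,6,0,11,5]),
     (10,[5,1,2,10,11,8,4,6,0,3,7,9]), (11,[3,9,11,0,2,8,7,6,4,1,5,10]),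
     (10,[2,1,0,10,7,4,8,5,3,11,9,6])]"
    "[(1,[5,11,2,8,1,4,10,6,7,0,3,9]), (1,[7,8,2,1,3,9,11,5,4,0,6,10]),
     (1,[0,9,10,4,5,1,7,3,8,2,6,11]), (0,[10,1,0,9,11,6,4,7,2,8,3,5]),
     (0,[2,10,11,1,0,8,6,5,9,3,4,7]), (0,[7,0,11,8,9,4,2,1,3,10,6,5]),
     (0,[10,4,1,2,3,8,7,11,6,5,0,9]), (0,[0,8,9,7,5,10,3,1,4,6,11,2]),
     (0,[2,3,5,4,1,11,8,9,0,6,7,10]), (0,[3,10,5,11,4,8,1,0,6,7,2,9]),
     (0,[0,10,5,11,9,7,8,2,3,4,1,6]), (1,[0,8,4,3,6,7,1,11,2,9,5,10]),
     (1,[0,4,9,7,8,3,5,1,10,6,11,2]), (1,[11,6,7,8,5,10,2,0,3,9,4,1]),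
     (1,[1,11,6,4,5,2,9,0,10,8,3,7]), (1,[6,11,10,2,1,4,8,7,9,0,5,3]),
     (1,[10,8,5,3,4,11,7,1,6,2,0,9]), (8,[1,3,11,2,0,10,8,5,6,4,9,7]),
     (8,[0,6,1,7,5,11,8,10,3,2,9,4]), (9,[6,4,0,1,3,7,5,10,9,11,2,8]),
     (9,[3,7,10,6,8,1,11,2,5,4,0,9])]"]) code_simp

section \<open>Pairwise non-isomorphism and the count\<close>

definition graphs :: "(nat \<times> (nat \<times> nat) list) list" where
  "graphs =
    [graph_1, graph_2, graph_3, graph_4, graph_5, graph_6, graph_7, graph_8, graph_9, graph_10,
     graph_11, graph_12, graph_13, graph_14, graph_15, graph_16, graph_17, graph_18, graph_19,
     graph_20, graph_21, graph_22, graph_23, graph_24, graph_25, graph_26, graph_27, graph_28,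
     graph_29, graph_30, graph_31, graph_32, graph_33, graph_34, graph_35, graph_36]"

lemma MMNA_graphs: "\<forall>X\<in>set graphs. MMNA (case_prod list_graph X)"
  unfolding graphs_def list.set ball_simps
  by (intro conjI TrueI
    MMNA_graph_1 MMNA_graph_2 MMNA_graph_3 MMNA_graph_4 MMNA_graph_5 MMNA_graph_6 MMNA_graph_7
    MMNA_graph_8 MMNA_graph_9 MMNA_graph_10 MMNA_graph_11 MMNA_graph_12 MMNA_graph_13
    MMNA_graph_14 MMNA_graph_15 MMNA_graph_16 MMNA_graph_17 MMNA_graph_18 MMNA_graph_19
    MMNA_graph_20 MMNA_graph_21 MMNA_graph_22 MMNA_graph_23 MMNA_graph_24 MMNA_graph_25
    MMNA_graph_26 MMNA_graph_27 MMNA_graph_28 MMNA_graph_29 MMNA_graph_30 MMNA_graph_31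
    MMNA_graph_32 MMNA_graph_33 MMNA_graph_34 MMNA_graph_35 MMNA_graph_36)

lemma distinct_degree_lists: "distinct (map (case_prod degree_list) graphs)"
  by code_simp

lemma graphs_increasing: "list_all (\<lambda>X. distinct (snd X) \<and> list_all (\<lambda>(a, b). a < b) (snd X)) graphs"
  by code_simp

lemma length_graphs: "length graphs = 36"
  by (simp add: graphs_def)

text \<open>Equality of the encodings is concluded, so this gives the pairwise non-isomorphism and,
  through reflexivity of \<open>graph_iso\<close>, also the injectivity needed for the
  cardinality.\<close>

lemma graph_iso_imp_eq:
  assumes "X \<in> set graphs" "Y \<in> set graphs"
    "graph_iso (case_prod list_graph X) (case_prod list_graph Y)"
  shows "X = Y"
proof -
  have deg: "degrees (case_prod list_graph Z) = mset (case_prod degree_list Z)" if "Z \<in> set graphs" for Z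
  proof -
    have "distinct (snd Z)" "\<forall>(a, b)\<in>set (snd Z). a < b"
      using graphs_increasing that by (simp_all add: list_all_iff)
    then show ?thesis by (simp add: case_prod_beta degrees_list_graph)
  qed
  have "wf_graph (case_prod list_graph X)"
    using MMNA_graphs assms(1) by (simp add: MMNA_def NA_def simple_imp_wf)
  then have "mset (case_prod degree_list X) = mset (case_prod degree_list Y)"
    using degrees_iso[OF assms(3)] deg assms(1,2) by simp
  \<comment> \<open>Degree lists are sorted, so they are determined by their multisets.\<close>
  then have "case_prod degree_list X = case_prod degree_list Y"
    by (simp add: case_prod_beta degree_list_def properties_for_sort)
  moreover have "inj_on (case_prod degree_list) (set graphs)"
    using distinct_degree_lists by (simp only: distinct_map)
  ultimately show ?thesis using assms(1,2) by (meson inj_onD)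
qed

theorem mainTheorem11:
  "\<exists>\<G> :: nat graph set. card \<G> = 36 \<and> (\<forall>G\<in>\<G>. MMNA G) \<and>
     pairwise (\<lambda>G H. \<not> graph_iso G H) \<G>"
proof (intro exI conjI)
  let ?\<G> = "case_prod list_graph ` set graphs"
  have refl: "graph_iso G G" for G :: "nat graph"
    unfolding graph_iso_def by (intro exI[of _ id]) simp
  have "inj_on (case_prod list_graph) (set graphs)"
    using graph_iso_imp_eq refl by (metis (no_types, lifting) inj_onI)
  moreover have "distinct graphs"
    using distinct_degree_lists by (simp add: distinct_map)
  ultimately show "card ?\<G> = 36"
    by (simp add: card_image distinct_card length_graphs)
  show "\<forall>G\<in>?\<G>. MMNA G" using MMNA_graphs by simp
  show "pairwise (\<lambda>G H. \<not> graph_iso G H) ?\<G>"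
    unfolding pairwise_def using graph_iso_imp_eq by blast
qed

end
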